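(* If $T\colon I\to I$, $I=[0,1]$, is a tame topologically exact topological Collet--Eckmann map and $\psi\colon I\to\mathbb{R}$ is a H\"older continuous potential, then for the dynamical system $(T\colon I\to I,\mu_\psi)$ we have $$\limsup_{r\to0}\ \tau_{B(y,r)}(x)\cdot\mu_\psi(B(y,r))=+\infty$$ for $\mu_\psi$-a.e. $y\in I$ and $\mu_\psi$-a.e. $x\in I$.
   Context: A $C^3$ map $T\colon I\to I$ is a topologically exact topological Collet--Eckmann map if: (a) $T$ has only finitely many maximal closed intervals of monotonicity; equivalently, the set $\mathrm{Crit}(T)=\{x\in I:T'(x)=0\}$ is finite; (b) $T$ is topologically exact: for every nonempty open $U\subset I$ there is $n\ge0$ with $T^n(U)=I$; (c) all critical points are non-flat (near each critical point $c$, up to local $C^3$ changes of coordinates near $c$ and $T(c)$, $|T|$ is a power map $x\mapsto|x|^{\ell}$ for some $\ell>1$); (d) $\inf\{|(T^n)'(x)|^{1/n}: n\ge1,\ T^n(x)=x\}>1$. $\mathrm{PC}(T):=\bigcup_{n\ge1}T^n(\mathrm{Crit}(T))$; $T$ is tame if $\overline{\mathrm{PC}(T)}\ne I$. Let $\mathcal{L}_\psi g(x)=\sum_{y\in T^{-1}(x)}g(y)e^{\psi(y)}$ be the transfer operator, $\mathcal{L}_\psi^*$ its dual, and $P(\psi)$ the topological pressure of $\psi$. There is a Borel probability measure $m_\psi$ on $I$ with $\mathcal{L}_\psi^*m_\psi=e^{P(\psi)}m_\psi$, and $\mathrm{supp}(m_\psi)=I$; $\mu_\psi$ is the unique Borel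 $T$-invariant probability measure absolutely continuous with respect to $m_\psi$ (it is equivalent to $m_\psi$). $\tau_U(x):=\inf\{k\ge1:T^k(x)\in U\}$; $B(y,r)$ is the ball of radius $r$ about $y$ in $I$. *)

theory Defs
  imports "HOL-Probability.Probability"
begin

text \<open>The unit interval is the set \<open>{0..1}\<close>; maps on it are functions on \<open>real\<close> of which
  only the values on \<open>{0..1}\<close> matter.\<close>

abbreviation unit_ivl :: "real set" where
  "unit_ivl \<equiv> {0..1}"

text \<open>Derivatives are taken within \<open>S\<close>, hence one-sided at the end points of a closed interval.\<close>

definition C3_on :: "real set \<Rightarrow> (real \<Rightarrow> real) \<Rightarrow> bool" where
  "C3_on S f \<longleftrightarrow> (\<exists>f1 f2 f3.
     (\<forall>x\<in>S. (f has_real_derivative f1 x) (at x within S)) \<and>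
     (\<forall>x\<in>S. (f1 has_real_derivative f2 x) (at x within S)) \<and>
     (\<forall>x\<in>S. (f2 has_real_derivative f3 x) (at x within S)) \<and>
     continuous_on S f3)"

definition deriv_ivl :: "(real \<Rightarrow> real) \<Rightarrow> real \<Rightarrow> real" where
  "deriv_ivl f x = vector_derivative f (at x within unit_ivl)"

definition Crit :: "(real \<Rightarrow> real) \<Rightarrow> real set" where
  "Crit T = {x \<in> unit_ivl. deriv_ivl T x = 0}"

definition C3_diffeo :: "real set \<Rightarrow> real set \<Rightarrow> (real \<Rightarrow> real) \<Rightarrow> bool" where
  "C3_diffeo U V f \<longleftrightarrow> open U \<and> open V \<and> C3_on U f \<and> f ` U = V \<and>
     (\<exists>g. C3_on V g \<and> g ` V = U \<and> (\<forall>x\<in>U. g (f x) = x) \<and> (\<forall>y\<in>V. f (g y) = y))"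

text \<open>The coordinate changes \<open>\<phi>\<close> and \<open>\<eta>\<close> are defined on neighbourhoods in the real line, also when
  \<open>c\<close> or \<open>T c\<close> is an end point; the identity is required on the side lying in \<open>{0..1}\<close>.\<close>

definition nonflat_at :: "(real \<Rightarrow> real) \<Rightarrow> real \<Rightarrow> bool" where
  "nonflat_at T c \<longleftrightarrow> (\<exists>l U U' V V' \<phi> \<eta>. l > 1 \<and>
     C3_diffeo U U' \<phi> \<and> c \<in> U \<and> \<phi> c = 0 \<and>
     C3_diffeo V V' \<eta> \<and> T c \<in> V \<and> \<eta> (T c) = 0 \<and>
     (\<forall>\<^sub>F x in at c within unit_ivl. \<bar>\<eta> (T x)\<bar> = \<bar>\<phi> x\<bar> powr l))"

definition topologically_exact :: "(real \<Rightarrow> real) \<Rightarrow> bool" where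
  "topologically_exact T \<longleftrightarrow>
     (\<forall>U. openin (top_of_set unit_ivl) U \<and> U \<noteq> {} \<longrightarrow> (\<exists>n. (T ^^ n) ` U = unit_ivl))"

text \<open>The set in the last condition is bounded below by \<open>0\<close>, and it is nonempty because a continuous
  self-map of the interval has a fixed point; so the real-valued \<open>Inf\<close> is the actual infimum.\<close>

definition exact_TCE :: "(real \<Rightarrow> real) \<Rightarrow> bool" where
  "exact_TCE T \<longleftrightarrow> T ` unit_ivl \<subseteq> unit_ivl \<and> C3_on unit_ivl T \<and>
     finite (Crit T) \<and>
     topologically_exact T \<and>
     (\<forall>c\<in>Crit T. nonflat_at T c) \<and>
     Inf {root n \<bar>deriv_ivl (T ^^ n) x\<bar> | n x. n \<ge> 1 \<and> x \<in> unit_ivl \<and> (T ^^ n) x = x} > 1"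

definition post_critical :: "(real \<Rightarrow> real) \<Rightarrow> real set" where
  "post_critical T = (\<Union>n\<in>{1..}. (T ^^ n) ` Crit T)"

definition tame :: "(real \<Rightarrow> real) \<Rightarrow> bool" where
  "tame T \<longleftrightarrow> closure (post_critical T) \<noteq> unit_ivl"

definition holder_continuous_on :: "real set \<Rightarrow> (real \<Rightarrow> real) \<Rightarrow> bool" where
  "holder_continuous_on S f \<longleftrightarrow> (\<exists>\<alpha> C. 0 < \<alpha> \<and> \<alpha> \<le> 1 \<and>
     (\<forall>x\<in>S. \<forall>y\<in>S. \<bar>f x - f y\<bar> \<le> C * \<bar>x - y\<bar> powr \<alpha>))"

definition birkhoff_sum :: "(real \<Rightarrow> real) \<Rightarrow> (real \<Rightarrow> real) \<Rightarrow> nat \<Rightarrow> real \<Rightarrow> real" where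
  "birkhoff_sum T \<psi> n x = (\<Sum>k<n. \<psi> ((T ^^ k) x))"

definition separated :: "(real \<Rightarrow> real) \<Rightarrow> nat \<Rightarrow> real \<Rightarrow> real set \<Rightarrow> bool" where
  "separated T n \<epsilon> E \<longleftrightarrow> E \<subseteq> unit_ivl \<and>
     (\<forall>x\<in>E. \<forall>y\<in>E. x \<noteq> y \<longrightarrow> (\<exists>k<n. dist ((T ^^ k) x) ((T ^^ k) y) > \<epsilon>))"

text \<open>Topological pressure via \<open>(n, \<epsilon>)\<close>-separated sets. For continuous \<open>T\<close> and \<open>n \<ge> 1\<close> such sets have
  bounded cardinality, so the inner supremum is a finite real number. The outer supremum over \<open>\<epsilon>\<close>
  is the limit as \<open>\<epsilon>\<close> tends to \<open>0\<close>, by monotonicity. For Lipschitz \<open>T\<close> and bounded \<open>\<psi>\<close> it is finite,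
  so \<open>real_of_ereal\<close> loses nothing.\<close>

definition pressure :: "(real \<Rightarrow> real) \<Rightarrow> (real \<Rightarrow> real) \<Rightarrow> real" where
  "pressure T \<psi> = real_of_ereal (SUP \<epsilon>\<in>{0<..}. limsup (\<lambda>n. ereal
     (ln (SUP E\<in>{E. finite E \<and> separated T n \<epsilon> E}. \<Sum>x\<in>E. exp (birkhoff_sum T \<psi> n x)) / real n)))"

text \<open>The fibres of \<open>T\<close> are finite whenever \<open>Crit T\<close> is, by Rolle's theorem.\<close>

definition transfer_op :: "(real \<Rightarrow> real) \<Rightarrow> (real \<Rightarrow> real) \<Rightarrow> (real \<Rightarrow> real) \<Rightarrow> real \<Rightarrow> real" where
  "transfer_op T \<psi> g x = (\<Sum>y\<in>{y \<in> unit_ivl. T y = x}. g y * exp (\<psi> y))"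

definition prob_on_ivl :: "real measure \<Rightarrow> bool" where
  "prob_on_ivl M \<longleftrightarrow> prob_space M \<and> sets M = sets (restrict_space borel unit_ivl)"

text \<open>The eigenvalue equation for the dual operator, tested on functions. The transfer operator of
  an interval map need not preserve continuity (the number of preimages jumps at images of turning
  points and of end points), so it acts on bounded Borel functions.\<close>

definition dual_eigenmeasure ::
    "(real \<Rightarrow> real) \<Rightarrow> (real \<Rightarrow> real) \<Rightarrow> real \<Rightarrow> real measure \<Rightarrow> bool" where
  "dual_eigenmeasure T \<psi> c m \<longleftrightarrow>
     (\<forall>g\<in>borel_measurable m. bounded (g ` unit_ivl) \<longrightarrow>
        (\<integral>x. transfer_op T \<psi> g x \<partial>m) = c * (\<integral>x. g x \<partial>m))"

definition supp_ivl :: "real measure \<Rightarrow> real set" where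
  "supp_ivl m = {x \<in> unit_ivl. \<forall>r>0. emeasure m (ball x r \<inter> unit_ivl) > 0}"

definition invariant_measure :: "(real \<Rightarrow> real) \<Rightarrow> real measure \<Rightarrow> bool" where
  "invariant_measure T M \<longleftrightarrow> T \<in> measurable M M \<and> distr M M T = M"

text \<open>The first hitting time is \<open>\<infinity>\<close> if the orbit never enters \<open>U\<close>.\<close>

definition hitting_time :: "(real \<Rightarrow> real) \<Rightarrow> real set \<Rightarrow> real \<Rightarrow> enat" where
  "hitting_time T U x = Inf {enat k | k. k \<ge> 1 \<and> (T ^^ k) x \<in> U}"

end

theory Submission
  imports Defs
begin

text \<open>Fix \<open>y\<close> and a small ball \<open>B\<close> around it, the hole. If the orbit of \<open>x\<close> misses \<open>B\<close> at all times
  up to \<open>N / \<mu> B\<close>, then the hitting time of \<open>B\<close> times \<open>\<mu> B\<close> is at least \<open>N\<close>. So it suffices that, for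
  every \<open>N\<close>, almost every \<open>x\<close> misses arbitrarily small holes for that long. This holds because the
  system forgets its past fast enough: missing \<open>B\<close> for \<open>1 / (2 C m B)\<close> steps has probability at least
  \<open>1 / 2\<close> by the union bound, and doing so \<open>Q\<close> times in a row has probability at least \<open>\<delta> > 0\<close> with
  \<open>\<delta>\<close> independent of the size of the hole. Hence the set of points that miss infinitely many of the
  holes has measure at least \<open>\<delta>\<close>. It is backward invariant up to the preimages of \<open>y\<close>, and sets of
  positive measure spread over the whole interval, so it has full measure
  (\<open>late_mass\<close>, \<open>late_infinitely_often\<close>, \<open>hitting_time_limsup\<close>).

  The independence is extracted from hyperbolicity, in four steps.

  \<^item> Expansion. An interval whose iterates stay short for \<open>n\<close> steps soon afterwards covers everything
    and therefore contains a periodic point, whose multiplier is at least \<open>lam ^ n\<close>. Critical points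
    are not periodic, so the orbit of that point rarely comes close to them, and away from them
    derivative times length is almost the length of the image. So the interval was exponentially
    short (\<open>exponential_shrinking\<close>); consequently every component of a preimage of a short interval
    shrinks exponentially along its orbit (\<open>backward_contraction\<close>), and Birkhoff sums of a
    Hoelder potential vary by a bounded amount on it (\<open>bounded_distortion\<close>).

  \<^item> The potential. With \<open>\<phi> = \<psi> - P\<close> the measure \<open>m\<close> is conformal: on a set where \<open>T ^^ n\<close> is injective,
    \<open>m\<close> is multiplied by \<open>exp (- S n)\<close>, where \<open>S n\<close> is the Birkhoff sum. If \<open>S n\<close> did not become negative
    everywhere, arbitrarily small intervals would carry a fixed proportion of the mass, and one single
    orbit would have to enter every set of positive measure at all large times of a subsequence.
    So \<open>S n\<close> decays linearly (\<open>S_negative\<close>, \<open>S_decay\<close>), and the mass of short pullbacks decays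
    exponentially (\<open>narrow_preimage_mass\<close>).

  \<^item> Univalent branches. Cut the interval at the first \<open>R\<close> images of the critical points and of the end
    points. If \<open>T ^^ n\<close> does not map a neighbourhood of \<open>x\<close> injectively onto a cell, then
    some pullback along the orbit, of depth greater than \<open>R\<close>, contains a singular point. These pullbacks
    have small total mass. Hence preimages of sets have comparable mass
    (\<open>preimage_bound\<close>), and all but an exponentially small set of points see a univalent
    branch within any time window of length \<open>g\<close> (\<open>unexpanded_small\<close>).

  \<^item> Spreading. A positive proportion of a set that is a union of such branches reaches any given
    set at one common time (\<open>mass_of_branch_returns\<close>). The branches through points that miss the hole
    for \<open>n\<close> steps lie themselves in the set of points missing the hole, unless they pass
    very close to the two end points of the hole, and that costs little (\<open>boundary_loss\<close>,
    \<open>avoidance_spreads\<close>). The same mechanism gives \<open>positive_mass_spreads\<close> and hence a lower bound of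
    \<open>\<mu>\<close> by a multiple of \<open>m\<close> (\<open>invariant_measure_dominates\<close>), which makes \<open>N / \<mu> B\<close> a bounded
    multiple of \<open>1 / m B\<close>.\<close>

section \<open>Expanding interval maps\<close>

text \<open>A diameter bound for which the empty set needs no special treatment.\<close>

definition narrow :: "real \<Rightarrow> real set \<Rightarrow> bool" where
  "narrow d A \<longleftrightarrow> (\<forall>u\<in>A. \<forall>v\<in>A. \<bar>u - v\<bar> \<le> d)"

lemma narrowD: "narrow d A \<Longrightarrow> u \<in> A \<Longrightarrow> v \<in> A \<Longrightarrow> \<bar>u - v\<bar> \<le> d"
  by (auto simp: narrow_def)

lemma narrow_subset: "narrow d A \<Longrightarrow> B \<subseteq> A \<Longrightarrow> narrow d B"
  by (auto simp: narrow_def)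

lemma narrow_mono: "narrow d A \<Longrightarrow> d \<le> d' \<Longrightarrow> narrow d' A"
  by (force simp: narrow_def)

lemma finite_uniform_pos:
  fixes P :: "'a \<Rightarrow> real \<Rightarrow> bool"
  assumes "finite F" "\<And>x. x \<in> F \<Longrightarrow> \<exists>d>0. P x d"
    and "\<And>x d d'. P x d \<Longrightarrow> 0 < d' \<Longrightarrow> d' \<le> d \<Longrightarrow> P x d'"
  shows "\<exists>d>0. \<forall>x\<in>F. P x d"
  using assms(1,2)
proof (induction F rule: finite_induct)
  case empty
  then show ?case by (intro exI[of _ 1]) auto
next
  case (insert x F)
  then obtain d1 where d1: "d1 > 0" "\<forall>x\<in>F. P x d1" by auto
  obtain d2 where d2: "d2 > 0" "P x d2" using insert.prems by auto
  have "min d1 d2 > 0" using d1 d2 by auto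
  moreover have "\<forall>y\<in>insert x F. P y (min d1 d2)"
    using d1 d2 assms(3) by (metis insert_iff min.cobounded1 min.cobounded2 calculation)
  ultimately show ?case by blast
qed

text \<open>The properties of the map on which everything rests. The function \<open>T1\<close> is the
  derivative of \<open>T\<close> within the interval, and the last assumption bounds the multipliers of periodic
  points from below, with the chain rule already carried out. Non-flatness enters only through the comparison of
  derivative times length with the length of the image: near a critical point of order \<open>l\<close> the
  derivative is at most of order \<open>D ^ (l - 1)\<close>, where \<open>D\<close> is the largest distance of a
  point of the interval from the critical point, and the image has at least the length of the interval times
  this.\<close>

locale interval_map =
  fixes T T1 :: "real \<Rightarrow> real"
  assumes maps: "x \<in> {0..1} \<Longrightarrow> T x \<in> {0..1}"
    and deriv: "x \<in> {0..1} \<Longrightarrow> (T has_real_derivative T1 x) (at x within {0..1})"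
    and T1_cont: "continuous_on {0..1} T1"
    and crit_finite: "finite {x \<in> {0..1}. T1 x = 0}"
    and exact: "a \<in> {0..1} \<Longrightarrow> b \<in> {0..1} \<Longrightarrow> a < b \<Longrightarrow> \<exists>n. (T ^^ n) ` {a..b} = {0..1}"
    and surj: "T ` {0..1} = {0..1}"
    and nonflat: "c \<in> {0..1} \<Longrightarrow> T1 c = 0 \<Longrightarrow>
      \<exists>\<delta>>0. \<exists>K. \<forall>a b e. 0 \<le> a \<and> a \<le> e \<and> e \<le> b \<and> b \<le> 1 \<and> {a..b} \<subseteq> ball c \<delta> \<longrightarrow>
        (\<exists>u\<in>{a..b}. \<exists>v\<in>{a..b}. (b - a) * \<bar>T1 e\<bar> \<le> K * \<bar>T u - T v\<bar>)"
    and periodic: "\<exists>lam>1. \<forall>n\<ge>1. \<forall>x\<in>{0..1}. (T ^^ n) x = x \<longrightarrow>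
      lam ^ n \<le> (\<Prod>k<n. \<bar>T1 ((T ^^ k) x)\<bar>)"
begin

definition crit :: "real set" where "crit = {x \<in> {0..1}. T1 x = 0}"

lemma finite_crit: "finite crit"
  using crit_finite by (simp add: crit_def)

lemma crit_subset: "crit \<subseteq> {0..1}"
  by (auto simp: crit_def)

lemma funpow_maps: "x \<in> {0..1} \<Longrightarrow> (T ^^ n) x \<in> {0..1}"
  by (induction n) (use maps in auto)

lemma funpow_image_subset: "A \<subseteq> {0..1} \<Longrightarrow> (T ^^ n) ` A \<subseteq> {0..1}"
  using funpow_maps by blast

lemma T_cont: "continuous_on {0..1} T"
  using deriv by (meson DERIV_continuous continuous_on_eq_continuous_within)

lemma funpow_cont: "continuous_on {0..1} (T ^^ n)"
proof (induction n)
  case 0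
  then show ?case by (simp add: id_def)
next
  case (Suc n)
  have "continuous_on {0..1} (T \<circ> (T ^^ n))"
    by (rule continuous_on_compose[OF Suc continuous_on_subset[OF T_cont]])
      (use funpow_maps in auto)
  then show ?case by simp
qed

lemma funpow_cont_subset: "A \<subseteq> {0..1} \<Longrightarrow> continuous_on A (T ^^ n)"
  using funpow_cont continuous_on_subset by blast

lemma funpow_surj: "(T ^^ n) ` {0..1} = {0..1}"
proof (induction n)
  case (Suc n)
  have "(T ^^ Suc n) ` {0..1} = T ` ((T ^^ n) ` {0..1})" by (simp add: image_comp)
  then show ?case using Suc surj by simp
qed simp

lemma funpow_add_apply: "(T ^^ (m + n)) x = (T ^^ m) ((T ^^ n) x)"
  by (simp add: funpow_add)

lemma funpow_image_add: "(T ^^ (m + n)) ` A = (T ^^ m) ` ((T ^^ n) ` A)"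
  by (simp add: funpow_add image_comp)

lemma funpow_image_full:
  assumes "(T ^^ n) ` A = {0..1}" "n \<le> m"
  shows "(T ^^ m) ` A = {0..1}"
proof -
  have "(T ^^ m) ` A = (T ^^ (m - n)) ` ((T ^^ n) ` A)"
    using funpow_image_add[of "m - n" n A] assms(2) by simp
  then show ?thesis using assms(1) funpow_surj by simp
qed

text \<open>An iterate that is constant on a nondegenerate interval contradicts exactness.\<close>

lemma not_narrow_image:
  assumes "0 \<le> a" "a < b" "b \<le> 1"
  shows "\<exists>d>0. \<not> narrow d ((T ^^ m) ` {a..b})"
proof (rule ccontr)
  assume A: "\<not> ?thesis"
  have const: "(T ^^ m) u = (T ^^ m) a" if "u \<in> {a..b}" for u
  proof (rule ccontr)
    assume ne: "(T ^^ m) u \<noteq> (T ^^ m) a"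
    define d where "d = \<bar>(T ^^ m) u - (T ^^ m) a\<bar> / 2"
    have "d > 0" using ne by (simp add: d_def)
    moreover have "\<not> narrow d ((T ^^ m) ` {a..b})"
    proof
      assume "narrow d ((T ^^ m) ` {a..b})"
      then have "\<bar>(T ^^ m) u - (T ^^ m) a\<bar> \<le> d"
        by (rule narrowD) (use that assms in auto)
      then show False using \<open>d > 0\<close> by (simp add: d_def)
    qed
    ultimately show False using A by blast
  qed
  obtain n where n: "(T ^^ n) ` {a..b} = {0..1}" using exact[of a b] assms by auto
  have "(T ^^ (n + m)) ` {a..b} = {0..1}" by (rule funpow_image_full[OF n]) simp
  moreover have "(T ^^ (n + m)) u = (T ^^ n) ((T ^^ m) a)" if "u \<in> {a..b}" for u
    unfolding funpow_add_apply const[OF that] ..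
  then have "(T ^^ (n + m)) ` {a..b} \<subseteq> {(T ^^ n) ((T ^^ m) a)}" by blast
  ultimately have "{0..1::real} \<subseteq> {(T ^^ n) ((T ^^ m) a)}" by simp
  from subsetD[OF this, of 0] subsetD[OF this, of 1] show False by simp
qed

text \<open>All intervals of length at least \<open>r\<close> contain one of finitely many intervals of length
  \<open>1 / q\<close>, which makes the covering time uniform. At the finitely many earlier times the images of
  these intervals are not single points, and afterwards they are everything, so all of them are longer than some
  \<open>d\<close>.\<close>

lemma covering_time:
  assumes "r > 0"
  shows "\<exists>N d. d > 0 \<and> (\<forall>a b. 0 \<le> a \<and> b \<le> 1 \<and> r \<le> b - a \<longrightarrow>
    (\<forall>m\<ge>N. (T ^^ m) ` {a..b} = {0..1}) \<and> (\<forall>m. \<not> narrow d ((T ^^ m) ` {a..b})))"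
proof -
  obtain q :: nat where q: "q > 2 / r" using reals_Archimedean2 by blast
  have q0: "q > 0" using q assms by (metis divide_pos_pos less_trans of_nat_0_less_iff zero_less_numeral)
  have q2: "2 / q < r" using q assms q0 by (simp add: field_simps)
  \<comment> \<open>any interval of length greater than \<open>2 / q\<close> contains one of these\<close>
  define J where "J i = {real i / q .. (real i + 1) / q}" for i :: nat
  have Jpos: "real i / q < (real i + 1) / q" for i using q0 by (simp add: divide_strict_right_mono)
  have J01: "0 \<le> real i / q \<and> (real i + 1) / q \<le> 1" if "i < q" for i
  proof -
    have "real i + 1 \<le> real q" using that by linarith
    then show ?thesis using q0 by (simp add: field_simps)
  qed
  have "\<exists>n. (T ^^ n) ` J i = {0..1}" if "i < q" for i
    unfolding J_def by (rule exact) (use J01[OF that] Jpos[of i] in auto)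
  then obtain n where n: "\<And>i. i < q \<Longrightarrow> (T ^^ n i) ` J i = {0..1}" by metis
  define N where "N = Max (n ` {..<q})"
  have nN: "n i \<le> N" if "i < q" for i unfolding N_def by (rule Max_ge) (use that in auto)
  have full: "(T ^^ m) ` J i = {0..1}" if "i < q" "m \<ge> N" for i m
  proof -
    have "n i \<le> m" using that nN[of i] by linarith
    then show ?thesis using funpow_image_full[OF n[OF that(1)]] by blast
  qed
  have "\<exists>d>0. \<forall>p\<in>{..<q} \<times> {..<N}. \<not> narrow d ((T ^^ snd p) ` J (fst p))"
  proof (rule finite_uniform_pos[where P = "\<lambda>p d. \<not> narrow d ((T ^^ snd p) ` J (fst p))"])
    show "finite ({..<q} \<times> {..<N})" by simp
  next
    fix p :: "nat \<times> nat" assume "p \<in> {..<q} \<times> {..<N}"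
    then have p: "fst p < q" by auto
    show "\<exists>d>0. \<not> narrow d ((T ^^ snd p) ` J (fst p))"
      unfolding J_def
      by (rule not_narrow_image) (use J01[OF p] Jpos[of "fst p"] in auto)
  next
    fix p and d d' :: real
    assume "\<not> narrow d ((T ^^ snd p) ` J (fst p))" "d' \<le> d"
    then show "\<not> narrow d' ((T ^^ snd p) ` J (fst p))" using narrow_mono by blast
  qed
  then obtain d where d: "d > 0" "\<And>i m. i < q \<Longrightarrow> m < N \<Longrightarrow> \<not> narrow d ((T ^^ m) ` J i)"
    by (metis (no_types, lifting) SigmaI fst_conv lessThan_iff snd_conv)
  define d' where "d' = min d (1/2)"
  have nn: "\<not> narrow d' ((T ^^ m) ` J i)" if i: "i < q" for i m
  proof (cases "m < N")
    case True
    then show ?thesis using d(2)[OF i True] narrow_mono[of d' _ d] by (auto simp: d'_def)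
  next
    case False
    then have "(T ^^ m) ` J i = {0..1}" using full i by auto
    moreover have "\<not> narrow d' {0..1::real}"
    proof
      assume "narrow d' {0..1::real}"
      then have "\<bar>(1::real) - 0\<bar> \<le> d'" by (rule narrowD) auto
      then show False by (simp add: d'_def)
    qed
    ultimately show ?thesis by simp
  qed
  have inJ: "\<exists>i<q. J i \<subseteq> {a..b}" if ab: "0 \<le> a" "b \<le> 1" "r \<le> b - a" for a b
  proof -
    define i where "i = nat \<lceil>a * q\<rceil>"
    have aq: "0 \<le> a * q" using ab q0 by simp
    have i1: "a * q \<le> real i" "real i < a * q + 1" using aq unfolding i_def by linarith+
    have "(real i + 1) / q \<le> (a * q + 2) / q" using i1 by (intro divide_right_mono) auto
    then have e: "(real i + 1) / q \<le> a + 2 / q" using q0 by (simp add: add_divide_distrib)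
    have e2: "a \<le> real i / q" using i1 q0 by (simp add: field_simps)
    have e3: "(real i + 1) / q \<le> b" using e q2 ab by linarith
    then have "(real i + 1) / q \<le> 1" using ab by linarith
    then have "i < q" using q0 by (simp add: field_simps)
    then show ?thesis using e2 e3 by (auto simp: J_def intro!: exI[of _ i])
  qed
  show ?thesis
  proof (intro exI conjI allI impI)
    show "d' > 0" using d by (simp add: d'_def)
    fix a b :: real and m assume ab: "0 \<le> a \<and> b \<le> 1 \<and> r \<le> b - a"
    then obtain i where i: "i < q" "J i \<subseteq> {a..b}" using inJ by blast
    show "\<not> narrow d' ((T ^^ m) ` {a..b})"
      using nn[OF i(1), of m] narrow_subset[OF _ image_mono[OF i(2)]] by blast
    assume "N \<le> m"
    then have "{0..1} \<subseteq> (T ^^ m) ` {a..b}"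
      using full[OF i(1)] image_mono[OF i(2), of "T ^^ m"] by metis
    moreover have "(T ^^ m) ` {a..b} \<subseteq> {0..1}" by (rule funpow_image_subset) (use ab in auto)
    ultimately show "(T ^^ m) ` {a..b} = {0..1}" by blast
  qed
qed

section \<open>Exponential shrinking of intervals with short iterates\<close>

text \<open>The multiplier of a periodic orbit through a critical point would be \<open>0\<close>.\<close>

lemma crit_not_periodic:
  assumes "c \<in> crit" "n \<ge> 1"
  shows "(T ^^ n) c \<noteq> c"
proof
  assume p: "(T ^^ n) c = c"
  obtain lam where lam: "lam > 1" "\<forall>n\<ge>1. \<forall>x\<in>{0..1}. (T ^^ n) x = x \<longrightarrow>
      lam ^ n \<le> (\<Prod>k<n. \<bar>T1 ((T ^^ k) x)\<bar>)" using periodic by blast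
  have "lam ^ n \<le> (\<Prod>k<n. \<bar>T1 ((T ^^ k) c)\<bar>)"
    using lam(2) assms p by (auto simp: crit_def)
  also have "(\<Prod>k<n. \<bar>T1 ((T ^^ k) c)\<bar>) = 0"
    by (rule prod_zero[OF _ bexI[of _ 0]]) (use assms in \<open>auto simp: crit_def\<close>)
  finally show False using lam(1) by (smt (verit) zero_less_power)
qed

lemma critical_return_time:
  "\<exists>\<rho>>0. \<forall>c\<in>crit. \<forall>k\<in>{1..R}. \<forall>x\<in>{0..1}. \<bar>x - c\<bar> \<le> \<rho> \<longrightarrow> \<bar>(T ^^ k) x - c\<bar> > \<rho>"
proof -
  define P where "P p d = (\<forall>x\<in>{0..1}. \<bar>x - fst p\<bar> \<le> d \<longrightarrow> \<bar>(T ^^ snd p) x - fst p\<bar> > d)"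
    for p :: "real \<times> nat" and d :: real
  have "\<exists>d>0. \<forall>p\<in>crit \<times> {1..R}. P p d"
  proof (rule finite_uniform_pos[where P = P])
    show "finite (crit \<times> {1..R})" using finite_crit by simp
  next
    fix p assume p: "p \<in> crit \<times> {1..R}"
    obtain c k where ck: "p = (c, k)" "c \<in> crit" "k \<ge> 1" using p by (cases p) auto
    have c01: "c \<in> {0..1}" using ck crit_subset by auto
    define d0 where "d0 = \<bar>(T ^^ k) c - c\<bar>"
    have d0: "d0 > 0" using crit_not_periodic[OF ck(2,3)] by (simp add: d0_def)
    obtain e where e: "e > 0" "\<forall>x\<in>{0..1}. dist x c < e \<longrightarrow> dist ((T ^^ k) x) ((T ^^ k) c) < d0 / 2"
      using funpow_cont[of k] c01 d0 unfolding continuous_on_iff by (meson half_gt_zero)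
    have "P p (min (e / 2) (d0 / 4))"
      unfolding P_def
    proof (intro ballI impI)
      fix x :: real assume x: "x \<in> {0..1}" "\<bar>x - fst p\<bar> \<le> min (e / 2) (d0 / 4)"
      then have "dist x c < e" using e(1) ck by (auto simp: dist_real_def)
      then have "dist ((T ^^ k) x) ((T ^^ k) c) < d0 / 2" using e(2) x by blast
      then have "\<bar>(T ^^ k) x - c\<bar> > d0 / 2" unfolding dist_real_def d0_def by (smt (verit) field_sum_of_halves)
      then show "\<bar>(T ^^ snd p) x - fst p\<bar> > min (e / 2) (d0 / 4)" using ck d0 by (simp add: min_def)
    qed
    then show "\<exists>d>0. P p d" using e(1) d0 by (intro exI[of _ "min (e / 2) (d0 / 4)"]) auto
  next
    fix p d d' assume "P p d" "d' \<le> d"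
    then show "P p d'" unfolding P_def by force
  qed
  then show ?thesis unfolding P_def by auto
qed

lemma spaced_card:
  fixes J :: "nat set" and R n :: nat
  assumes "J \<subseteq> {..<n}" "\<And>i j. i \<in> J \<Longrightarrow> j \<in> J \<Longrightarrow> i < j \<Longrightarrow> j - i > R"
  shows "real (card J) \<le> real n / real (R + 1) + 1"
proof -
  have inj: "inj_on (\<lambda>j. j div (R + 1)) J"
  proof (rule linorder_inj_onI)
    fix i j assume ij: "i < j" "i \<in> J" "j \<in> J"
    have "i + (R + 1) \<le> j" using assms(2)[OF ij(2,3,1)] by linarith
    then have "(i + (R + 1)) div (R + 1) \<le> j div (R + 1)" by (rule div_le_mono)
    moreover have "(i + (R + 1)) div (R + 1) = i div (R + 1) + 1" by (rule div_add_self2) simp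
    ultimately show "i div (R + 1) \<noteq> j div (R + 1)" by linarith
  qed auto
  have "card J \<le> card {..n div (R + 1)}"
    by (rule card_inj_on_le[OF inj]) (use assms(1) in \<open>auto intro!: div_le_mono\<close>)
  then have "real (card J) \<le> real (n div (R + 1)) + 1" by simp
  also have "real (n div (R + 1)) \<le> real n / real (R + 1)" by (rule of_nat_div_le_of_nat)
  finally show ?thesis by (simp add: add.commute)
qed

definition visits :: "real \<Rightarrow> nat \<Rightarrow> real \<Rightarrow> nat set" where
  "visits \<rho> n x = {j. j < n \<and> (\<exists>c\<in>crit. \<bar>(T ^^ j) x - c\<bar> \<le> \<rho>)}"

text \<open>Near a critical point the orbit cannot return to the same critical point within \<open>R\<close>
  steps, so the visits to each of them are spaced.\<close>

lemma rare_critical_visits: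
  "\<exists>\<rho>>0. \<forall>x\<in>{0..1}. \<forall>n. real (card (visits \<rho> n x)) \<le> card crit * (real n / real (R + 1) + 1)"
proof -
  obtain \<rho> where \<rho>: "\<rho> > 0"
    "\<And>c k x. c \<in> crit \<Longrightarrow> k \<in> {1..R} \<Longrightarrow> x \<in> {0..1} \<Longrightarrow> \<bar>x - c\<bar> \<le> \<rho> \<Longrightarrow> \<bar>(T ^^ k) x - c\<bar> > \<rho>"
    using critical_return_time[of R] by blast
  have "real (card (visits \<rho> n x)) \<le> card crit * (real n / real (R + 1) + 1)" if x: "x \<in> {0..1}" for x n
  proof -
    define J where "J c = {j. j < n \<and> \<bar>(T ^^ j) x - c\<bar> \<le> \<rho>}" for c
    have "real (card (J c)) \<le> real n / real (R + 1) + 1" if c: "c \<in> crit" for c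
    proof (rule spaced_card)
      show "J c \<subseteq> {..<n}" by (auto simp: J_def)
      fix i j assume ij: "i \<in> J c" "j \<in> J c" "i < j"
      show "j - i > R"
      proof (rule ccontr)
        assume "\<not> ?thesis"
        then have "j - i \<in> {1..R}" using ij by auto
        then have "\<bar>(T ^^ (j - i)) ((T ^^ i) x) - c\<bar> > \<rho>"
          using \<rho>(2)[OF c _ funpow_maps[OF x], of "j - i" i] ij by (auto simp: J_def)
        moreover have "(T ^^ (j - i)) ((T ^^ i) x) = (T ^^ j) x"
          using funpow_add_apply[of "j - i" i x] ij by simp
        ultimately show False using ij by (auto simp: J_def)
      qed
    qed
    then have "(\<Sum>c\<in>crit. real (card (J c))) \<le> (\<Sum>c\<in>crit. real n / real (R + 1) + 1)" by (rule sum_mono)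
    moreover have "visits \<rho> n x = (\<Union>c\<in>crit. J c)" by (auto simp: visits_def J_def)
    moreover have "card (\<Union>c\<in>crit. J c) \<le> (\<Sum>c\<in>crit. card (J c))"
      by (rule card_UN_le[OF finite_crit])
    ultimately show ?thesis by (simp flip: of_nat_sum)
  qed
  then show ?thesis using \<rho>(1) by blast
qed

lemma T_deriv_sub: "x \<in> A \<Longrightarrow> A \<subseteq> {0..1} \<Longrightarrow> (T has_real_derivative T1 x) (at x within A)"
  using deriv DERIV_subset by blast

lemma T_mvt:
  assumes "0 \<le> a" "a \<le> b" "b \<le> 1"
  shows "\<exists>x\<in>{a..b}. T b - T a = T1 x * (b - a)"
proof -
  have "\<exists>x\<in>{a..b}. T b - T a = (\<lambda>h. T1 x * h) (b - a)"
    by (rule mvt_very_simple[of a b T "\<lambda>x h. T1 x * h"])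
      (use assms T_deriv_sub[of _ "{a..b}"] in \<open>auto simp: has_field_derivative_def\<close>)
  then show ?thesis by simp
qed

lemma T1_bound: "\<exists>L\<ge>1. \<forall>x\<in>{0..1}. \<bar>T1 x\<bar> \<le> L"
proof -
  have "compact (T1 ` {0..1})" by (rule compact_continuous_image[OF T1_cont]) simp
  then have "bounded (T1 ` {0..1})" by (rule compact_imp_bounded)
  then obtain B where "\<forall>x\<in>{0..1}. \<bar>T1 x\<bar> \<le> B" by (auto simp: bounded_iff)
  then show ?thesis by (intro exI[of _ "max B 1"]) force
qed

text \<open>Away from the critical points the derivative is bounded below, so by uniform continuity its relative
  variation over a short interval is small.\<close>

lemma derivative_length_bound_off_crit:
  assumes "\<rho> > 0" "\<kappa> > 0"
  shows "\<exists>r>0. \<forall>a e b. 0 \<le> a \<and> a \<le> e \<and> e \<le> b \<and> b \<le> 1 \<and> b - a \<le> r \<and>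
    (\<forall>c\<in>crit. \<forall>x\<in>{a..b}. \<bar>x - c\<bar> > \<rho>) \<longrightarrow> (b - a) * \<bar>T1 e\<bar> \<le> (1 + \<kappa>) * \<bar>T b - T a\<bar>"
proof -
  define S where "S = {x \<in> {0..1}. \<forall>c\<in>crit. \<rho> \<le> \<bar>x - c\<bar>}"
  have S_eq: "S = {0..1} \<inter> (\<Inter>c\<in>crit. {x. \<rho> \<le> \<bar>x - c\<bar>})" by (auto simp: S_def)
  have "closed {x. \<rho> \<le> \<bar>x - c\<bar>}" for c :: real
    by (intro closed_Collect_le continuous_intros)
  then have "compact S" unfolding S_eq by (intro compact_Int_closed) auto
  have "\<exists>\<tau>>0. \<forall>x\<in>S. \<tau> \<le> \<bar>T1 x\<bar>"
  proof (cases "S = {}")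
    case True
    then show ?thesis by (intro exI[of _ 1]) auto
  next
    case False
    have "continuous_on S (\<lambda>x. \<bar>T1 x\<bar>)"
      by (intro continuous_intros continuous_on_subset[OF T1_cont]) (auto simp: S_def)
    then obtain x where x: "x \<in> S" "\<forall>y\<in>S. \<bar>T1 x\<bar> \<le> \<bar>T1 y\<bar>"
      using continuous_attains_inf[OF \<open>compact S\<close> False] by blast
    have "T1 x \<noteq> 0"
    proof
      assume "T1 x = 0"
      then have "x \<in> crit" using x by (auto simp: crit_def S_def)
      then show False using x assms by (auto simp: S_def)
    qed
    then show ?thesis using x by (intro exI[of _ "\<bar>T1 x\<bar>"]) auto
  qed
  then obtain \<tau> where \<tau>: "\<tau> > 0" "\<And>x. x \<in> S \<Longrightarrow> \<tau> \<le> \<bar>T1 x\<bar>" by blast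
  have "uniformly_continuous_on {0..1} T1" by (rule compact_uniformly_continuous[OF T1_cont]) simp
  then obtain r where r: "r > 0" "\<And>x y. x \<in> {0..1} \<Longrightarrow> y \<in> {0..1} \<Longrightarrow> dist y x < r \<Longrightarrow> dist (T1 y) (T1 x) < \<kappa> * \<tau>"
    unfolding uniformly_continuous_on_def using \<tau>(1) assms(2) by (metis mult_pos_pos)
  show ?thesis
  proof (intro exI[of _ "r / 2"] conjI allI impI)
    show "r / 2 > 0" using r by simp
    fix a e b
    assume A: "0 \<le> a \<and> a \<le> e \<and> e \<le> b \<and> b \<le> 1 \<and> b - a \<le> r / 2 \<and>
      (\<forall>c\<in>crit. \<forall>x\<in>{a..b}. \<bar>x - c\<bar> > \<rho>)"
    obtain x where x: "x \<in> {a..b}" "T b - T a = T1 x * (b - a)" using T_mvt[of a b] A by auto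
    have "x \<in> S" using A x(1) by (force simp: S_def)
    then have "\<tau> \<le> \<bar>T1 x\<bar>" by (rule \<tau>)
    have "dist (T1 e) (T1 x) < \<kappa> * \<tau>"
      by (rule r(2)) (use A x(1) r(1) in \<open>auto simp: dist_real_def\<close>)
    then have "\<bar>T1 e\<bar> \<le> \<bar>T1 x\<bar> + \<kappa> * \<tau>" by (auto simp: dist_real_def)
    also have "\<dots> \<le> \<bar>T1 x\<bar> + \<kappa> * \<bar>T1 x\<bar>" using \<open>\<tau> \<le> _\<close> assms(2) by simp
    also have "\<dots> = (1 + \<kappa>) * \<bar>T1 x\<bar>" by (simp add: algebra_simps)
    finally have "(b - a) * \<bar>T1 e\<bar> \<le> (b - a) * ((1 + \<kappa>) * \<bar>T1 x\<bar>)"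
      using A by (intro mult_left_mono) auto
    also have "\<dots> = (1 + \<kappa>) * \<bar>T b - T a\<bar>" using A by (simp add: x(2) abs_mult)
    finally show "(b - a) * \<bar>T1 e\<bar> \<le> (1 + \<kappa>) * \<bar>T b - T a\<bar>" .
  qed
qed

text \<open>The same with a constant in place of \<open>1 + \<kappa>\<close>, now for all short intervals; close
  to a critical point it is non-flatness. The image of \<open>{a..b}\<close> need not have \<open>T a\<close>
  and \<open>T b\<close> as its end points, whence \<open>u\<close> and \<open>v\<close>.\<close>

lemma derivative_length_bound:
  "\<exists>r>0. \<exists>K\<ge>1. \<forall>a e b. 0 \<le> a \<and> a \<le> e \<and> e \<le> b \<and> b \<le> 1 \<and> b - a \<le> r \<longrightarrow>
    (\<exists>u\<in>{a..b}. \<exists>v\<in>{a..b}. (b - a) * \<bar>T1 e\<bar> \<le> K * \<bar>T u - T v\<bar>)"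
proof -
  \<comment> \<open>using \<open>1 / d\<close> as the constant makes the property monotone in the single parameter \<open>d\<close>\<close>
  define P where "P c d = (\<forall>a b e. 0 \<le> a \<and> a \<le> e \<and> e \<le> b \<and> b \<le> 1 \<and> {a..b} \<subseteq> ball c d \<longrightarrow>
        (\<exists>u\<in>{a..b}. \<exists>v\<in>{a..b}. (b - a) * \<bar>T1 e\<bar> \<le> 1 / d * \<bar>T u - T v\<bar>))" for c d :: real
  have mono: "P c d'" if Pd: "P c d" "0 < d'" "d' \<le> d" for c d d'
    unfolding P_def
  proof (intro allI impI)
    fix a b e assume A: "0 \<le> a \<and> a \<le> e \<and> e \<le> b \<and> b \<le> 1 \<and> {a..b} \<subseteq> ball c d'"
    then have "{a..b} \<subseteq> ball c d" using Pd(3) by (meson order_trans subset_ball)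
    then obtain u v where uv: "u \<in> {a..b}" "v \<in> {a..b}" "(b - a) * \<bar>T1 e\<bar> \<le> 1 / d * \<bar>T u - T v\<bar>"
      using Pd(1) A unfolding P_def by blast
    have "1 / d * \<bar>T u - T v\<bar> \<le> 1 / d' * \<bar>T u - T v\<bar>"
      using Pd by (intro mult_right_mono divide_left_mono) auto
    with uv(3) have "(b - a) * \<bar>T1 e\<bar> \<le> 1 / d' * \<bar>T u - T v\<bar>" by linarith
    then show "\<exists>u\<in>{a..b}. \<exists>v\<in>{a..b}. (b - a) * \<bar>T1 e\<bar> \<le> 1 / d' * \<bar>T u - T v\<bar>"
      using uv by blast
  qed
  have "\<exists>d>0. \<forall>c\<in>crit. P c d"
  proof (rule finite_uniform_pos[where P = P])
    show "finite crit" by (rule finite_crit)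
    show "\<And>c d d'. P c d \<Longrightarrow> 0 < d' \<Longrightarrow> d' \<le> d \<Longrightarrow> P c d'" by (rule mono)
  next
    fix c assume "c \<in> crit"
    then obtain \<delta> K where dK: "\<delta> > 0" "\<And>a b e. 0 \<le> a \<and> a \<le> e \<and> e \<le> b \<and> b \<le> 1 \<and> {a..b} \<subseteq> ball c \<delta> \<Longrightarrow>
        (\<exists>u\<in>{a..b}. \<exists>v\<in>{a..b}. (b - a) * \<bar>T1 e\<bar> \<le> K * \<bar>T u - T v\<bar>)"
      using nonflat[of c] unfolding crit_def by blast
    define d where "d = min \<delta> (1 / max K 1)"
    have d: "d > 0" "d \<le> \<delta>" using dK(1) by (auto simp: d_def)
    have "1 / (1 / max K 1) \<le> 1 / d" using d(1) by (intro divide_left_mono) (auto simp: d_def)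
    then have K: "K \<le> 1 / d" by simp
    have "P c d"
      unfolding P_def
    proof (intro allI impI)
      fix a b e assume A: "0 \<le> a \<and> a \<le> e \<and> e \<le> b \<and> b \<le> 1 \<and> {a..b} \<subseteq> ball c d"
      then have "{a..b} \<subseteq> ball c \<delta>" using d(2) by (meson order_trans subset_ball)
      then obtain u v where uv: "u \<in> {a..b}" "v \<in> {a..b}" "(b - a) * \<bar>T1 e\<bar> \<le> K * \<bar>T u - T v\<bar>"
        using dK(2) A by blast
      have "K * \<bar>T u - T v\<bar> \<le> 1 / d * \<bar>T u - T v\<bar>" using K by (intro mult_right_mono) auto
      with uv(3) have "(b - a) * \<bar>T1 e\<bar> \<le> 1 / d * \<bar>T u - T v\<bar>" by linarith
      then show "\<exists>u\<in>{a..b}. \<exists>v\<in>{a..b}. (b - a) * \<bar>T1 e\<bar> \<le> 1 / d * \<bar>T u - T v\<bar>"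
        using uv by blast
    qed
    then show "\<exists>d>0. P c d" using d by blast
  qed
  then obtain d where d: "d > 0" "\<And>c. c \<in> crit \<Longrightarrow> P c d" by blast
  obtain r where r: "r > 0" "\<And>a e b. 0 \<le> a \<and> a \<le> e \<and> e \<le> b \<and> b \<le> 1 \<and> b - a \<le> r \<and>
    (\<forall>c\<in>crit. \<forall>x\<in>{a..b}. \<bar>x - c\<bar> > d / 3) \<Longrightarrow> (b - a) * \<bar>T1 e\<bar> \<le> (1 + 1) * \<bar>T b - T a\<bar>"
    using derivative_length_bound_off_crit[of "d / 3" 1] d(1) by auto
  have pos: "min r (d / 3) > 0" and ge1: "max 2 (1 / d) \<ge> 1" using r d by auto
  show ?thesis
  proof (rule exI[of _ "min r (d / 3)"], rule conjI[OF pos], rule exI[of _ "max 2 (1 / d)"],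
      rule conjI[OF ge1], intro allI impI)
    fix a e b assume A: "0 \<le> a \<and> a \<le> e \<and> e \<le> b \<and> b \<le> 1 \<and> b - a \<le> min r (d / 3)"
    show "\<exists>u\<in>{a..b}. \<exists>v\<in>{a..b}. (b - a) * \<bar>T1 e\<bar> \<le> max 2 (1 / d) * \<bar>T u - T v\<bar>"
    proof (cases "\<forall>c\<in>crit. \<forall>x\<in>{a..b}. \<bar>x - c\<bar> > d / 3")
      case True
      then have "(b - a) * \<bar>T1 e\<bar> \<le> 2 * \<bar>T b - T a\<bar>" using r(2)[of a e b] A by auto
      also have "\<dots> \<le> max 2 (1 / d) * \<bar>T b - T a\<bar>" by (intro mult_right_mono) auto
      finally show ?thesis using A by (intro bexI[of _ b] bexI[of _ a]) auto
    next
      case False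
      then obtain c x where cx: "c \<in> crit" "x \<in> {a..b}" "\<bar>x - c\<bar> \<le> d / 3" by force
      have "{a..b} \<subseteq> ball c d"
      proof
        fix y assume "y \<in> {a..b}"
        then have "y - x \<le> d / 3" "x - y \<le> d / 3" using cx(2) A by auto
        then have "\<bar>c - y\<bar> < d" using cx(3) d(1) by linarith
        then show "y \<in> ball c d" by (simp add: dist_real_def)
      qed
      then obtain u v where uv: "u \<in> {a..b}" "v \<in> {a..b}" "(b - a) * \<bar>T1 e\<bar> \<le> 1 / d * \<bar>T u - T v\<bar>"
        using d(2)[OF cx(1)] A unfolding P_def by blast
      have "1 / d * \<bar>T u - T v\<bar> \<le> max 2 (1 / d) * \<bar>T u - T v\<bar>" by (intro mult_right_mono) auto
      with uv(3) have "(b - a) * \<bar>T1 e\<bar> \<le> max 2 (1 / d) * \<bar>T u - T v\<bar>" by linarith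
      then show ?thesis using uv by blast
    qed
  qed
qed

lemma covering_timeE:
  assumes "r > 0"
  obtains N d where "d > 0"
    "\<And>a b m. 0 \<le> a \<Longrightarrow> b \<le> 1 \<Longrightarrow> r \<le> b - a \<Longrightarrow> m \<ge> N \<Longrightarrow> (T ^^ m) ` {a..b} = {0..1}"
    "\<And>a b m. 0 \<le> a \<Longrightarrow> b \<le> 1 \<Longrightarrow> r \<le> b - a \<Longrightarrow> \<not> narrow d ((T ^^ m) ` {a..b})"
proof -
  from covering_time[OF assms] obtain N d where *: "d > 0 \<and> (\<forall>a b. 0 \<le> a \<and> b \<le> 1 \<and> r \<le> b - a \<longrightarrow>
    (\<forall>m\<ge>N. (T ^^ m) ` {a..b} = {0..1}) \<and> (\<forall>m. \<not> narrow d ((T ^^ m) ` {a..b})))" by (elim exE)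
  show thesis
  proof (rule that[of d N])
    show "d > 0" using * by (rule conjunct1)
    fix a b :: real and m assume "0 \<le> a" "b \<le> 1" "r \<le> b - a"
    with * have **: "(\<forall>m\<ge>N. (T ^^ m) ` {a..b} = {0..1}) \<and> (\<forall>m. \<not> narrow d ((T ^^ m) ` {a..b}))" by simp
    then show "\<not> narrow d ((T ^^ m) ` {a..b})" by (elim conjE allE)
    show "m \<ge> N \<Longrightarrow> (T ^^ m) ` {a..b} = {0..1}" using ** by (elim conjE allE impE)
  qed
qed

lemma image_interval:
  assumes "0 \<le> a" "a \<le> b" "b \<le> 1"
  shows "\<exists>c d. (T ^^ n) ` {a..b} = {c..d} \<and> c \<le> d"
  by (rule continuous_image_closed_interval[OF assms(2) funpow_cont_subset]) (use assms in auto)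

lemma fixed_point_of_cover:
  assumes "0 \<le> a" "a \<le> b" "b \<le> 1" "(T ^^ M) ` {a..b} = {0..1}"
  shows "\<exists>e\<in>{a..b}. (T ^^ M) e = e"
proof -
  define g where "g x = (T ^^ M) x - x" for x
  have "(0::real) \<in> (T ^^ M) ` {a..b}" "(1::real) \<in> (T ^^ M) ` {a..b}" using assms(4) by auto
  then obtain u v where uv: "u \<in> {a..b}" "v \<in> {a..b}" "(T ^^ M) u = 0" "(T ^^ M) v = 1" by auto
  have "continuous_on {a..b} g"
    unfolding g_def by (intro continuous_intros funpow_cont_subset) (use assms in auto)
  then have "connected (g ` {a..b})" by (rule connected_continuous_image) simp
  moreover have "g u \<in> g ` {a..b}" "g v \<in> g ` {a..b}" using uv by auto
  moreover have "g u \<le> 0" "0 \<le> g v" using uv assms by (auto simp: g_def)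
  ultimately have "0 \<in> g ` {a..b}" by (meson connectedD_interval)
  then show ?thesis by (auto simp: g_def)
qed

text \<open>The costs \<open>C j\<close> of the comparisons between derivative and length multiply along the
  orbit of \<open>e\<close>, and the last image has length at most \<open>1\<close>.\<close>

lemma derivative_product_length_bound:
  assumes ab: "0 \<le> a" "a \<le> b" "b \<le> 1" and e: "e \<in> {a..b}"
    and step: "\<And>j c d. j < N \<Longrightarrow> (T ^^ j) ` {a..b} = {c..d} \<Longrightarrow>
      \<exists>u\<in>{c..d}. \<exists>v\<in>{c..d}. (d - c) * \<bar>T1 ((T ^^ j) e)\<bar> \<le> C j * \<bar>T u - T v\<bar>"
    and C: "\<And>j. C j \<ge> 0"
  shows "(b - a) * (\<Prod>j<N. \<bar>T1 ((T ^^ j) e)\<bar>) \<le> (\<Prod>j<N. C j)"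
proof -
  have "\<forall>j. \<exists>c d. (T ^^ j) ` {a..b} = {c..d} \<and> c \<le> d" using image_interval[OF ab] by blast
  then obtain lo hi where lh: "\<And>j. (T ^^ j) ` {a..b} = {lo j..hi j}" "\<And>j. lo j \<le> hi j" by metis
  have "(T ^^ 0) ` {a..b} = {a..b}" by simp
  then have ab0: "{lo 0..hi 0} = {a..b}" using lh(1)[of 0] by metis
  then have lh0: "lo 0 = a" "hi 0 = b" using lh(2)[of 0] ab(2) Icc_eq_Icc by metis+
  have "(b - a) * (\<Prod>j<k. \<bar>T1 ((T ^^ j) e)\<bar>) \<le> (\<Prod>j<k. C j) * (hi k - lo k)" if "k \<le> N" for k
    using that
  proof (induction k)
    case 0
    then show ?case using lh0 by simp
  next
    case (Suc k)
    obtain u v where uv: "u \<in> {lo k..hi k}" "v \<in> {lo k..hi k}"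
      "(hi k - lo k) * \<bar>T1 ((T ^^ k) e)\<bar> \<le> C k * \<bar>T u - T v\<bar>"
      using step[OF _ lh(1)[of k]] Suc.prems by auto
    have "T ` {lo k..hi k} = {lo (Suc k)..hi (Suc k)}"
      using lh(1)[of k] lh(1)[of "Suc k"] by (simp add: image_comp flip: lh(1)[of k])
    then have "T u \<in> {lo (Suc k)..hi (Suc k)}" "T v \<in> {lo (Suc k)..hi (Suc k)}" using uv by auto
    then have "\<bar>T u - T v\<bar> \<le> hi (Suc k) - lo (Suc k)" by auto
    then have 1: "(hi k - lo k) * \<bar>T1 ((T ^^ k) e)\<bar> \<le> C k * (hi (Suc k) - lo (Suc k))"
      using uv(3) C[of k] by (meson mult_left_mono order_trans)
    have "(b - a) * (\<Prod>j<Suc k. \<bar>T1 ((T ^^ j) e)\<bar>)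
      = (b - a) * (\<Prod>j<k. \<bar>T1 ((T ^^ j) e)\<bar>) * \<bar>T1 ((T ^^ k) e)\<bar>" by simp
    also have "\<dots> \<le> (\<Prod>j<k. C j) * (hi k - lo k) * \<bar>T1 ((T ^^ k) e)\<bar>"
      using Suc by (intro mult_right_mono) auto
    also have "\<dots> = (\<Prod>j<k. C j) * ((hi k - lo k) * \<bar>T1 ((T ^^ k) e)\<bar>)" by simp
    also have "\<dots> \<le> (\<Prod>j<k. C j) * (C k * (hi (Suc k) - lo (Suc k)))"
      using 1 C by (intro mult_left_mono prod_nonneg) auto
    finally show ?case by (simp add: mult.assoc)
  qed
  from this[of N] have "(b - a) * (\<Prod>j<N. \<bar>T1 ((T ^^ j) e)\<bar>) \<le> (\<Prod>j<N. C j) * (hi N - lo N)" by simp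
  also have "\<dots> \<le> (\<Prod>j<N. C j) * 1"
  proof (intro mult_left_mono prod_nonneg)
    have "{lo N..hi N} \<subseteq> {0..1}" using funpow_image_subset[of "{a..b}" N] lh(1)[of N] ab by auto
    then show "hi N - lo N \<le> 1" using lh(2)[of N] by auto
  qed (use C in auto)
  finally show ?thesis by simp
qed

lemma first_wide_time:
  assumes ab: "0 \<le> a" "a < b" "b \<le> 1" and r: "r < 1"
    and narrow: "\<And>j. j \<le> n \<Longrightarrow> narrow r ((T ^^ j) ` {a..b})"
  shows "\<exists>N>n. (\<forall>j<N. narrow r ((T ^^ j) ` {a..b})) \<and> \<not> narrow r ((T ^^ N) ` {a..b})"
proof -
  obtain m where m: "(T ^^ m) ` {a..b} = {0..1}" using exact[of a b] ab by auto
  have "\<not> narrow r {0..1}"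
  proof
    assume "narrow r {0..1}"
    then have "\<bar>(1::real) - 0\<bar> \<le> r" by (rule narrowD) auto
    then show False using r by simp
  qed
  then have ex: "\<not> narrow r ((T ^^ m) ` {a..b})" using m by simp
  define N where "N = (LEAST N. \<not> narrow r ((T ^^ N) ` {a..b}))"
  have "\<not> narrow r ((T ^^ N) ` {a..b})" unfolding N_def by (rule LeastI[of _ m]) (rule ex)
  moreover have "\<forall>j<N. narrow r ((T ^^ j) ` {a..b})" unfolding N_def using not_less_Least by blast
  moreover have "N > n" using calculation(1) narrow by (meson not_le)
  ultimately show ?thesis by blast
qed

text \<open>Let \<open>N\<close> be the first time at which the image of \<open>{a..b}\<close> is longer than
  \<open>r\<close>. Then \<open>N > n\<close>, and \<open>N0\<close> steps later the image is everything, so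
  \<open>{a..b}\<close> contains a point \<open>e\<close> of period \<open>N0 + N\<close>. Its multiplier is at
  least \<open>lam ^ N\<close>. On the other hand, multiplier times length is at most the product of the costs,
  and the cost is \<open>q\<close>, the fourth root of \<open>lam\<close>, except at the rare times when
  \<open>e\<close> is near a critical point.\<close>

theorem exponential_shrinking:
  "\<exists>r>0. \<exists>K>0. \<exists>\<theta>. 0 < \<theta> \<and> \<theta> < 1 \<and> (\<forall>a b n. 0 \<le> a \<and> a \<le> b \<and> b \<le> 1 \<and>
    (\<forall>j\<le>n. narrow r ((T ^^ j) ` {a..b})) \<longrightarrow> b - a \<le> K * \<theta> ^ n)"
proof -
  obtain lam where lam: "lam > 1" "\<And>n x. n \<ge> 1 \<Longrightarrow> x \<in> {0..1} \<Longrightarrow> (T ^^ n) x = x \<Longrightarrow>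
      lam ^ n \<le> (\<Prod>k<n. \<bar>T1 ((T ^^ k) x)\<bar>)" using periodic by blast
  obtain L where L: "L \<ge> 1" "\<And>x. x \<in> {0..1} \<Longrightarrow> \<bar>T1 x\<bar> \<le> L" using T1_bound by blast
  obtain r1 K1 where r1: "r1 > 0" "K1 \<ge> 1" "\<And>a e b. 0 \<le> a \<and> a \<le> e \<and> e \<le> b \<and> b \<le> 1 \<and> b - a \<le> r1 \<Longrightarrow>
    (\<exists>u\<in>{a..b}. \<exists>v\<in>{a..b}. (b - a) * \<bar>T1 e\<bar> \<le> K1 * \<bar>T u - T v\<bar>)"
    using derivative_length_bound by blast
  define q where "q = lam powr (1/4)"
  have q: "q > 1" "q ^ 4 = lam" using lam(1) by (auto simp: q_def powr_power gr_one_powr)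
  define p where "p = card crit"
  \<comment> \<open>spacing so large that the \<open>card V\<close> factors \<open>K1\<close> cost at most \<open>q ^ N\<close> up to a constant\<close>
  obtain R :: nat where R: "real R > p * ln K1 / ln q" using reals_Archimedean2 by blast
  have Rq: "p * ln K1 / real (R + 1) \<le> ln q"
  proof -
    have "p * ln K1 < real R * ln q" using R q by (simp add: field_simps)
    also have "\<dots> \<le> real (R + 1) * ln q" using q by (intro mult_right_mono) auto
    finally show ?thesis by (simp add: field_simps)
  qed
  obtain \<rho> where \<rho>: "\<rho> > 0"
    "\<And>x n. x \<in> {0..1} \<Longrightarrow> real (card (visits \<rho> n x)) \<le> p * (real n / real (R + 1) + 1)"
    using rare_critical_visits[of R] unfolding p_def by blast
  obtain r2 where r2: "r2 > 0" "\<And>a e b. 0 \<le> a \<and> a \<le> e \<and> e \<le> b \<and> b \<le> 1 \<and> b - a \<le> r2 \<and>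
    (\<forall>c\<in>crit. \<forall>x\<in>{a..b}. \<bar>x - c\<bar> > \<rho> / 2) \<Longrightarrow> (b - a) * \<bar>T1 e\<bar> \<le> q * \<bar>T b - T a\<bar>"
    using derivative_length_bound_off_crit[of "\<rho> / 2" "q - 1"] \<rho>(1) q by auto
  define r where "r = min (min r1 r2) (min (\<rho> / 2) (1 / 2))"
  have r: "r > 0" "r \<le> r1" "r \<le> r2" "r \<le> \<rho> / 2" "r < 1"
    using r1 r2 \<rho> by (auto simp: r_def)
  obtain N0 where N0: "\<And>a b. 0 \<le> a \<Longrightarrow> b \<le> 1 \<Longrightarrow> r \<le> b - a \<Longrightarrow> (T ^^ N0) ` {a..b} = {0..1}"
    by (rule covering_timeE[OF r(1)]) (metis order_refl)
  define K where "K = L ^ N0 * K1 ^ p"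
  have main: "b - a \<le> K * (1 / q\<^sup>2) ^ n"
    if ab: "0 \<le> a" "a < b" "b \<le> 1" and nar: "\<And>j. j \<le> n \<Longrightarrow> narrow r ((T ^^ j) ` {a..b})" for a b n
  proof -
    obtain N where N: "N > n" "\<And>j. j < N \<Longrightarrow> narrow r ((T ^^ j) ` {a..b})"
      "\<not> narrow r ((T ^^ N) ` {a..b})" using first_wide_time[OF ab r(5) nar] by blast
    have ab': "a \<le> b" using ab by simp
    obtain c d where cd: "(T ^^ N) ` {a..b} = {c..d}" "c \<le> d"
      using image_interval[OF ab(1) ab' ab(3), of N] by blast
    have "r \<le> d - c"
    proof (rule ccontr)
      assume "\<not> ?thesis"
      then have "narrow r {c..d}" by (auto simp: narrow_def)
      then show False using N(3) cd by simp
    qed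
    moreover have "{c..d} \<subseteq> {0..1}" using funpow_image_subset[of "{a..b}" N] cd(1) ab by auto
    ultimately have "(T ^^ N0) ` {c..d} = {0..1}" using cd(2) by (intro N0) auto
    then have full: "(T ^^ (N0 + N)) ` {a..b} = {0..1}" using funpow_image_add[of N0 N] cd(1) by simp
    obtain e where e: "e \<in> {a..b}" "(T ^^ (N0 + N)) e = e"
      using fixed_point_of_cover[OF ab(1) ab' ab(3) full] by blast
    have e01: "e \<in> {0..1}" using e(1) ab by auto
    have dj: "\<bar>T1 ((T ^^ j) e)\<bar> \<le> L" for j using L(2)[OF funpow_maps[OF e01]] .
    \<comment> \<open>the times at which only the crude cost \<open>K1\<close> is available\<close>
    define V where "V = visits \<rho> N e"
    define C where "C j = (if j \<in> V then K1 else q)" for j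
    have "lam ^ N \<le> lam ^ (N0 + N)" using lam by (intro power_increasing) auto
    also have "\<dots> \<le> (\<Prod>k<N0 + N. \<bar>T1 ((T ^^ k) e)\<bar>)" by (rule lam(2)) (use N e e01 in auto)
    also have "\<dots> = (\<Prod>k\<in>{..<N} \<union> {N..<N0 + N}. \<bar>T1 ((T ^^ k) e)\<bar>)"
      by (rule prod.cong) auto
    also have "\<dots> = (\<Prod>k<N. \<bar>T1 ((T ^^ k) e)\<bar>) * (\<Prod>k\<in>{N..<N0 + N}. \<bar>T1 ((T ^^ k) e)\<bar>)"
      by (rule prod.union_disjoint) auto
    also have "\<dots> \<le> (\<Prod>k<N. \<bar>T1 ((T ^^ k) e)\<bar>) * (\<Prod>k\<in>{N..<N0 + N}. L)"
      by (intro mult_left_mono prod_mono prod_nonneg) (use dj in auto)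
    finally have 1: "lam ^ N \<le> (\<Prod>k<N. \<bar>T1 ((T ^^ k) e)\<bar>) * L ^ N0" by simp
    have 2: "(b - a) * (\<Prod>j<N. \<bar>T1 ((T ^^ j) e)\<bar>) \<le> (\<Prod>j<N. C j)"
    proof (rule derivative_product_length_bound[OF ab(1) ab' ab(3) e(1)])
      show "C j \<ge> 0" for j using r1 q by (auto simp: C_def)
    next
      fix j c d assume j: "j < N" and cd: "(T ^^ j) ` {a..b} = {c..d}"
      have ej: "(T ^^ j) e \<in> {c..d}" using cd e(1) by blast
      have cd01: "{c..d} \<subseteq> {0..1}" using funpow_image_subset[of "{a..b}" j] cd ab by auto
      have nrw: "narrow r {c..d}" using N(2)[OF j] cd by simp
      have dc: "d - c \<le> r" using narrowD[OF nrw, of d c] ej by auto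
      have g: "0 \<le> c \<and> c \<le> (T ^^ j) e \<and> (T ^^ j) e \<le> d \<and> d \<le> 1" using ej cd01 by auto
      show "\<exists>u\<in>{c..d}. \<exists>v\<in>{c..d}. (d - c) * \<bar>T1 ((T ^^ j) e)\<bar> \<le> C j * \<bar>T u - T v\<bar>"
      proof (cases "j \<in> V")
        case True
        then show ?thesis using r1(3)[of c "(T ^^ j) e" d] g dc r by (auto simp: C_def)
      next
        case False
        have "\<bar>x - s\<bar> > \<rho> / 2" if s: "s \<in> crit" "x \<in> {c..d}" for s x
        proof (rule ccontr)
          assume "\<not> ?thesis"
          moreover have "\<bar>(T ^^ j) e - x\<bar> \<le> r" using narrowD[OF nrw ej s(2)] .
          ultimately have "\<bar>(T ^^ j) e - s\<bar> \<le> \<rho>" using r(4) by linarith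
          then show False using False j s by (auto simp: V_def visits_def)
        qed
        then have "(d - c) * \<bar>T1 ((T ^^ j) e)\<bar> \<le> q * \<bar>T d - T c\<bar>"
          using r2(2)[of c "(T ^^ j) e" d] g dc r by auto
        then show ?thesis using False g by (intro bexI[of _ d] bexI[of _ c]) (auto simp: C_def)
      qed
    qed
    have V: "finite V" "V \<subseteq> {..<N}" by (auto simp: V_def visits_def)
    have "(\<Prod>j<N. C j) \<le> (\<Prod>j<N. (if j \<in> V then K1 else 1) * q)"
      by (rule prod_mono) (use r1 q in \<open>auto simp: C_def mult_left_mono[of 1 q K1, simplified]\<close>)
    also have "\<dots> = (\<Prod>j<N. if j \<in> V then K1 else 1) * q ^ N" by (simp add: prod.distrib)
    also have "(\<Prod>j<N. if j \<in> V then K1 else 1) = K1 ^ card V"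
      using V by (simp add: prod.If_cases Int_absorb1)
    finally have 3: "(\<Prod>j<N. C j) \<le> K1 ^ card V * q ^ N" .
    have "K1 ^ card V = exp (real (card V) * ln K1)"
      using r1 by (simp add: exp_of_nat_mult)
    also have "\<dots> \<le> exp (p * (real N / real (R + 1) + 1) * ln K1)"
      using \<rho>(2)[OF e01, of N] r1 unfolding V_def by (intro iffD2[OF exp_le_cancel_iff] mult_right_mono) auto
    also have "p * (real N / real (R + 1) + 1) * ln K1 = N * (p * ln K1 / real (R + 1)) + p * ln K1"
      by (simp add: algebra_simps)
    also have "exp \<dots> \<le> exp (N * ln q + p * ln K1)"
      using Rq by (intro iffD2[OF exp_le_cancel_iff] add_right_mono mult_left_mono) auto
    also have "\<dots> = q ^ N * K1 ^ p" using q r1 by (simp add: exp_add exp_of_nat_mult)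
    finally have 4: "K1 ^ card V \<le> q ^ N * K1 ^ p" .
    have "(b - a) * lam ^ N \<le> (b - a) * ((\<Prod>k<N. \<bar>T1 ((T ^^ k) e)\<bar>) * L ^ N0)"
      using 1 ab by (intro mult_left_mono) auto
    also have "\<dots> = ((b - a) * (\<Prod>k<N. \<bar>T1 ((T ^^ k) e)\<bar>)) * L ^ N0" by simp
    also have "\<dots> \<le> (\<Prod>j<N. C j) * L ^ N0" using 2 L by (intro mult_right_mono) auto
    also have "\<dots> \<le> (K1 ^ card V * q ^ N) * L ^ N0" using 3 L by (intro mult_right_mono) auto
    also have "\<dots> \<le> ((q ^ N * K1 ^ p) * q ^ N) * L ^ N0" using 4 L q by (intro mult_right_mono) auto
    also have "\<dots> = K * (q\<^sup>2) ^ N" by (simp add: K_def power_mult_distrib power2_eq_square)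
    also have "lam ^ N = (q\<^sup>2) ^ N * (q\<^sup>2) ^ N"
      by (simp flip: q(2) power_mult power_add)
    finally have "(b - a) * (q\<^sup>2) ^ N * (q\<^sup>2) ^ N \<le> K * (q\<^sup>2) ^ N" by (simp add: mult.assoc)
    then have "(b - a) * (q\<^sup>2) ^ N \<le> K" using q by simp
    then have "b - a \<le> K * (1 / q\<^sup>2) ^ N" using q by (simp add: field_simps power_one_over)
    also have "\<dots> \<le> K * (1 / q\<^sup>2) ^ n"
    proof (intro mult_left_mono power_decreasing)
      show "1 / q\<^sup>2 \<le> 1" using q by (simp add: power2_eq_square) (smt (verit) mult_less_cancel_right1)
      show "0 \<le> K" using L r1 by (simp add: K_def)
    qed (use N in auto)
    finally show ?thesis .
  qed
  have K0: "K > 0" using L r1 by (simp add: K_def)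
  have th: "0 < 1 / q\<^sup>2" "1 / q\<^sup>2 < 1" using q by (auto simp: power_strict_increasing one_less_power)
  show ?thesis
  proof (rule exI[of _ r], rule conjI[OF r(1)], rule exI[of _ K], rule conjI[OF K0],
      rule exI[of _ "1 / q\<^sup>2"], intro conjI th allI impI)
    fix a b n assume A: "0 \<le> a \<and> a \<le> b \<and> b \<le> 1 \<and> (\<forall>j\<le>n. narrow r ((T ^^ j) ` {a..b}))"
    show "b - a \<le> K * (1 / q\<^sup>2) ^ n"
    proof (cases "a < b")
      case True
      then show ?thesis using main[of a b n] A by blast
    next
      case False
      then have "b - a \<le> 0" using A by simp
      also have "0 \<le> K * (1 / q\<^sup>2) ^ n" using K0 th by simp
      finally show ?thesis .
    qed
  qed
qed

lemma connected_between:
  fixes A :: "real set"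
  assumes "connected A" "u \<in> A" "v \<in> A"
  shows "{min u v..max u v} \<subseteq> A"
  using assms by (metis connected_contains_Icc max_def min_def)

definition shrinks :: "real \<Rightarrow> real \<Rightarrow> nat \<Rightarrow> real set \<Rightarrow> bool" where
  "shrinks K \<theta> k A \<longleftrightarrow> (\<forall>j\<le>k. narrow (K * \<theta> ^ (k - j)) ((T ^^ j) ` A))"

text \<open>If the image of \<open>A\<close> at time \<open>k\<close> is short enough, no earlier image can be
  longer than \<open>r\<close>, since all later images of an interval of length \<open>r\<close> are longer than
  a fixed \<open>d\<close> (\<open>covering_time\<close>). Then shrinking applies from each time
  \<open>j\<close> to time \<open>k\<close>.\<close>

theorem backward_contraction:
  obtains K \<theta> where "K > 0" "0 < \<theta>" "\<theta> < 1"
    "\<And>r0. r0 > 0 \<Longrightarrow> \<exists>r'>0. \<forall>k A. A \<subseteq> {0..1} \<and> connected A \<and> narrow r' ((T ^^ k) ` A) \<longrightarrow>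
      shrinks K \<theta> k A \<and> (\<forall>j\<le>k. narrow r0 ((T ^^ j) ` A))"
proof -
  obtain r K \<theta> where r: "r > 0" "K > 0" "0 < \<theta>" "\<theta> < 1"
    and shr: "\<And>a b n. 0 \<le> a \<and> a \<le> b \<and> b \<le> 1 \<and>
      (\<forall>j\<le>n. narrow r ((T ^^ j) ` {a..b})) \<Longrightarrow> b - a \<le> K * \<theta> ^ n"
    using exponential_shrinking by blast
  have "\<exists>r'>0. \<forall>k A. A \<subseteq> {0..1} \<and> connected A \<and> narrow r' ((T ^^ k) ` A) \<longrightarrow>
      shrinks K \<theta> k A \<and> (\<forall>j\<le>k. narrow r0 ((T ^^ j) ` A))"
    if r0: "r0 > 0" for r0
  proof -
    define r1 where "r1 = min r0 r"
    have r1: "r1 > 0" using r0 r by (simp add: r1_def)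
    obtain d where d: "d > 0" "\<And>a b m. 0 \<le> a \<Longrightarrow> b \<le> 1 \<Longrightarrow> r1 \<le> b - a \<Longrightarrow> \<not> narrow d ((T ^^ m) ` {a..b})"
      by (rule covering_timeE[OF r1]) (rule that; assumption)
    have n1: "narrow r1 ((T ^^ j) ` A)"
      if A: "A \<subseteq> {0..1}" "connected A" "narrow d ((T ^^ k) ` A)" "j \<le> k" for j k A
      unfolding narrow_def
    proof (intro ballI, rule ccontr)
      fix u v assume uv: "u \<in> (T ^^ j) ` A" "v \<in> (T ^^ j) ` A" "\<not> \<bar>u - v\<bar> \<le> r1"
      have "connected ((T ^^ j) ` A)"
        by (rule connected_continuous_image[OF funpow_cont_subset]) (use A in auto)
      then have sub: "{min u v..max u v} \<subseteq> (T ^^ j) ` A" using connected_between uv by blast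
      have "(T ^^ (k - j)) ` {min u v..max u v} \<subseteq> (T ^^ (k - j)) ` ((T ^^ j) ` A)"
        using sub by (rule image_mono)
      also have "\<dots> = (T ^^ k) ` A" using funpow_image_add[of "k - j" j A] A(4) by simp
      finally have "narrow d ((T ^^ (k - j)) ` {min u v..max u v})" using A(3) narrow_subset by blast
      moreover have "0 \<le> min u v \<and> max u v \<le> 1"
        using uv funpow_image_subset[OF A(1), of j] by (auto simp: min_def max_def)
      ultimately show False using d(2)[of "min u v" "max u v"] uv(3) by (simp add: max_def min_def abs_if split: if_splits)
    qed
    have n2: "narrow (K * \<theta> ^ (k - j)) ((T ^^ j) ` A)"
      if A: "A \<subseteq> {0..1}" "connected A" "narrow d ((T ^^ k) ` A)" "j \<le> k" for j k A
      unfolding narrow_def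
    proof (intro ballI)
      fix u v assume uv: "u \<in> (T ^^ j) ` A" "v \<in> (T ^^ j) ` A"
      have "connected ((T ^^ j) ` A)"
        by (rule connected_continuous_image[OF funpow_cont_subset]) (use A in auto)
      then have sub: "{min u v..max u v} \<subseteq> (T ^^ j) ` A" using connected_between uv by blast
      have "max u v - min u v \<le> K * \<theta> ^ (k - j)"
      proof (rule shr, intro conjI allI impI)
        show "0 \<le> min u v" "max u v \<le> 1"
          using uv funpow_image_subset[OF A(1), of j] by (auto simp: min_def max_def)
        show "min u v \<le> max u v" by simp
        fix i assume "i \<le> k - j"
        have "(T ^^ i) ` {min u v..max u v} \<subseteq> (T ^^ (i + j)) ` A"
          using image_mono[OF sub, of "T ^^ i"] funpow_image_add[of i j A] by simp
        moreover have "narrow r1 ((T ^^ (i + j)) ` A)"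
          by (rule n1[OF A(1-3)]) (use \<open>i \<le> k - j\<close> A(4) in auto)
        ultimately show "narrow r ((T ^^ i) ` {min u v..max u v})"
          using narrow_subset narrow_mono[of r1 _ r] by (auto simp: r1_def)
      qed
      then show "\<bar>u - v\<bar> \<le> K * \<theta> ^ (k - j)" by (auto simp: min_def max_def split: if_splits)
    qed
    show ?thesis
    proof (intro exI[of _ d] conjI[OF d(1)] allI impI)
      fix k A assume A: "A \<subseteq> {0..1} \<and> connected A \<and> narrow d ((T ^^ k) ` A)"
      then have "shrinks K \<theta> k A" using n2[of A k] by (simp add: shrinks_def)
      moreover have "narrow r0 ((T ^^ j) ` A)" if "j \<le> k" for j
        using n1[of A k j] A that narrow_mono[of r1 _ r0] by (simp add: r1_def)
      ultimately show "shrinks K \<theta> k A \<and> (\<forall>j\<le>k. narrow r0 ((T ^^ j) ` A))" by simp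
    qed
  qed
  then show thesis using that r by blast
qed

section \<open>Fibres and critical points\<close>

lemma crit_between:
  assumes "w1 < w2" "w1 \<in> {0..1}" "w2 \<in> {0..1}" "T w1 = T w2"
  shows "\<exists>c\<in>crit. w1 < c \<and> c < w2"
proof -
  have der: "DERIV T x :> T1 x" if "w1 < x" "x < w2" for x
    using deriv[of x] that assms at_within_Icc_at[of 0 x 1] by auto
  have "\<exists>z. w1 < z \<and> z < w2 \<and> DERIV T z :> 0"
  proof (rule Rolle[OF assms(1,4)])
    show "continuous_on {w1..w2} T" by (rule continuous_on_subset[OF T_cont]) (use assms in auto)
    show "\<And>x. w1 < x \<Longrightarrow> x < w2 \<Longrightarrow> T differentiable at x"
      using der real_differentiable_def by blast
  qed
  then obtain z where z: "w1 < z" "z < w2" "DERIV T z :> 0" by blast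
  have "T1 z = 0" using DERIV_unique[OF der[OF z(1,2)] z(3)] .
  then show ?thesis using z assms by (intro bexI[of _ z]) (auto simp: crit_def)
qed

lemma fibre1_separated_by_crit: "inj_on (\<lambda>w. {c \<in> crit. c \<le> w}) {w \<in> {0..1}. T w = z}"
proof (rule linorder_inj_onI)
  fix x y assume xy: "x < y" "x \<in> {w \<in> {0..1}. T w = z}" "y \<in> {w \<in> {0..1}. T w = z}"
  then obtain c where "c \<in> crit" "x < c" "c < y" using crit_between[of x y] by auto
  then have "c \<in> {c \<in> crit. c \<le> y}" "c \<notin> {c \<in> crit. c \<le> x}" by auto
  then show "{c \<in> crit. c \<le> x} \<noteq> {c \<in> crit. c \<le> y}" by blast
qed auto

lemma finite_fibre1: "finite {w \<in> {0..1}. T w = z}"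
  by (rule inj_on_finite[OF fibre1_separated_by_crit, where B = "Pow crit"]) (use finite_crit in auto)

lemma fibre_Suc:
  "A \<subseteq> {0..1} \<Longrightarrow> {w \<in> A. (T ^^ Suc n) w = z} = (\<Union>y\<in>{y \<in> T ` A. (T ^^ n) y = z}. {w \<in> A. T w = y})"
  by (auto simp: funpow_swap1)

lemma finite_fibre: "finite {w \<in> {0..1}. (T ^^ n) w = z}"
proof (induction n)
  case 0
  have "{w \<in> {0..1}. (T ^^ 0) w = z} \<subseteq> {z}" by auto
  then show ?case by (rule finite_subset) simp
next
  case (Suc n)
  then show ?case unfolding fibre_Suc[OF subset_refl] using finite_fibre1 surj by auto
qed

lemma fibre1_card:
  assumes A: "A \<subseteq> {0..1}" "connected A" and one: "\<And>c c'. c \<in> A \<inter> crit \<Longrightarrow> c' \<in> A \<inter> crit \<Longrightarrow> c = c'"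
  shows "card {w \<in> A. T w = y} \<le> 2 ^ (if A \<inter> crit = {} then 0 else 1)"
proof -
  let ?F = "{w \<in> A. T w = y}"
  have btw: "\<exists>c\<in>A \<inter> crit. w1 < c \<and> c < w2" if w: "w1 \<in> ?F" "w2 \<in> ?F" "w1 < w2" for w1 w2
  proof -
    have "w1 \<in> {0..1}" "w2 \<in> {0..1}" "T w1 = T w2" using w A by auto
    then obtain c where c: "c \<in> crit" "w1 < c" "c < w2" using crit_between[OF w(3)] by blast
    moreover have "c \<in> A" using connectedD_interval[OF A(2), of w1 w2 c] w c by auto
    ultimately show ?thesis by blast
  qed
  show ?thesis
  proof (cases "A \<inter> crit = {}")
    case True
    have no: False if "w1 \<in> ?F" "w2 \<in> ?F" "w1 < w2" for w1 w2
      using btw[OF that] True by blast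
    have "\<forall>w1\<in>?F. \<forall>w2\<in>?F. w1 = w2"
    proof (intro ballI, rule ccontr)
      fix w1 w2 assume w: "w1 \<in> ?F" "w2 \<in> ?F" "w1 \<noteq> w2"
      then consider "w1 < w2" | "w2 < w1" by linarith
      then show False using no w by cases blast+
    qed
    moreover have "finite ?F" by (rule finite_subset[OF _ finite_fibre1[of y]]) (use A in auto)
    ultimately have "card ?F \<le> 1" by (simp only: card_le_Suc0_iff_eq One_nat_def)
    then show ?thesis using True by simp
  next
    case False
    then obtain c where c: "c \<in> A \<inter> crit" by blast
    have "inj_on (\<lambda>w. w \<le> c) ?F"
    proof (rule linorder_inj_onI)
      fix x y' assume xy: "x < y'" "x \<in> ?F" "y' \<in> ?F"
      then obtain c' where "c' \<in> A \<inter> crit" "x < c'" "c' < y'" using btw by blast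
      then have "x < c" "c < y'" using one[OF c] by auto
      then show "(x \<le> c) \<noteq> (y' \<le> c)" by auto
    qed auto
    then have "card ?F \<le> card (UNIV :: bool set)" by (rule card_inj_on_le) auto
    then show ?thesis using False by simp
  qed
qed

lemma crit_gap: "\<exists>g>0. \<forall>c\<in>crit. \<forall>c'\<in>crit. \<bar>c - c'\<bar> \<le> g \<longrightarrow> c = c'"
proof -
  have "\<exists>d>0. \<forall>p\<in>crit \<times> crit. \<bar>fst p - snd p\<bar> \<le> d \<longrightarrow> fst p = snd p"
  proof (rule finite_uniform_pos[where P = "\<lambda>p d. \<bar>fst p - snd p\<bar> \<le> d \<longrightarrow> fst p = snd p"])
    show "finite (crit \<times> crit)" using finite_crit by simp
    fix p :: "real \<times> real"
    show "\<exists>d>0. \<bar>fst p - snd p\<bar> \<le> d \<longrightarrow> fst p = snd p"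
      by (cases "fst p = snd p", intro exI[of _ 1], simp, intro exI[of _ "\<bar>fst p - snd p\<bar> / 2"], auto)
  qed auto
  then show ?thesis by force
qed

text \<open>Each passage of the narrow set \<open>A\<close> over a critical point at most doubles the number of
  preimages, and nothing else increases it.\<close>

lemma fibre_card:
  assumes "A \<subseteq> {0..1}" "connected A"
    and g: "\<forall>c\<in>crit. \<forall>c'\<in>crit. \<bar>c - c'\<bar> \<le> g \<longrightarrow> c = c'" and "\<And>j. j < n \<Longrightarrow> narrow g ((T ^^ j) ` A)"
  shows "card {w \<in> A. (T ^^ n) w = z} \<le> 2 ^ card {j. j < n \<and> (T ^^ j) ` A \<inter> crit \<noteq> {}}"
  using assms(1,2,4)
proof (induction n arbitrary: A)
  case 0
  have "{w \<in> A. (T ^^ 0) w = z} \<subseteq> {z}" by auto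
  then have "card {w \<in> A. (T ^^ 0) w = z} \<le> card {z}" by (intro card_mono) auto
  then show ?case by simp
next
  case (Suc n)
  define E where "E = (if A \<inter> crit = {} then 0 else 1::nat)"
  have TA: "T ` A \<subseteq> {0..1}" using Suc.prems maps by blast
  have cTA: "connected (T ` A)"
    by (rule connected_continuous_image[OF continuous_on_subset[OF T_cont]]) (use Suc.prems in auto)
  have im: "(T ^^ Suc j) ` A = (T ^^ j) ` (T ` A)" for j
    by (simp only: funpow_Suc_right image_comp)
  have "card {y \<in> T ` A. (T ^^ n) y = z} \<le> 2 ^ card {j. j < n \<and> (T ^^ j) ` (T ` A) \<inter> crit \<noteq> {}}"
    by (rule Suc.IH[OF TA cTA]) (use Suc.prems(3) im in \<open>metis Suc_less_eq\<close>)
  moreover have "card {w \<in> A. T w = y} \<le> 2 ^ E" for y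
    unfolding E_def
  proof (rule fibre1_card[OF Suc.prems(1,2)])
    have "narrow g A" using Suc.prems(3)[of 0] by simp
    then show "c = c'" if "c \<in> A \<inter> crit" "c' \<in> A \<inter> crit" for c c'
      using that g narrowD by blast
  qed
  moreover have "finite {y \<in> T ` A. (T ^^ n) y = z}"
    by (rule finite_subset[OF _ finite_fibre[of n z]]) (use TA in auto)
  moreover have "card (\<Union>y\<in>{y \<in> T ` A. (T ^^ n) y = z}. {w \<in> A. T w = y})
      \<le> (\<Sum>y\<in>{y \<in> T ` A. (T ^^ n) y = z}. card {w \<in> A. T w = y})"
    by (rule card_UN_le) (rule calculation(3))
  moreover have "(\<Sum>y\<in>{y \<in> T ` A. (T ^^ n) y = z}. card {w \<in> A. T w = y})
     \<le> of_nat (card {y \<in> T ` A. (T ^^ n) y = z}) * 2 ^ E"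
    by (rule sum_bounded_above) (rule calculation(2))
  ultimately have "card {w \<in> A. (T ^^ Suc n) w = z}
      \<le> 2 ^ card {j. j < n \<and> (T ^^ j) ` (T ` A) \<inter> crit \<noteq> {}} * 2 ^ E"
    unfolding fibre_Suc[OF Suc.prems(1)] by (smt (verit) of_nat_id le_trans mult_le_mono1)
  also have "\<dots> = 2 ^ (card (Suc ` {j. j < n \<and> (T ^^ j) ` (T ` A) \<inter> crit \<noteq> {}}) + E)"
    by (simp add: power_add card_image)
  also have "card (Suc ` {j. j < n \<and> (T ^^ j) ` (T ` A) \<inter> crit \<noteq> {}}) + E
     = card (Suc ` {j. j < n \<and> (T ^^ j) ` (T ` A) \<inter> crit \<noteq> {}} \<union> (if A \<inter> crit = {} then {} else {0}))"
    unfolding E_def by (subst card_Un_disjoint) auto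
  also have "Suc ` {j. j < n \<and> (T ^^ j) ` (T ` A) \<inter> crit \<noteq> {}} \<union> (if A \<inter> crit = {} then {} else {0})
     = {j. j < Suc n \<and> (T ^^ j) ` A \<inter> crit \<noteq> {}}" (is "?l = ?r")
  proof (rule set_eqI)
    fix j show "j \<in> ?l \<longleftrightarrow> j \<in> ?r"
      by (cases j) (auto simp: im simp del: funpow.simps split: if_splits)
  qed
  finally show ?case .
qed

end

section \<open>Conformal measures and transfer operators\<close>

text \<open>The components of the complement of \<open>F\<close> between its extreme points, coded by their end
  points.\<close>

definition gaps :: "real set \<Rightarrow> (real \<times> real) set" where
  "gaps F = {(a, b). a \<in> F \<and> b \<in> F \<and> a < b \<and> {a<..<b} \<inter> F = {}}"

lemma finite_gaps: "finite F \<Longrightarrow> finite (gaps F)"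
  by (rule finite_subset[of _ "F \<times> F"]) (auto simp: gaps_def)

lemma gap_exists:
  assumes "finite F" "u \<in> F" "v \<in> F" "u < x" "x < v" "x \<notin> F"
  shows "\<exists>(a, b)\<in>gaps F. x \<in> {a<..<b}"
proof -
  define a where "a = Max {y \<in> F. y < x}"
  define b where "b = Min {y \<in> F. x < y}"
  have fin: "finite {y \<in> F. y < x}" "finite {y \<in> F. x < y}" using assms by auto
  have ne: "{y \<in> F. y < x} \<noteq> {}" "{y \<in> F. x < y} \<noteq> {}" using assms by auto
  have a: "a \<in> F" "a < x" using Max_in[OF fin(1) ne(1)] by (auto simp: a_def)
  have b: "b \<in> F" "x < b" using Min_in[OF fin(2) ne(2)] by (auto simp: b_def)
  have "y \<notin> F" if "y \<in> {a<..<b}" for y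
  proof
    assume "y \<in> F"
    then consider "y < x" | "x < y" using assms(6) by (metis linorder_neqE)
    then show False
    proof cases
      case 1
      then have "y \<le> a" unfolding a_def using \<open>y \<in> F\<close> by (intro Max_ge fin) auto
      then show False using that by auto
    next
      case 2
      then have "b \<le> y" unfolding b_def using \<open>y \<in> F\<close> by (intro Min_le fin) auto
      then show False using that by auto
    qed
  qed
  then show ?thesis using a b by (intro bexI[of _ "(a, b)"]) (auto simp: gaps_def)
qed

lemma gaps_disjoint:
  assumes "(a, b) \<in> gaps F" "(c, d) \<in> gaps F" "x \<in> {a<..<b}" "x \<in> {c<..<d}"
  shows "(a, b) = (c, d)"
proof -
  have F: "a \<in> F" "b \<in> F" "c \<in> F" "d \<in> F" using assms by (auto simp: gaps_def)
  have "\<not> (a < y \<and> y < b)" "\<not> (c < y \<and> y < d)" if "y \<in> F" for y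
    using assms that by (auto simp: gaps_def)
  note n = this
  have "\<not> a < c" "\<not> c < a" "\<not> b < d" "\<not> d < b"
    using n(1)[OF F(3)] n(2)[OF F(1)] n(2)[OF F(2)] n(1)[OF F(4)] assms(3,4) by auto
  then show ?thesis by auto
qed

text \<open>The conformality assumption says that the transfer operator of \<open>\<phi>\<close> preserves
  integrals; for an eigenmeasure of the operator of \<open>\<psi>\<close> with eigenvalue \<open>exp P\<close>
  this is the case for \<open>\<phi> = \<psi> - P\<close>.\<close>

locale conformal_map = interval_map T T1 for T T1 :: "real \<Rightarrow> real" +
  fixes \<phi> :: "real \<Rightarrow> real" and m :: "real measure"
  assumes holder: "\<exists>\<alpha> C. 0 < \<alpha> \<and> 0 \<le> C \<and> (\<forall>x\<in>{0..1}. \<forall>y\<in>{0..1}. \<bar>\<phi> x - \<phi> y\<bar> \<le> C * \<bar>x - y\<bar> powr \<alpha>)"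
    and prob: "prob_space m"
    and sets_m: "sets m = sets (restrict_space borel {0..1})"
    and conformal: "g \<in> borel_measurable m \<Longrightarrow> bounded (g ` {0..1}) \<Longrightarrow>
      (\<integral>x. (\<Sum>y\<in>{y \<in> {0..1}. T y = x}. g y * exp (\<phi> y)) \<partial>m) = (\<integral>x. g x \<partial>m)"
    and supp: "0 \<le> a \<Longrightarrow> a < b \<Longrightarrow> b \<le> 1 \<Longrightarrow> measure m {a<..<b} > 0"
begin

sublocale prob_space m by (rule prob)

lemma space_m: "space m = {0..1}"
  using sets_eq_imp_space_eq[OF sets_m] by (simp add: space_restrict_space)

lemma sets_m_iff: "A \<in> sets m \<longleftrightarrow> A \<subseteq> {0..1} \<and> A \<in> sets borel"
  unfolding sets_m by (subst sets_restrict_space_iff) auto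

lemma measurable_m_cong: "borel_measurable m = borel_measurable (restrict_space borel {0..1})"
  by (rule measurable_cong_sets[OF sets_m refl])

lemma funpow_measurable: "T ^^ n \<in> measurable m m"
proof -
  have "T ^^ n \<in> borel_measurable (restrict_space borel {0..1})"
    by (rule borel_measurable_continuous_on_restrict[OF funpow_cont])
  then have "T ^^ n \<in> measurable (restrict_space borel {0..1}) (restrict_space borel {0..1})"
    by (rule measurable_restrict_space2[rotated]) (use funpow_maps in \<open>auto simp: space_restrict_space\<close>)
  then show ?thesis using measurable_cong_sets[OF sets_m sets_m] by blast
qed

lemma preimage_sets:
  assumes "E \<in> sets m" "A \<in> sets m"
  shows "{x \<in> E. (T ^^ n) x \<in> A} \<in> sets m"
proof -
  have "(T ^^ n) -` A \<inter> space m \<in> sets m" by (rule measurable_sets[OF funpow_measurable assms(2)])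
  then have "E \<inter> ((T ^^ n) -` A \<inter> space m) \<in> sets m" using assms(1) by blast
  moreover have "E \<inter> ((T ^^ n) -` A \<inter> space m) = {x \<in> E. (T ^^ n) x \<in> A}"
    using assms(1) by (auto simp: sets_m_iff space_m)
  ultimately show ?thesis by simp
qed

lemma I_sets: "{0..1} \<in> sets m"
  by (simp add: sets_m_iff)

lemma phi_cont: "continuous_on {0..1} \<phi>"
proof -
  obtain \<alpha> C where h: "0 < \<alpha>" "0 \<le> C"
    "\<And>x y. x \<in> {0..1} \<Longrightarrow> y \<in> {0..1} \<Longrightarrow> \<bar>\<phi> x - \<phi> y\<bar> \<le> C * \<bar>x - y\<bar> powr \<alpha>" using holder by blast
  show ?thesis
    unfolding continuous_on_def
  proof
    fix x :: real assume x: "x \<in> {0..1}"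
    have "((\<lambda>y. C * \<bar>y - x\<bar> powr \<alpha>) \<longlongrightarrow> C * \<bar>x - x\<bar> powr \<alpha>) (at x within {0..1})"
      by (intro tendsto_intros) (use h in auto)
    then have 0: "((\<lambda>y. C * \<bar>y - x\<bar> powr \<alpha>) \<longlongrightarrow> 0) (at x within {0..1})" by simp
    have "((\<lambda>y. \<phi> y - \<phi> x) \<longlongrightarrow> 0) (at x within {0..1})"
      by (rule Lim_null_comparison[OF _ 0]) (use h(3) x in \<open>auto simp: eventually_at_filter\<close>)
    then show "(\<phi> \<longlongrightarrow> \<phi> x) (at x within {0..1})" by (simp add: LIM_zero_iff)
  qed
qed

lemma phi_bound: "\<exists>B\<ge>0. \<forall>x\<in>{0..1}. \<bar>\<phi> x\<bar> \<le> B"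
proof -
  have "bounded (\<phi> ` {0..1})"
    by (rule compact_imp_bounded[OF compact_continuous_image[OF phi_cont]]) simp
  then obtain B where "\<forall>x\<in>{0..1}. \<bar>\<phi> x\<bar> \<le> B" by (auto simp: bounded_iff)
  then show ?thesis by (intro exI[of _ "max B 0"]) force
qed

definition S :: "nat \<Rightarrow> real \<Rightarrow> real" where
  "S n x = (\<Sum>k<n. \<phi> ((T ^^ k) x))"

lemma S_add: "S (n + k) x = S n x + S k ((T ^^ n) x)"
proof (induction k)
  case (Suc k)
  have "(T ^^ (n + k)) x = (T ^^ k) ((T ^^ n) x)"
    using funpow_add_apply[of k n x] by (simp add: add.commute)
  then show ?case using Suc by (simp add: S_def)
qed (simp add: S_def)

lemma S_bound:
  assumes "\<forall>x\<in>{0..1}. \<bar>\<phi> x\<bar> \<le> B" "x \<in> {0..1}"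
  shows "\<bar>S n x\<bar> \<le> n * B"
proof -
  have "\<bar>S n x\<bar> \<le> (\<Sum>k<n. \<bar>\<phi> ((T ^^ k) x)\<bar>)" unfolding S_def by (rule sum_abs)
  also have "\<dots> \<le> (\<Sum>k<n. B)" by (rule sum_mono) (use assms funpow_maps in auto)
  finally show ?thesis by simp
qed

lemma S_cont: "continuous_on {0..1} (S n)"
  unfolding S_def
proof (intro continuous_on_sum)
  fix k
  have "continuous_on {0..1} (\<phi> \<circ> (T ^^ k))"
    by (rule continuous_on_compose[OF funpow_cont continuous_on_subset[OF phi_cont]])
      (use funpow_maps in auto)
  then show "continuous_on {0..1} (\<lambda>x. \<phi> ((T ^^ k) x))" by (simp add: o_def)
qed

definition transfer :: "nat \<Rightarrow> (real \<Rightarrow> real) \<Rightarrow> real \<Rightarrow> real" where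
  "transfer n g z = (\<Sum>w\<in>{w \<in> {0..1}. (T ^^ n) w = z}. g w * exp (S n w))"

lemma inj_on_gap:
  assumes "(a, b) \<in> gaps (crit \<union> {0, 1})"
  shows "inj_on T {a<..<b}" "{a<..<b} \<subseteq> {0..1}"
proof -
  show sub: "{a<..<b} \<subseteq> {0..1}" using assms crit_subset by (auto simp: gaps_def)
  show "inj_on T {a<..<b}"
  proof (rule linorder_inj_onI)
    fix x y assume xy: "x < y" "x \<in> {a<..<b}" "y \<in> {a<..<b}"
    show "T x \<noteq> T y"
    proof
      assume "T x = T y"
      then obtain c where "c \<in> crit" "x < c" "c < y" using crit_between[of x y] xy sub by blast
      then have "c \<in> {a<..<b} \<inter> (crit \<union> {0, 1})" using xy by auto
      then show False using assms by (auto simp: gaps_def)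
    qed
  qed auto
qed

text \<open>Iterating conformality needs the transfer operator to preserve measurability. On an interval of
  monotonicity the sum has at most one term, which is a composition with the continuous inverse branch.\<close>

lemma branch_sum_measurable:
  fixes h :: "real \<Rightarrow> real"
  assumes h: "h \<in> borel_measurable m" and J: "{a<..<b} \<subseteq> {0..1::real}" "inj_on T {a<..<b}"
  shows "(\<lambda>x. \<Sum>y\<in>{y \<in> {a<..<b}. T y = x}. h y) \<in> borel_measurable m"
proof -
  let ?J = "{a<..<b}"
  have cont: "continuous_on ?J T" by (rule continuous_on_subset[OF T_cont J(1)])
  have pc: "path_connected ?J" by (simp add: convex_imp_path_connected)
  obtain \<iota> where i: "homeomorphism ?J (T ` ?J) T \<iota>"
    using injective_into_1d_eq_homeomorphism[OF cont pc] J(2) by blast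
  have ci: "continuous_on (T ` ?J) \<iota>" and ii: "\<And>y. y \<in> ?J \<Longrightarrow> \<iota> (T y) = y"
    using i by (auto simp: homeomorphism_def)
  have "connected (T ` ?J)" by (rule connected_continuous_image[OF cont]) simp
  then have TJ: "T ` ?J \<in> sets borel"
    by (intro real_interval_borel_measurable) (simp add: is_interval_connected_1)
  define h' where "h' y = indicator {0..1} y *\<^sub>R h y" for y
  have h': "h' \<in> borel_measurable borel"
    using h unfolding measurable_m_cong h'_def by (subst (asm) borel_measurable_restrict_space_iff) auto
  define \<iota>' where "\<iota>' x = (if x \<in> T ` ?J then \<iota> x else 0)" for x
  have i': "\<iota>' \<in> borel_measurable borel"
    unfolding \<iota>'_def by (intro borel_measurable_continuous_on_if TJ ci continuous_intros)
  have "(\<lambda>x. indicator (T ` ?J) x * h' (\<iota>' x)) \<in> borel_measurable borel"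
    using TJ measurable_compose[OF i' h'] by measurable
  then have "(\<lambda>x. indicator (T ` ?J) x * h' (\<iota>' x)) \<in> borel_measurable m"
    unfolding measurable_m_cong by (rule measurable_restrict_space1)
  moreover have "(\<Sum>y\<in>{y \<in> ?J. T y = x}. h y) = indicator (T ` ?J) x * h' (\<iota>' x)" for x
  proof (cases "x \<in> T ` ?J")
    case True
    then obtain y where y: "y \<in> ?J" "x = T y" by auto
    have "{y' \<in> ?J. T y' = x} = {y}" using y J(2) by (auto dest: inj_onD)
    moreover have "y \<in> {0..1}" using y J by blast
    ultimately show ?thesis using True y ii[OF y(1)] by (simp add: h'_def \<iota>'_def)
  next
    case False
    then have e: "{y' \<in> ?J. T y' = x} = {}" by auto
    show ?thesis unfolding e using False by simp
  qed
  ultimately show ?thesis by simp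
qed

lemma transfer1_eq: "transfer 1 g x = (\<Sum>y\<in>{y \<in> {0..1}. T y = x}. g y * exp (\<phi> y))"
  by (simp add: transfer_def S_def)

lemma S_measurable: "S n \<in> borel_measurable m"
  unfolding measurable_m_cong by (rule borel_measurable_continuous_on_restrict[OF S_cont])

text \<open>The fibre is split along the finitely many intervals of monotonicity and the finitely many points
  between them.\<close>

lemma transfer1_measurable:
  assumes g: "g \<in> borel_measurable m"
  shows "transfer 1 g \<in> borel_measurable m"
proof -
  define h where "h y = g y * exp (\<phi> y)" for y
  have "S 1 = \<phi>" by (rule ext) (simp add: S_def)
  then have "\<phi> \<in> borel_measurable m" using S_measurable[of 1] by metis
  then have h: "h \<in> borel_measurable m" unfolding h_def using g by measurable
  let ?F = "crit \<union> {0, 1}"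
  have F: "finite ?F" "?F \<subseteq> {0..1}" using finite_crit crit_subset by auto
  define B where "B x p = (case p of (a, b) \<Rightarrow> {y \<in> {a<..<b}. T y = x})" for x :: real and p :: "real \<times> real"
  have Bsub: "B x p \<subseteq> {y \<in> {0..1}. T y = x}" if "p \<in> gaps ?F" for x p
  proof -
    obtain a b where p: "p = (a, b)" by (cases p)
    then show ?thesis using subsetD[OF inj_on_gap(2)[of a b]] that by (auto simp: B_def)
  qed
  have eq: "(\<Sum>y\<in>{y \<in> {0..1}. T y = x}. h y) = (\<Sum>p\<in>gaps ?F. \<Sum>y\<in>B x p. h y) + (\<Sum>y\<in>?F. if T y = x then h y else 0)" for x
  proof -
    have U: "{y \<in> {0..1}. T y = x} = (\<Union>p\<in>gaps ?F. B x p) \<union> {y \<in> ?F. T y = x}" (is "?l = ?r")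
    proof
      show "?l \<subseteq> ?r"
      proof
        fix y assume y: "y \<in> ?l"
        show "y \<in> ?r"
        proof (cases "y \<in> ?F")
          case False
          then have "0 < y" "y < 1" using y by (auto simp: less_le)
          then obtain p where "p \<in> gaps ?F" "case p of (a, b) \<Rightarrow> y \<in> {a<..<b}"
            using gap_exists[OF F(1), of 0 1 y] False by auto
          then have "y \<in> B x p" using y by (auto simp: B_def)
          then show ?thesis using \<open>p \<in> gaps ?F\<close> by blast
        qed (use y in auto)
      qed
      show "?r \<subseteq> ?l" using Bsub F by blast
    qed
    have fin: "finite (B x p)" if "p \<in> gaps ?F" for p
      by (rule finite_subset[OF Bsub[OF that] finite_fibre1])
    have "B x p \<inter> B x q = {}" if pq: "p \<in> gaps ?F" "q \<in> gaps ?F" "p \<noteq> q" for p q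
    proof (rule ccontr)
      assume "B x p \<inter> B x q \<noteq> {}"
      then obtain y where "y \<in> B x p" "y \<in> B x q" by blast
      then show False using pq gaps_disjoint[of _ _ ?F _ _ y] by (auto simp: B_def split: prod.splits)
    qed
    then have 1: "sum h (\<Union>p\<in>gaps ?F. B x p) = (\<Sum>p\<in>gaps ?F. \<Sum>y\<in>B x p. h y)"
      by (intro sum.UNION_disjoint) (use finite_gaps[OF F(1)] fin in auto)
    have 2: "(\<Sum>y\<in>{y \<in> ?F. T y = x}. h y) = (\<Sum>y\<in>?F. if T y = x then h y else 0)"
      by (rule sum.inter_filter[OF F(1)])
    have "(\<Union>p\<in>gaps ?F. B x p) \<inter> {y \<in> ?F. T y = x} = {}" by (auto simp: B_def gaps_def)
    then have "sum h ?r = sum h (\<Union>p\<in>gaps ?F. B x p) + sum h {y \<in> ?F. T y = x}"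
      by (intro sum.union_disjoint) (use F finite_gaps[OF F(1)] fin in auto)
    then show ?thesis using 1 2 U by simp
  qed
  have "transfer 1 g = (\<lambda>x. (\<Sum>p\<in>gaps ?F. \<Sum>y\<in>B x p. h y) + (\<Sum>y\<in>?F. if T y = x then h y else 0))"
  proof (intro ext)
    fix x
    have "transfer 1 g x = (\<Sum>y\<in>{y \<in> {0..1}. T y = x}. h y)" by (simp only: transfer1_eq h_def)
    then show "transfer 1 g x = (\<Sum>p\<in>gaps ?F. \<Sum>y\<in>B x p. h y) + (\<Sum>y\<in>?F. if T y = x then h y else 0)"
      using eq[of x] by simp
  qed
  moreover have "(\<lambda>x. \<Sum>y\<in>B x p. h y) \<in> borel_measurable m" if "p \<in> gaps ?F" for p
  proof -
    obtain a b where p: "p = (a, b)" by (cases p)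
    then show ?thesis
      using branch_sum_measurable[OF h inj_on_gap(2,1)[of a b]] that by (simp add: B_def)
  qed
  moreover have "(\<lambda>x. if T y = x then h y else 0) \<in> borel_measurable m" for y
    unfolding measurable_m_cong by (rule measurable_restrict_space1) measurable
  ultimately show ?thesis by simp
qed

lemma transfer_Suc: "transfer (Suc n) g z = transfer n (transfer 1 g) z"
proof -
  let ?fib = "\<lambda>n z. {w \<in> {0..1}. (T ^^ n) w = z}"
  have "transfer n (transfer 1 g) z = (\<Sum>w\<in>?fib n z. \<Sum>y\<in>?fib 1 w. g y * exp (S 1 y) * exp (S n w))"
    by (simp add: transfer_def sum_distrib_right)
  also have "\<dots> = (\<Sum>w\<in>?fib n z. \<Sum>y\<in>?fib 1 w. g y * exp (S (Suc n) y))"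
  proof (intro sum.cong refl)
    fix w y assume "y \<in> ?fib 1 w"
    then have "S (1 + n) y = S 1 y + S n w" using S_add[of 1 n y] by simp
    then show "g y * exp (S 1 y) * exp (S n w) = g y * exp (S (Suc n) y)"
      by (simp add: exp_add mult.assoc)
  qed
  also have "\<dots> = (\<Sum>y\<in>(\<Union>w\<in>?fib n z. ?fib 1 w). g y * exp (S (Suc n) y))"
    by (rule sum.UNION_disjoint[symmetric]) (use finite_fibre finite_fibre1 in auto)
  also have "(\<Union>w\<in>?fib n z. ?fib 1 w) = ?fib (Suc n) z"
    using maps by (auto simp: funpow_swap1)
  finally show ?thesis by (simp add: transfer_def)
qed

lemma transfer1_bounded:
  assumes "bounded (g ` {0..1})"
  shows "bounded (transfer 1 g ` {0..1})"
proof -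
  have "\<exists>G. \<forall>x\<in>{0..1}. \<bar>g x\<bar> \<le> G" using assms by (simp add: bounded_iff)
  then obtain G where G: "\<And>x. x \<in> {0..1} \<Longrightarrow> \<bar>g x\<bar> \<le> G" by blast
  have G0: "G \<ge> 0" using G[of 0] by simp
  obtain B where B: "\<forall>x\<in>{0..1}. \<bar>\<phi> x\<bar> \<le> B" using phi_bound by blast
  have cardb: "card {y \<in> {0..1}. T y = x} \<le> 2 ^ card crit" for x
  proof -
    have "card {y \<in> {0..1}. T y = x} \<le> card (Pow crit)"
    proof (rule card_inj_on_le[of "\<lambda>w. {c \<in> crit. c \<le> w}"])
      show "inj_on (\<lambda>w. {c \<in> crit. c \<le> w}) {w \<in> {0..1}. T w = x}"
        by (rule fibre1_separated_by_crit)
    qed (use finite_crit in auto)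
    then show ?thesis by (simp add: card_Pow finite_crit)
  qed
  have "\<bar>transfer 1 g x\<bar> \<le> 2 ^ card crit * (G * exp B)" for x
  proof -
    have "\<bar>transfer 1 g x\<bar> \<le> (\<Sum>y\<in>{y \<in> {0..1}. T y = x}. \<bar>g y * exp (\<phi> y)\<bar>)"
      unfolding transfer1_eq by (rule sum_abs)
    also have "\<dots> \<le> of_nat (card {y \<in> {0..1}. T y = x}) * (G * exp B)"
    proof (rule sum_bounded_above)
      fix y assume "y \<in> {y \<in> {0..1}. T y = x}"
      then have "\<bar>g y\<bar> \<le> G" "\<phi> y \<le> B" using G B by force+
      then show "\<bar>g y * exp (\<phi> y)\<bar> \<le> G * exp B" by (simp add: abs_mult mult_mono)
    qed
    also have "\<dots> \<le> 2 ^ card crit * (G * exp B)"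
    proof (rule mult_right_mono)
      have "real (card {y \<in> {0..1}. T y = x}) \<le> real (2 ^ card crit)" using cardb[of x] of_nat_le_iff by blast
      then show "real (card {y \<in> {0..1}. T y = x}) \<le> 2 ^ card crit" by simp
    qed (use G0 in auto)
    finally show ?thesis .
  qed
  then show ?thesis by (auto simp: bounded_iff)
qed

lemma transfer_integral:
  assumes "g \<in> borel_measurable m" "bounded (g ` {0..1})"
  shows "transfer n g \<in> borel_measurable m \<and> bounded (transfer n g ` {0..1}) \<and>
    (\<integral>x. transfer n g x \<partial>m) = (\<integral>x. g x \<partial>m)"
  using assms
proof (induction n arbitrary: g)
  case 0
  have eq: "transfer 0 g x = g x" if "x \<in> {0..1}" for x
  proof -
    have "{w \<in> {0..1}. (T ^^ 0) w = x} = {x}" using that by auto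
    then show ?thesis by (simp add: transfer_def S_def)
  qed
  have "transfer 0 g \<in> borel_measurable m"
    using 0(1) by (rule measurable_cong[THEN iffD2, rotated]) (use eq space_m in auto)
  moreover have "(\<integral>x. transfer 0 g x \<partial>m) = (\<integral>x. g x \<partial>m)"
    by (rule Bochner_Integration.integral_cong) (use eq space_m in auto)
  moreover have "transfer 0 g ` {0..1} = g ` {0..1}" using eq by auto
  ultimately show ?case using 0(2) by simp
next
  case (Suc n)
  have 1: "transfer 1 g \<in> borel_measurable m" "bounded (transfer 1 g ` {0..1})"
    using transfer1_measurable transfer1_bounded Suc.prems by auto
  have "(\<integral>x. transfer 1 g x \<partial>m) = (\<integral>x. g x \<partial>m)"
    unfolding transfer1_eq by (rule conformal[OF Suc.prems])
  moreover have "transfer (Suc n) g = transfer n (transfer 1 g)" by (rule ext) (rule transfer_Suc)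
  ultimately show ?case using Suc.IH[OF 1] by (simp only: conj_assoc)
qed

lemma bounded_integrable:
  fixes f :: "real \<Rightarrow> real"
  assumes "f \<in> borel_measurable m" "bounded (f ` {0..1})"
  shows "integrable m f"
proof -
  have "\<exists>B. \<forall>x\<in>{0..1}. \<bar>f x\<bar> \<le> B" using assms(2) by (simp add: bounded_iff)
  then obtain B where "\<forall>x\<in>{0..1}. \<bar>f x\<bar> \<le> B" by blast
  then show ?thesis by (intro integrable_const_bound[of _ B] AE_I2) (use assms(1) space_m in auto)
qed

lemma integrable_ind: "A \<in> sets m \<Longrightarrow> integrable m (indicator A :: real \<Rightarrow> real)"
  by (rule integrable_real_indicator) (auto simp: emeasure_eq_measure)

lemma measure_transfer:
  assumes "E \<in> sets m"
  shows "integrable m (transfer n (indicator E))" "(\<integral>x. transfer n (indicator E) x \<partial>m) = measure m E"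
proof -
  have g: "(indicator E :: real \<Rightarrow> real) \<in> borel_measurable m" using assms by simp
  have b: "bounded ((indicator E :: real \<Rightarrow> real) ` {0..1})"
    by (rule bounded_subset[of "{0, 1}"]) (auto simp: indicator_def)
  from transfer_integral[OF g b, of n]
  show "integrable m (transfer n (indicator E))" using bounded_integrable by blast
  have "(\<integral>x. indicator E x \<partial>m) = measure m (E \<inter> space m)" by simp
  also have "E \<inter> space m = E" using assms sets.sets_into_space by blast
  finally show "(\<integral>x. transfer n (indicator E) x \<partial>m) = measure m E"
    using transfer_integral[OF g b, of n] by simp
qed

text \<open>The indicator of the preimage is transferred to at most \<open>M * exp b\<close> times the indicator
  of \<open>A\<close>.\<close>

lemma measure_preimage_le:
  assumes E: "E \<in> sets m" and A: "A \<in> sets m"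
    and M: "\<And>z. real (card {w \<in> E. (T ^^ n) w = z}) \<le> M" and b: "\<And>w. w \<in> E \<Longrightarrow> S n w \<le> b"
  shows "measure m {x \<in> E. (T ^^ n) x \<in> A} \<le> M * exp b * measure m A"
proof -
  let ?E = "{x \<in> E. (T ^^ n) x \<in> A}"
  have sE: "?E \<in> sets m" by (rule preimage_sets[OF E A])
  have E01: "E \<subseteq> {0..1}" using E by (simp add: sets_m_iff)
  have pt: "transfer n (indicator ?E) z \<le> M * exp b * indicator A z" for z
  proof -
    have fin: "finite {w \<in> {0..1}. (T ^^ n) w = z}" by (rule finite_fibre)
    have "transfer n (indicator ?E) z = (\<Sum>w\<in>{w \<in> {0..1}. (T ^^ n) w = z}. if w \<in> E then indicator A z * exp (S n w) else 0)"
      unfolding transfer_def by (intro sum.cong) (auto simp: indicator_def)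
    also have "\<dots> = (\<Sum>w\<in>{w \<in> {w \<in> {0..1}. (T ^^ n) w = z}. w \<in> E}. indicator A z * exp (S n w))"
      by (rule sum.inter_filter[OF fin, symmetric])
    also have "{w \<in> {w \<in> {0..1}. (T ^^ n) w = z}. w \<in> E} = {w \<in> E. (T ^^ n) w = z}" using E01 by auto
    also have "(\<Sum>w\<in>{w \<in> E. (T ^^ n) w = z}. indicator A z * exp (S n w))
      \<le> of_nat (card {w \<in> E. (T ^^ n) w = z}) * (indicator A z * exp b)"
      by (rule sum_bounded_above) (use b in \<open>auto intro: mult_left_mono\<close>)
    also have "\<dots> \<le> M * (indicator A z * exp b)"
      by (rule mult_right_mono[OF M]) simp
    finally show ?thesis by (simp add: mult_ac)
  qed
  have "measure m ?E = (\<integral>x. transfer n (indicator ?E) x \<partial>m)" by (simp add: measure_transfer(2)[OF sE])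
  also have "\<dots> \<le> (\<integral>x. M * exp b * indicator A x \<partial>m)"
    by (rule integral_mono[OF measure_transfer(1)[OF sE]]) (use pt integrable_ind[OF A] in auto)
  also have "\<dots> = M * exp b * measure m A"
    using A sets.sets_into_space[OF A] by (simp add: Int_absorb2)
  finally show ?thesis .
qed

lemma measure_preimage_ge:
  assumes E: "E \<in> sets m" and A: "A \<in> sets m" "A \<subseteq> (T ^^ n) ` E"
    and b: "\<And>w. w \<in> E \<Longrightarrow> a \<le> S n w"
  shows "exp a * measure m A \<le> measure m {x \<in> E. (T ^^ n) x \<in> A}"
proof -
  let ?E = "{x \<in> E. (T ^^ n) x \<in> A}"
  have sE: "?E \<in> sets m" by (rule preimage_sets[OF E A(1)])
  have E01: "E \<subseteq> {0..1}" using E by (simp add: sets_m_iff)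
  have pt: "exp a * indicator A z \<le> transfer n (indicator ?E) z" for z
  proof (cases "z \<in> A")
    case True
    then obtain w where w: "w \<in> E" "(T ^^ n) w = z" using A(2) by auto
    have "exp a \<le> exp (S n w)" using b[OF w(1)] by simp
    also have "\<dots> = indicator ?E w * exp (S n w)" using w True by simp
    also have "\<dots> \<le> transfer n (indicator ?E) z"
      unfolding transfer_def by (rule member_le_sum) (use w E01 finite_fibre in auto)
    finally show ?thesis using True by simp
  next
    case False
    then show ?thesis by (auto simp: transfer_def intro!: sum_nonneg)
  qed
  have "exp a * measure m A = (\<integral>x. exp a * indicator A x \<partial>m)"
    using A sets.sets_into_space[OF A(1)] by (simp add: Int_absorb2)
  also have "\<dots> \<le> (\<integral>x. transfer n (indicator ?E) x \<partial>m)"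
    by (rule integral_mono[OF _ measure_transfer(1)[OF sE]]) (use pt integrable_ind[OF A(1)] in auto)
  also have "\<dots> = measure m ?E" by (rule measure_transfer(2)[OF sE])
  finally show ?thesis .
qed

text \<open>The differences along the two orbits form a geometric series, summed backwards from time
  \<open>n\<close>.\<close>

lemma bounded_distortion:
  assumes K: "K > 0" "0 < \<theta>" "\<theta> < 1"
  obtains \<Delta> where "\<Delta> \<ge> 0"
    "\<And>n A x y. A \<subseteq> {0..1} \<Longrightarrow> shrinks K \<theta> n A \<Longrightarrow> x \<in> A \<Longrightarrow> y \<in> A \<Longrightarrow> \<bar>S n x - S n y\<bar> \<le> \<Delta>"
proof -
  obtain \<alpha> C where h: "0 < \<alpha>" "0 \<le> C"
    "\<And>x y. x \<in> {0..1} \<Longrightarrow> y \<in> {0..1} \<Longrightarrow> \<bar>\<phi> x - \<phi> y\<bar> \<le> C * \<bar>x - y\<bar> powr \<alpha>" using holder by blast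
  define q where "q = \<theta> powr \<alpha>"
  have q: "0 < q" "q < 1" using K h powr_less_mono2[of \<alpha> \<theta> 1] by (auto simp: q_def)
  define \<Delta> where "\<Delta> = C * K powr \<alpha> * (1 / (1 - q))"
  have "\<bar>S n x - S n y\<bar> \<le> \<Delta>"
    if A01: "A \<subseteq> {0..1}" and "shrinks K \<theta> n A" and xy: "x \<in> A" "y \<in> A" for n A x y
  proof -
    note A = A01 \<open>shrinks K \<theta> n A\<close>[unfolded shrinks_def, rule_format]
    have "\<bar>S n x - S n y\<bar> = \<bar>\<Sum>k<n. \<phi> ((T ^^ k) x) - \<phi> ((T ^^ k) y)\<bar>" by (simp add: S_def sum_subtractf)
    also have "\<dots> \<le> (\<Sum>k<n. \<bar>\<phi> ((T ^^ k) x) - \<phi> ((T ^^ k) y)\<bar>)" by (rule sum_abs)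
    also have "\<dots> \<le> (\<Sum>k<n. C * K powr \<alpha> * q ^ (n - k))"
    proof (rule sum_mono)
      fix k assume "k \<in> {..<n}"
      then have "\<bar>(T ^^ k) x - (T ^^ k) y\<bar> \<le> K * \<theta> ^ (n - k)" using narrowD[OF A(2)[of k]] xy by auto
      then have "\<bar>(T ^^ k) x - (T ^^ k) y\<bar> powr \<alpha> \<le> (K * \<theta> ^ (n - k)) powr \<alpha>"
        using h by (intro powr_mono2) auto
      also have "\<dots> = K powr \<alpha> * q ^ (n - k)"
        using K by (simp add: powr_mult q_def powr_power powr_powr flip: powr_realpow) (simp add: powr_powr mult.commute)
      finally have "C * \<bar>(T ^^ k) x - (T ^^ k) y\<bar> powr \<alpha> \<le> C * (K powr \<alpha> * q ^ (n - k))"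
        using h by (intro mult_left_mono) auto
      moreover have "\<bar>\<phi> ((T ^^ k) x) - \<phi> ((T ^^ k) y)\<bar> \<le> C * \<bar>(T ^^ k) x - (T ^^ k) y\<bar> powr \<alpha>"
        by (rule h(3)) (use A(1) xy funpow_maps in auto)
      ultimately show "\<bar>\<phi> ((T ^^ k) x) - \<phi> ((T ^^ k) y)\<bar> \<le> C * K powr \<alpha> * q ^ (n - k)" by simp
    qed
    also have "\<dots> = C * K powr \<alpha> * (\<Sum>k<n. q ^ (n - k))" by (simp add: sum_distrib_left)
    also have "(\<Sum>k<n. q ^ (n - k)) = (\<Sum>k<n. q ^ Suc k)"
      by (rule sum.reindex_bij_witness[of _ "\<lambda>k. n - Suc k" "\<lambda>k. n - Suc k"])
        (auto simp: Suc_diff_Suc simp flip: power_Suc)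
    also have "\<dots> \<le> 1 / (1 - q)"
    proof -
      have "(\<Sum>k<n. q ^ Suc k) \<le> (\<Sum>k<n. q ^ k)" by (rule sum_mono) (use q in \<open>auto simp: mult_left_le_one_le\<close>)
      also have "\<dots> \<le> (\<Sum>k. q ^ k)" by (rule sum_le_suminf) (use q in auto)
      also have "\<dots> = 1 / (1 - q)" by (rule suminf_geometric) (use q in auto)
      finally show ?thesis .
    qed
    finally show ?thesis using h(2) by (simp add: \<Delta>_def mult_left_mono)
  qed
  moreover have "\<Delta> \<ge> 0" using h q by (simp add: \<Delta>_def)
  ultimately show thesis using that by blast
qed

end

section \<open>Hyperbolicity of the potential\<close>

context interval_map
begin

text \<open>Among the points whose orbit separates from that of \<open>x\<close> by at least
  \<open>\<rho>\<close> within \<open>n\<close> steps, take the closest one to \<open>x\<close>; on the way to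
  it lies a point that separates by exactly \<open>\<rho> / 2\<close>.\<close>

lemma escape_segment:
  assumes \<rho>: "0 < \<rho>" "\<rho> \<le> 1 / 2" and x: "x \<in> {0..1}"
  shows "\<exists>u\<in>{0..1}. (\<forall>j\<le>n. \<forall>v\<in>{min x u..max x u}. \<bar>(T ^^ j) v - (T ^^ j) x\<bar> < \<rho>) \<and>
    (\<exists>j\<le>n. \<bar>(T ^^ j) u - (T ^^ j) x\<bar> = \<rho> / 2)"
proof -
  define E where "E = (\<Union>j\<in>{..n}. {u \<in> {0..1}. \<rho> \<le> \<bar>(T ^^ j) u - (T ^^ j) x\<bar>})"
  have "closed {u \<in> {0..1}. \<rho> \<le> \<bar>(T ^^ j) u - (T ^^ j) x\<bar>}" for j
    by (intro continuous_on_closed_Collect_le continuous_intros funpow_cont)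
  then have "closed E" unfolding E_def by (intro closed_UN) auto
  moreover have "bounded E" by (rule bounded_subset[of "{0..1}"]) (auto simp: E_def)
  ultimately have "compact E" by (simp add: compact_eq_bounded_closed)
  have "\<bar>0 - x\<bar> \<ge> \<rho> \<or> \<bar>1 - x\<bar> \<ge> \<rho>" using \<rho> x by auto
  then have "0 \<in> E \<or> 1 \<in> E" by (auto simp: E_def intro!: bexI[of _ 0])
  then have "E \<noteq> {}" by auto
  have "continuous_on E (\<lambda>u. \<bar>u - x\<bar>)" by (intro continuous_intros)
  then obtain u1 where u1: "u1 \<in> E" "\<And>u. u \<in> E \<Longrightarrow> \<bar>u1 - x\<bar> \<le> \<bar>u - x\<bar>"
    using continuous_attains_inf[OF \<open>compact E\<close> \<open>E \<noteq> {}\<close>] by blast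
  obtain j where j: "j \<le> n" "u1 \<in> {0..1}" "\<rho> \<le> \<bar>(T ^^ j) u1 - (T ^^ j) x\<bar>"
    using u1(1) by (auto simp: E_def)
  define h where "h u = \<bar>(T ^^ j) u - (T ^^ j) x\<bar>" for u
  let ?s = "{min x u1..max x u1}"
  have s01: "?s \<subseteq> {0..1}" using x j(2) by auto
  have "continuous_on ?s h"
    unfolding h_def by (intro continuous_intros funpow_cont_subset s01)
  then have "connected (h ` ?s)" by (rule connected_continuous_image) simp
  moreover have "h x \<in> h ` ?s" "h u1 \<in> h ` ?s" by auto
  moreover have "h x \<le> \<rho> / 2" "\<rho> / 2 \<le> h u1" using \<rho> j(3) by (auto simp: h_def)
  ultimately have "\<rho> / 2 \<in> h ` ?s" by (meson connectedD_interval)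
  then obtain u where u: "u \<in> ?s" "h u = \<rho> / 2" by auto
  have "u \<noteq> u1" using u(2) j(3) \<rho> by (auto simp: h_def)
  have "\<bar>(T ^^ i) v - (T ^^ i) x\<bar> < \<rho>" if "i \<le> n" "v \<in> {min x u..max x u}" for i v
  proof (rule ccontr)
    assume "\<not> ?thesis"
    moreover have "v \<in> {0..1}" using that(2) u(1) s01 x by (auto simp: min_def max_def split: if_splits)
    ultimately have "v \<in> E" using that(1) unfolding E_def by (intro UN_I[of i]) auto
    then have "\<bar>u1 - x\<bar> \<le> \<bar>v - x\<bar>" by (rule u1(2))
    moreover have "\<bar>v - x\<bar> < \<bar>u1 - x\<bar>"
      using that(2) u(1) \<open>u \<noteq> u1\<close> by (auto simp: min_def max_def split: if_splits)
    ultimately show False by simp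
  qed
  then show ?thesis using u s01 j(1) by (intro bexI[of _ u]) (auto simp: h_def)
qed

end

context conformal_map
begin

text \<open>A neighbourhood of \<open>x\<close> that is small, has bounded distortion up to time
  \<open>n\<close>, and covers the interval \<open>N\<close> steps later.\<close>

definition full_nbhd :: "nat \<Rightarrow> real \<Rightarrow> real \<Rightarrow> nat \<Rightarrow> real \<Rightarrow> real \<Rightarrow> real \<Rightarrow> bool" where
  "full_nbhd N \<epsilon> \<Delta> n x a b \<longleftrightarrow> 0 \<le> a \<and> a \<le> x \<and> x \<le> b \<and> b \<le> 1 \<and> b - a \<le> \<epsilon> \<and>
    (T ^^ (n + N)) ` {a..b} = {0..1} \<and> (\<forall>v\<in>{a..b}. \<forall>w\<in>{a..b}. \<bar>S n v - S n w\<bar> \<le> \<Delta>)"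

text \<open>The segment from \<open>x\<close> to the point given by \<open>escape_segment\<close> works: its
  iterates up to time \<open>n\<close> are short, but one of them has length at least \<open>\<rho> / 2\<close>,
  so the image at time \<open>n\<close> is not too short either.\<close>

lemma small_full_nbhd:
  obtains N0 K \<theta> \<Delta> where "0 < \<theta>" "\<theta> < 1"
    "\<And>n x. x \<in> {0..1} \<Longrightarrow> \<exists>a b. full_nbhd N0 (K * \<theta> ^ n) \<Delta> n x a b"
proof -
  obtain K \<theta> where K: "K > 0" "0 < \<theta>" "\<theta> < 1" and bc: "\<And>r0. r0 > 0 \<Longrightarrow> \<exists>r'>0. \<forall>k A. A \<subseteq> {0..1} \<and> connected A \<and> narrow r' ((T ^^ k) ` A) \<longrightarrow>
      shrinks K \<theta> k A \<and> (\<forall>j\<le>k. narrow r0 ((T ^^ j) ` A))"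
    by (rule backward_contraction) (rule that; assumption)
  obtain r where r: "r > 0" "\<And>k A. A \<subseteq> {0..1} \<Longrightarrow> connected A \<Longrightarrow> narrow r ((T ^^ k) ` A) \<Longrightarrow> shrinks K \<theta> k A"
    using bc[of 1, OF zero_less_one] by metis
  obtain \<Delta> where \<Delta>: "\<And>n A x y. A \<subseteq> {0..1} \<Longrightarrow> shrinks K \<theta> n A \<Longrightarrow> x \<in> A \<Longrightarrow> y \<in> A \<Longrightarrow> \<bar>S n x - S n y\<bar> \<le> \<Delta>"
    by (rule bounded_distortion[OF K]) (rule that; assumption)
  define \<rho> where "\<rho> = min (r / 2) (1 / 2)"
  have \<rho>: "0 < \<rho>" "\<rho> \<le> 1 / 2" "2 * \<rho> \<le> r" using r(1) by (auto simp: \<rho>_def)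
  have \<rho>2: "\<rho> / 2 > 0" using \<rho> by simp
  obtain d where d: "d > 0" "\<And>a b m. 0 \<le> a \<Longrightarrow> b \<le> 1 \<Longrightarrow> \<rho> / 2 \<le> b - a \<Longrightarrow> \<not> narrow d ((T ^^ m) ` {a..b})"
    by (rule covering_timeE[OF \<rho>2]) (rule that; assumption)
  obtain N0 where N0: "\<And>a b m. 0 \<le> a \<Longrightarrow> b \<le> 1 \<Longrightarrow> d \<le> b - a \<Longrightarrow> m \<ge> N0 \<Longrightarrow> (T ^^ m) ` {a..b} = {0..1}"
    by (rule covering_timeE[OF d(1)]) (rule that; assumption)
  have "\<exists>a b. full_nbhd N0 (K * \<theta> ^ n) \<Delta> n x a b" if x: "x \<in> {0..1}" for n x
  proof -
    obtain u j where u: "u \<in> {0..1}"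
      "\<And>i v. i \<le> n \<Longrightarrow> v \<in> {min x u..max x u} \<Longrightarrow> \<bar>(T ^^ i) v - (T ^^ i) x\<bar> < \<rho>"
      "j \<le> n" "\<bar>(T ^^ j) u - (T ^^ j) x\<bar> = \<rho> / 2"
      using escape_segment[OF \<rho>(1,2) x, of n] by blast
    define a b where "a = min x u" and "b = max x u"
    have ab: "0 \<le> a" "a \<le> x" "x \<le> b" "b \<le> 1" "{a..b} \<subseteq> {0..1}"
      using x u(1) by (auto simp: a_def b_def)
    have con: "connected ((T ^^ i) ` {a..b})" for i
      by (rule connected_continuous_image[OF funpow_cont_subset[OF ab(5)]]) simp
    have "narrow r ((T ^^ n) ` {a..b})"
      unfolding narrow_def
    proof (intro ballI)
      fix p q assume "p \<in> (T ^^ n) ` {a..b}" "q \<in> (T ^^ n) ` {a..b}"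
      then have "\<bar>p - (T ^^ n) x\<bar> < \<rho>" "\<bar>q - (T ^^ n) x\<bar> < \<rho>" using u(2)[of n] by (auto simp: a_def b_def)
      then show "\<bar>p - q\<bar> \<le> r" using \<rho>(3) by linarith
    qed
    then have nar: "shrinks K \<theta> n {a..b}" by (intro r(2) ab(5)) auto
    then have "narrow (K * \<theta> ^ (n - 0)) ((T ^^ 0) ` {a..b})" unfolding shrinks_def by blast
    then have "narrow (K * \<theta> ^ n) {a..b}" by simp
    then have len: "b - a \<le> K * \<theta> ^ n" using narrowD[of _ "{a..b}" b a] ab by auto
    let ?p = "min ((T ^^ j) u) ((T ^^ j) x)" and ?q = "max ((T ^^ j) u) ((T ^^ j) x)"
    have sub: "{?p..?q} \<subseteq> (T ^^ j) ` {a..b}"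
      by (rule connected_between[OF con]) (auto simp: a_def b_def)
    have pq: "0 \<le> ?p" "?q \<le> 1" "\<rho> / 2 \<le> ?q - ?p"
      using funpow_maps[OF u(1), of j] funpow_maps[OF x, of j] u(4) by (auto simp: min_def max_def)
    have "\<not> narrow d ((T ^^ (n - j)) ` {?p..?q})" by (rule d(2)[OF pq])
    moreover have "(T ^^ (n - j)) ` {?p..?q} \<subseteq> (T ^^ n) ` {a..b}"
      using image_mono[OF sub, of "T ^^ (n - j)"] funpow_image_add[of "n - j" j] u(3) by simp
    ultimately have "\<not> narrow d ((T ^^ n) ` {a..b})" using narrow_subset by blast
    then obtain p q where pq: "p \<in> (T ^^ n) ` {a..b}" "q \<in> (T ^^ n) ` {a..b}" "\<bar>p - q\<bar> > d"
      by (force simp: narrow_def)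
    have "{min p q..max p q} \<subseteq> (T ^^ n) ` {a..b}" by (rule connected_between[OF con pq(1,2)])
    then have sub2: "(T ^^ N0) ` {min p q..max p q} \<subseteq> (T ^^ N0) ` ((T ^^ n) ` {a..b})" by (rule image_mono)
    have "(T ^^ N0) ` {min p q..max p q} = {0..1}"
    proof (rule N0[OF _ _ _ order_refl])
      have "p \<in> {0..1}" "q \<in> {0..1}" using pq(1,2) funpow_image_subset[OF ab(5), of n] by blast+
      then show "0 \<le> min p q" "max p q \<le> 1" by auto
      show "d \<le> max p q - min p q" using pq(3) by (auto simp: min_def max_def)
    qed
    then have "{0..1} \<subseteq> (T ^^ (n + N0)) ` {a..b}"
      using sub2 funpow_image_add[of N0 n "{a..b}"] by (simp add: add.commute)
    then have full: "(T ^^ (n + N0)) ` {a..b} = {0..1}" using funpow_image_subset[OF ab(5)] by blast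
    have "full_nbhd N0 (K * \<theta> ^ n) \<Delta> n x a b"
      using ab len full \<Delta>[OF ab(5) nar] by (simp add: full_nbhd_def)
    then show ?thesis by blast
  qed
  then show thesis using that K by blast
qed

lemma punctured_nbhd_small:
  assumes "\<epsilon> > 0"
  shows "\<exists>\<delta>>0. measure m ((ball w \<delta> \<inter> {0..1}) - {w}) < \<epsilon>"
proof -
  define U where "U k = (ball w (1 / (real k + 1)) \<inter> {0..1}) - {w}" for k :: nat
  have U: "range U \<subseteq> sets m" by (auto simp: U_def sets_m_iff)
  have "decseq U"
  proof (rule decseq_SucI)
    fix k
    have "1 / (real (Suc k) + 1) \<le> 1 / (real k + 1)" by (intro divide_left_mono) auto
    then have "ball w (1 / (real (Suc k) + 1)) \<subseteq> ball w (1 / (real k + 1))" by (rule subset_ball)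
    then show "U (Suc k) \<subseteq> U k" unfolding U_def by blast
  qed
  then have "(\<lambda>k. measure m (U k)) \<longlonglongrightarrow> measure m (\<Inter>k. U k)"
    by (rule finite_Lim_measure_decseq[OF U])
  also have "(\<Inter>k. U k) = {}"
  proof (rule ccontr)
    assume "(\<Inter>k. U k) \<noteq> {}"
    then obtain x where x: "\<And>k. x \<in> U k" by blast
    then have "dist w x > 0" by (auto simp: U_def)
    then obtain k where "inverse (real (Suc k)) < dist w x" using reals_Archimedean by blast
    then have "x \<notin> U k" by (auto simp: U_def field_simps)
    then show False using x by blast
  qed
  finally have "(\<lambda>k. measure m (U k)) \<longlonglongrightarrow> 0" by simp
  then have "\<forall>\<^sub>F k in sequentially. measure m (U k) < \<epsilon>" using assms by (rule order_tendstoD)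
  then obtain k where "measure m (U k) < \<epsilon>" by (auto simp: eventually_sequentially)
  then show ?thesis by (intro exI[of _ "1 / (real k + 1)"]) (auto simp: U_def)
qed

text \<open>If \<open>S n\<close> is nonnegative at \<open>x n\<close> for every \<open>n\<close>, it is at
  least \<open>- \<Delta>\<close> on a tiny neighbourhood of \<open>x n\<close> that covers everything at time
  \<open>n + N0\<close>; so a proportion \<open>c\<close> of any set \<open>A\<close> pulls back into that
  neighbourhood. Along a subsequence these neighbourhoods shrink to a point \<open>w\<close>. Punctured
  neighbourhoods of \<open>w\<close> have vanishing mass, so \<open>w\<close> itself must enter \<open>A\<close>
  eventually along the subsequence, for every \<open>A\<close> of positive mass. Two disjoint sets give a
  contradiction.\<close>

lemma S_negative: "\<exists>n\<ge>1. \<forall>x\<in>{0..1}. S n x < 0"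
proof (rule ccontr)
  assume "\<not> ?thesis"
  then have "\<forall>n. \<exists>x. n \<ge> 1 \<longrightarrow> x \<in> {0..1} \<and> S n x \<ge> 0" by (meson not_le)
  then obtain x where x: "\<And>n. n \<ge> 1 \<Longrightarrow> x n \<in> {0..1}" "\<And>n. n \<ge> 1 \<Longrightarrow> S n (x n) \<ge> 0" by metis
  obtain N0 K \<theta> \<Delta> where th: "0 < \<theta>" "\<theta> < 1"
    and nb: "\<And>n x. x \<in> {0..1} \<Longrightarrow> \<exists>a b. full_nbhd N0 (K * \<theta> ^ n) \<Delta> n x a b"
    by (rule small_full_nbhd) (rule that; assumption)
  have "\<forall>n. \<exists>a b. n \<ge> 1 \<longrightarrow> full_nbhd N0 (K * \<theta> ^ n) \<Delta> n (x n) a b"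
    using nb x(1) by blast
  then obtain a b where fn: "\<And>n. n \<ge> 1 \<Longrightarrow> full_nbhd N0 (K * \<theta> ^ n) \<Delta> n (x n) (a n) (b n)" by metis
  note ab = fn[unfolded full_nbhd_def]
  obtain B where B: "B \<ge> 0" "\<forall>x\<in>{0..1}. \<bar>\<phi> x\<bar> \<le> B" using phi_bound by blast
  define c where "c = exp (- \<Delta> - N0 * B)"
  have mass: "c * measure m A \<le> measure m {v \<in> {a n..b n}. (T ^^ (n + N0)) v \<in> A}"
    if "n \<ge> 1" "A \<in> sets m" for n A
    unfolding c_def
  proof (rule measure_preimage_ge)
    note abn = ab[OF that(1)]
    show "{a n..b n} \<in> sets m" using abn by (auto simp: sets_m_iff)
    show "A \<in> sets m" by fact
    then have "A \<subseteq> {0..1}" by (simp add: sets_m_iff)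
    then show "A \<subseteq> (T ^^ (n + N0)) ` {a n..b n}" using abn by simp
    fix w assume w: "w \<in> {a n..b n}"
    then have w01: "w \<in> {0..1}" using abn by auto
    have "x n \<in> {a n..b n}" using abn by simp
    then have "\<bar>S n (x n) - S n w\<bar> \<le> \<Delta>" using abn w by blast
    then have "S n w \<ge> - \<Delta>" using x(2)[OF that(1)] by linarith
    moreover have "\<bar>S N0 ((T ^^ n) w)\<bar> \<le> N0 * B" by (rule S_bound[OF B(2) funpow_maps[OF w01]])
    ultimately show "- \<Delta> - N0 * B \<le> S (n + N0) w" by (simp add: S_add)
  qed
  have c: "c > 0" by (simp add: c_def)
  obtain w f where wf: "w \<in> {0..1}" "strict_mono f" "((\<lambda>n. x (Suc n)) \<circ> f) \<longlonglongrightarrow> w"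
    using compact_imp_seq_compact[OF compact_Icc[of 0 "1::real"]] x(1) seq_compactE[of "{0..1::real}" "\<lambda>n. x (Suc n)"]
    by (metis le_add1 plus_1_eq_Suc)
  have hit: "\<exists>N. \<forall>k\<ge>N. (T ^^ (Suc (f k) + N0)) w \<in> A" if A: "A \<in> sets m" "measure m A > 0" for A
  proof -
    obtain \<delta> where \<delta>: "\<delta> > 0" "measure m ((ball w \<delta> \<inter> {0..1}) - {w}) < c * measure m A"
      using punctured_nbhd_small[of "c * measure m A"] A(2) c by auto
    have "(\<lambda>n. K * \<theta> ^ n) \<longlonglongrightarrow> K * 0" by (intro tendsto_intros LIMSEQ_realpow_zero) (use th in auto)
    then have "((\<lambda>n. K * \<theta> ^ n) \<circ> (\<lambda>k. Suc (f k))) \<longlonglongrightarrow> K * 0"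
      by (rule LIMSEQ_subseq_LIMSEQ) (use wf(2) in \<open>auto simp: strict_mono_def\<close>)
    then have e1: "\<forall>\<^sub>F k in sequentially. K * \<theta> ^ Suc (f k) < \<delta> / 2"
      using \<delta>(1) order_tendstoD(2)[of _ 0 sequentially "\<delta> / 2"] by (auto simp: o_def)
    have e2: "\<forall>\<^sub>F k in sequentially. dist (x (Suc (f k))) w < \<delta> / 2"
      using tendstoD[OF wf(3), of "\<delta> / 2"] \<delta>(1) by (auto simp: o_def)
    have "\<forall>\<^sub>F k in sequentially. (T ^^ (Suc (f k) + N0)) w \<in> A"
      using eventually_conj[OF e1 e2]
    proof eventually_elim
      case (elim k)
      let ?n = "Suc (f k)"
      note abn = ab[of ?n, simplified]
      show ?case
      proof (rule ccontr)
        assume no: "(T ^^ (?n + N0)) w \<notin> A"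
        have "{v \<in> {a ?n..b ?n}. (T ^^ (?n + N0)) v \<in> A} \<subseteq> (ball w \<delta> \<inter> {0..1}) - {w}"
        proof
          fix v assume v: "v \<in> {v \<in> {a ?n..b ?n}. (T ^^ (?n + N0)) v \<in> A}"
          have "b ?n - a ?n < \<delta> / 2" using abn elim by auto
          then have "v - x ?n < \<delta> / 2" "x ?n - v < \<delta> / 2" using v abn by auto
          then have "\<bar>v - x ?n\<bar> < \<delta> / 2" by (smt (verit))
          moreover have "\<bar>x ?n - w\<bar> < \<delta> / 2" using elim by (simp add: dist_real_def)
          ultimately have "\<bar>w - v\<bar> < \<delta>" by linarith
          then have "dist w v < \<delta>" by (simp add: dist_real_def)
          moreover have "v \<noteq> w" using v no by auto
          ultimately show "v \<in> (ball w \<delta> \<inter> {0..1}) - {w}" using v abn by auto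
        qed
        then have "measure m {v \<in> {a ?n..b ?n}. (T ^^ (?n + N0)) v \<in> A} \<le> measure m ((ball w \<delta> \<inter> {0..1}) - {w})"
          by (rule finite_measure_mono) (auto simp: sets_m_iff)
        then show False using mass[of ?n A] A(1) \<delta>(2) by auto
      qed
    qed
    then show ?thesis by (simp add: eventually_sequentially)
  qed
  have A: "{0..<1/2} \<in> sets m" "{1/2..1} \<in> sets m" by (auto simp: sets_m_iff)
  have "measure m {0..<1/2} > 0"
    by (rule less_le_trans[OF supp[of 0 "1/2"]]) (auto intro!: finite_measure_mono A)
  moreover have "measure m {1/2..1} > 0"
    by (rule less_le_trans[OF supp[of "1/2" 1]]) (auto intro!: finite_measure_mono A)
  ultimately obtain N1 N2 where "\<forall>k\<ge>N1. (T ^^ (Suc (f k) + N0)) w \<in> {0..<1/2}"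
    "\<forall>k\<ge>N2. (T ^^ (Suc (f k) + N0)) w \<in> {1/2..1}" using hit A by meson
  then have "(T ^^ (Suc (f (max N1 N2)) + N0)) w \<in> {0..<1/2} \<inter> {1/2..1}"
    by (metis IntI max.cobounded1 max.cobounded2)
  then show False by auto
qed

text \<open>Negativity of one \<open>S p\<close> is uniform by compactness and adds up over blocks of length
  \<open>p\<close>.\<close>

lemma S_decay:
  obtains C \<gamma> :: real where "\<gamma> > 0" "\<And>n x. x \<in> {0..1} \<Longrightarrow> S n x \<le> C - \<gamma> * real n"
proof -
  obtain p where p: "p \<ge> 1" "\<And>x. x \<in> {0..1} \<Longrightarrow> S p x < 0" using S_negative by blast
  have "\<exists>x\<in>{0..1}. \<forall>y\<in>{0..1}. S p y \<le> S p x"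
    by (rule continuous_attains_sup[OF _ _ S_cont]) auto
  then obtain x0 where x0: "x0 \<in> {0..1}" "\<And>y. y \<in> {0..1} \<Longrightarrow> S p y \<le> S p x0" by blast
  define \<delta> where "\<delta> = - S p x0"
  have \<delta>: "\<delta> > 0" using p(2)[OF x0(1)] by (simp add: \<delta>_def)
  obtain B where B: "B \<ge> 0" "\<forall>x\<in>{0..1}. \<bar>\<phi> x\<bar> \<le> B" using phi_bound by blast
  have q: "S (q * p) x \<le> - \<delta> * q" if "x \<in> {0..1}" for q x
    using that
  proof (induction q arbitrary: x)
    case 0
    then show ?case by (simp add: S_def)
  next
    case (Suc q)
    have "S (Suc q * p) x = S p x + S (q * p) ((T ^^ p) x)" by (simp add: S_add)
    also have "\<dots> \<le> - \<delta> + - \<delta> * q"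
      by (intro add_mono Suc.IH funpow_maps Suc.prems) (use x0(2)[OF Suc.prems] in \<open>simp add: \<delta>_def\<close>)
    finally show ?case by (simp add: algebra_simps)
  qed
  have "S n x \<le> (\<delta> + p * B) - \<delta> / p * real n" if x: "x \<in> {0..1}" for n x
  proof -
    have "S n x = S (n div p * p) x + S (n mod p) ((T ^^ (n div p * p)) x)"
      using S_add[of "n div p * p" "n mod p" x] by simp
    moreover have "S (n div p * p) x \<le> - \<delta> * (n div p)" by (rule q[OF x])
    moreover have "S (n mod p) ((T ^^ (n div p * p)) x) \<le> (n mod p) * B"
      using S_bound[OF B(2) funpow_maps[OF x], of "n mod p" "n div p * p"] by linarith
    moreover have "(n mod p) * B \<le> p * B" using p(1) B(1) by (intro mult_right_mono) (auto intro: less_imp_le)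
    moreover have "- \<delta> * (n div p) \<le> \<delta> - \<delta> / p * n"
    proof -
      have "n < p * (n div p) + p" using p(1) by (metis add_less_cancel_left div_mult_mod_eq mod_less_divisor mult.commute less_le_trans zero_less_one)
      then have "real n \<le> real (p * (n div p) + p)" using of_nat_le_iff less_imp_le by blast
      then have "\<delta> * real n \<le> \<delta> * (real p * real (n div p) + real p)" using \<delta> by simp
      then have "\<delta> * real n / p \<le> \<delta> * (real (n div p) + 1)" using p(1) by (simp add: field_simps)
      then show ?thesis by (simp add: algebra_simps)
    qed
    ultimately show ?thesis by linarith
  qed
  moreover have "\<delta> / p > 0" using \<delta> p(1) by simp
  ultimately show thesis using that by blast
qed

section \<open>Mass of narrow pullbacks\<close>

lemma connected_sets:
  fixes A :: "real set"
  assumes "connected A" "A \<subseteq> {0..1}"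
  shows "A \<in> sets m"
  using assms real_interval_borel_measurable by (auto simp: sets_m_iff is_interval_connected_1)

text \<open>\<open>exp (S k)\<close> decays exponentially at rate \<open>\<gamma>\<close>, and the number of
  preimages grows only at half this rate because a narrow set rarely passes over critical points.\<close>

lemma narrow_preimage_mass:
  obtains C \<beta> r :: real where "C > 0" "\<beta> > 0" "r > 0"
    "\<And>A B k. A \<subseteq> {0..1} \<Longrightarrow> connected A \<Longrightarrow> \<forall>j<k. narrow r ((T ^^ j) ` A) \<Longrightarrow> B \<in> sets m \<Longrightarrow>
      measure m {x \<in> A. (T ^^ k) x \<in> B} \<le> C * exp (- \<beta> * real k) * measure m B"
proof -
  obtain CH \<gamma> :: real where H: "\<gamma> > 0" "\<And>n x. x \<in> {0..1} \<Longrightarrow> S n x \<le> CH - \<gamma> * real n"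
    by (rule S_decay) (rule that; assumption)
  define p where "p = card crit"
  \<comment> \<open>spacing so large that \<open>2 ^ card ?V\<close> is at most \<open>exp (\<gamma> / 2 * k)\<close> up to a constant\<close>
  obtain R :: nat where R: "real R > p * ln 2 / (\<gamma> / 2)" using reals_Archimedean2 by blast
  have Rq: "p * ln 2 / real (R + 1) \<le> \<gamma> / 2"
  proof -
    have "p * ln 2 < real R * (\<gamma> / 2)" using R H(1) by (simp add: field_simps)
    also have "\<dots> \<le> real (R + 1) * (\<gamma> / 2)" using H(1) by (intro mult_right_mono) auto
    finally show ?thesis by (simp add: field_simps)
  qed
  obtain \<rho> where \<rho>: "\<rho> > 0"
    "\<And>x n. x \<in> {0..1} \<Longrightarrow> real (card (visits \<rho> n x)) \<le> p * (real n / real (R + 1) + 1)"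
    using rare_critical_visits[of R] unfolding p_def by blast
  obtain g where g: "g > 0" "\<forall>c\<in>crit. \<forall>c'\<in>crit. \<bar>c - c'\<bar> \<le> g \<longrightarrow> c = c'" using crit_gap by blast
  define r where "r = min \<rho> g"
  define C where "C = exp (p * ln 2) * exp CH"
  have "measure m {x \<in> A. (T ^^ k) x \<in> B} \<le> C * exp (- (\<gamma> / 2) * real k) * measure m B"
    if A': "A \<subseteq> {0..1}" "connected A" "\<forall>j<k. narrow r ((T ^^ j) ` A)" and B: "B \<in> sets m" for A B k
  proof (cases "A = {}")
    case True
    then show ?thesis by (simp add: C_def)
  next
    case False
    then obtain e where e: "e \<in> A" by blast
    note A = A'(1,2) A'(3)[rule_format]
    have sA: "A \<in> sets m" by (rule connected_sets[OF A(2,1)])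
    let ?V = "{j. j < k \<and> (T ^^ j) ` A \<inter> crit \<noteq> {}}"
    have "?V \<subseteq> visits \<rho> k e"
    proof
      fix j assume "j \<in> ?V"
      then obtain c where c: "j < k" "c \<in> (T ^^ j) ` A" "c \<in> crit" by blast
      have "\<bar>(T ^^ j) e - c\<bar> \<le> r" by (rule narrowD[OF A(3)]) (use c e in auto)
      then show "j \<in> visits \<rho> k e" using c by (auto simp: visits_def r_def)
    qed
    moreover have "finite (visits \<rho> k e)" by (auto simp: visits_def)
    ultimately have "card ?V \<le> card (visits \<rho> k e)" by (simp add: card_mono)
    then have cV: "real (card ?V) \<le> p * (real k / real (R + 1) + 1)"
      using \<rho>(2)[of e k] e A(1) by (meson of_nat_le_iff order_trans subsetD)
    have M: "real (card {w \<in> A. (T ^^ k) w = z}) \<le> exp (p * ln 2) * exp (\<gamma> / 2 * k)" for z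
    proof -
      have "card {w \<in> A. (T ^^ k) w = z} \<le> 2 ^ card ?V"
        by (rule fibre_card[OF A(1,2) g(2)]) (use A(3) narrow_mono[of r _ g] in \<open>auto simp: r_def\<close>)
      then have "real (card {w \<in> A. (T ^^ k) w = z}) \<le> real (2 ^ card ?V)" using of_nat_le_iff by blast
      also have "\<dots> = exp (real (card ?V) * ln 2)" by (simp add: exp_of_nat_mult)
      also have "\<dots> \<le> exp (p * (real k / real (R + 1) + 1) * ln 2)"
        using cV by (intro iffD2[OF exp_le_cancel_iff] mult_right_mono) auto
      also have "p * (real k / real (R + 1) + 1) * ln 2 = k * (p * ln 2 / real (R + 1)) + p * ln 2"
        by (simp add: algebra_simps)
      also have "exp \<dots> \<le> exp (k * (\<gamma> / 2) + p * ln 2)"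
        using Rq by (intro iffD2[OF exp_le_cancel_iff] add_right_mono mult_left_mono) auto
      also have "\<dots> = exp (p * ln 2) * exp (\<gamma> / 2 * k)" by (simp add: exp_add mult.commute)
      finally show ?thesis .
    qed
    have "measure m {x \<in> A. (T ^^ k) x \<in> B} \<le> exp (p * ln 2) * exp (\<gamma> / 2 * k) * exp (CH - \<gamma> * k) * measure m B"
      by (rule measure_preimage_le[OF sA B M]) (use H(2) A(1) in auto)
    also have "exp (p * ln 2) * exp (\<gamma> / 2 * k) * exp (CH - \<gamma> * k) = C * exp (- (\<gamma> / 2) * k)"
      by (simp add: C_def flip: exp_add)
    finally show ?thesis .
  qed
  moreover have "C > 0" "r > 0" "\<gamma> / 2 > 0" using \<rho> g H by (auto simp: C_def r_def)
  ultimately show thesis by (intro that[of C "\<gamma> / 2" r])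
qed

lemma T_lipschitz: "\<exists>L\<ge>2. \<forall>x\<in>{0..1}. \<forall>y\<in>{0..1}. \<bar>T x - T y\<bar> \<le> L * \<bar>x - y\<bar>"
proof -
  obtain L where L: "L \<ge> 1" "\<And>x. x \<in> {0..1} \<Longrightarrow> \<bar>T1 x\<bar> \<le> L" using T1_bound by blast
  have le: "\<bar>T y - T x\<bar> \<le> max L 2 * \<bar>y - x\<bar>" if xy: "x \<in> {0..1}" "y \<in> {0..1}" "x \<le> y" for x y
  proof -
    obtain z where z: "z \<in> {x..y}" "T y - T x = T1 z * (y - x)" using T_mvt[of x y] xy by auto
    have "\<bar>T1 z\<bar> \<le> max L 2" using L(2)[of z] z xy by auto
    then show ?thesis by (simp add: z(2) abs_mult mult_right_mono)
  qed
  have "\<bar>T x - T y\<bar> \<le> max L 2 * \<bar>x - y\<bar>" if "x \<in> {0..1}" "y \<in> {0..1}" for x y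
    using le[of x y] le[of y x] that by (cases "x \<le> y") (auto simp: abs_minus_commute)
  then show ?thesis by (intro exI[of _ "max L 2"]) auto
qed

text \<open>An interval of length \<open>d\<close> stays narrow for about \<open>ln (r / d) / ln L\<close>
  steps, where \<open>L\<close> is a Lipschitz constant of \<open>T\<close>, and its mass decays exponentially
  in this number.\<close>

lemma mass_of_interval:
  obtains C s :: real where "C > 0" "s > 0"
    "\<And>A d. A \<subseteq> {0..1} \<Longrightarrow> connected A \<Longrightarrow> narrow d A \<Longrightarrow> d > 0 \<Longrightarrow> measure m A \<le> C * d powr s"
proof -
  obtain C \<beta> r :: real where C: "C > 0" "\<beta> > 0" "r > 0" "\<And>A B k. A \<subseteq> {0..1} \<Longrightarrow> connected A \<Longrightarrow>
    \<forall>j<k. narrow r ((T ^^ j) ` A) \<Longrightarrow> B \<in> sets m \<Longrightarrow>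
    measure m {x \<in> A. (T ^^ k) x \<in> B} \<le> C * exp (- \<beta> * real k) * measure m B"
    by (rule narrow_preimage_mass) (rule that; assumption)
  obtain L where L: "L \<ge> 2" "\<And>x y. x \<in> {0..1} \<Longrightarrow> y \<in> {0..1} \<Longrightarrow> \<bar>T x - T y\<bar> \<le> L * \<bar>x - y\<bar>"
    using T_lipschitz by blast
  have nar: "narrow (L ^ j * d) ((T ^^ j) ` A)" if "A \<subseteq> {0..1}" "narrow d A" for A d j
  proof (induction j)
    case (Suc j)
    show ?case
      unfolding narrow_def
    proof (intro ballI)
      fix u v assume "u \<in> (T ^^ Suc j) ` A" "v \<in> (T ^^ Suc j) ` A"
      then obtain x y where xy: "x \<in> A" "y \<in> A" "u = T ((T ^^ j) x)" "v = T ((T ^^ j) y)" by auto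
      have "\<bar>u - v\<bar> \<le> L * \<bar>(T ^^ j) x - (T ^^ j) y\<bar>"
        unfolding xy by (rule L(2)) (use xy that funpow_maps in blast)+
      also have "\<dots> \<le> L * (L ^ j * d)" using narrowD[OF Suc] xy L(1) by (intro mult_left_mono) auto
      finally show "\<bar>u - v\<bar> \<le> L ^ Suc j * d" by (simp add: mult.assoc)
    qed
  qed (use that in simp)
  define s where "s = \<beta> / ln L"
  have lnL: "ln L > 0" using L by simp
  have s: "s > 0" using C lnL by (simp add: s_def)
  define C' where "C' = max (C * exp \<beta>) 1 / r powr s"
  have "measure m A \<le> C' * d powr s" if A: "A \<subseteq> {0..1}" "connected A" "narrow d A" "d > 0" for A d
  proof (cases "d \<le> r")
    case False
    have "measure m A \<le> 1" by simp
    also have "1 \<le> d powr s / r powr s"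
      using False C s by (simp add: powr_mono2)
    also have "\<dots> = 1 * (d powr s / r powr s)" by simp
    also have "\<dots> \<le> max (C * exp \<beta>) 1 * (d powr s / r powr s)" by (intro mult_right_mono) auto
    also have "\<dots> = C' * d powr s" by (simp add: C'_def)
    finally show ?thesis .
  next
    case True
    define k where "k = nat \<lfloor>ln (r / d) / ln L\<rfloor>"
    have q0: "0 \<le> ln (r / d) / ln L" using True A C lnL by simp
    have k: "real k \<le> ln (r / d) / ln L" "ln (r / d) / ln L < real k + 1"
      using q0 by (auto simp: k_def)
    have "L ^ j * d \<le> r" if "j < k" for j
    proof -
      have "L ^ j * d \<le> L ^ k * d" using that L A by (intro mult_right_mono power_increasing) auto
      moreover have "L ^ k = exp (real k * ln L)" using L by (simp add: exp_of_nat_mult)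
      moreover have "exp (real k * ln L) \<le> exp (ln (r / d))"
        using k(1) lnL by (simp add: field_simps)
      moreover have "exp (ln (r / d)) = r / d" using A C by simp
      ultimately have "L ^ j * d \<le> L ^ k * d" "L ^ k \<le> r / d" by linarith+
      moreover have "L ^ k * d \<le> r / d * d" by (rule mult_right_mono[OF calculation(2)]) (use A in simp)
      moreover have "r / d * d = r" using A(4) by simp
      ultimately show ?thesis by linarith
    qed
    then have nr: "\<forall>j<k. narrow r ((T ^^ j) ` A)"
      using nar[OF A(1,3)] narrow_mono by blast
    have "{x \<in> A. (T ^^ k) x \<in> {0..1}} = A" using A(1) funpow_maps by blast
    then have "measure m A \<le> C * exp (- \<beta> * k) * measure m {0..1}"
      using C(4)[OF A(1,2) nr I_sets] by simp
    also have "measure m {0..1} = 1" using prob_space space_m by simp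
    also have "exp (- \<beta> * k) \<le> exp (\<beta> - \<beta> * (ln (r / d) / ln L))"
    proof -
      have "\<beta> * (ln (r / d) / ln L) \<le> \<beta> * (real k + 1)" using k C by (intro mult_left_mono) auto
      then show ?thesis by (simp add: algebra_simps)
    qed
    also have "exp (\<beta> - \<beta> * (ln (r / d) / ln L)) = exp \<beta> * (r / d) powr (- s)"
      using A C by (simp add: powr_def s_def exp_diff exp_minus field_simps)
    also have "(r / d) powr (- s) = d powr s / r powr s"
      using A C by (simp add: powr_minus powr_divide)
    finally have "measure m A \<le> C * (exp \<beta> * (d powr s / r powr s))" using C(1) by simp
    also have "\<dots> = (C * exp \<beta>) * (d powr s / r powr s)" by simp
    also have "\<dots> \<le> max (C * exp \<beta>) 1 * (d powr s / r powr s)" by (intro mult_right_mono) auto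
    finally show ?thesis by (simp add: C'_def)
  qed
  moreover have "C' > 0" using C by (simp add: C'_def)
  ultimately show thesis using that s by blast
qed

end

section \<open>Univalent branches\<close>

lemma geometric_tail:
  fixes q c :: real
  assumes "0 < q" "q < 1" "c \<ge> 0"
  obtains R where "\<And>n. c * (\<Sum>k\<in>{R<..n}. q ^ k) \<le> 1 / 2"
proof -
  have bd: "(1 - q) * (\<Sum>k\<in>{R<..n}. q ^ k) \<le> q ^ Suc R" for R n
  proof -
    have "(1 - q) * (\<Sum>k\<in>{R<..R + i}. q ^ k) = q ^ Suc R - q ^ Suc (R + i)" for i
    proof (induction i)
      case (Suc i)
      have "{R<..R + Suc i} = insert (Suc (R + i)) {R<..R + i}" by auto
      then have "(1 - q) * (\<Sum>k\<in>{R<..R + Suc i}. q ^ k)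
        = (1 - q) * q ^ Suc (R + i) + (1 - q) * (\<Sum>k\<in>{R<..R + i}. q ^ k)" by (simp add: distrib_left)
      also have "\<dots> = q ^ Suc R - q ^ Suc (R + Suc i)" unfolding Suc by (simp add: algebra_simps)
      finally show ?case .
    qed simp
    from this[of "n - R"] have "n \<ge> R \<Longrightarrow> ?thesis" using assms by simp
    moreover have "n < R \<Longrightarrow> ?thesis" using assms by simp
    ultimately show ?thesis by linarith
  qed
  have "(\<lambda>R. c * (q ^ Suc R / (1 - q))) \<longlonglongrightarrow> c * (0 / (1 - q))"
    by (intro tendsto_intros LIMSEQ_Suc LIMSEQ_realpow_zero) (use assms in auto)
  then have "\<forall>\<^sub>F R in sequentially. c * (q ^ Suc R / (1 - q)) < 1 / 2"
    by (rule order_tendstoD(2)) simp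
  then obtain R where R: "c * (q ^ Suc R / (1 - q)) < 1 / 2" by (auto simp: eventually_sequentially)
  have "c * (\<Sum>k\<in>{R<..n}. q ^ k) \<le> 1 / 2" for n
  proof -
    have "(\<Sum>k\<in>{R<..n}. q ^ k) \<le> q ^ Suc R / (1 - q)" using bd[of R n] assms by (simp add: field_simps)
    then have "c * (\<Sum>k\<in>{R<..n}. q ^ k) \<le> c * (q ^ Suc R / (1 - q))" using assms by (intro mult_left_mono)
    then show ?thesis using R by linarith
  qed
  then show thesis by (rule that)
qed

context interval_map
begin

text \<open>The inverse branches of \<open>T ^^ n\<close> over \<open>D\<close>: the components of the preimage
  that are mapped onto \<open>D\<close> injectively.\<close>

definition branches :: "nat \<Rightarrow> real set \<Rightarrow> real set set" where
  "branches n D = {W \<in> components {x \<in> {0..1}. (T ^^ n) x \<in> D}.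
     open W \<and> inj_on (T ^^ n) W \<and> (T ^^ n) ` W = D}"

text \<open>The end points count as singular because a component that ends at one of them need not be mapped
  onto \<open>D\<close>.\<close>

definition sing :: "real set" where "sing = crit \<union> {0, 1}"

definition pullback :: "nat \<Rightarrow> real set \<Rightarrow> real \<Rightarrow> real set" where
  "pullback k D = connected_component_set {u \<in> {0..1}. (T ^^ k) u \<in> D}"

lemma finite_sing: "finite sing" and sing_subset: "sing \<subseteq> {0..1}"
  using finite_crit crit_subset by (auto simp: sing_def)

lemma pullback_subset: "pullback k D s \<subseteq> {u \<in> {0..1}. (T ^^ k) u \<in> D}"
  unfolding pullback_def by (rule connected_component_subset)

lemma pullback_connected: "connected (pullback k D s)"
  unfolding pullback_def by (rule connected_connected_component)

lemma branch_facts: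
  assumes "W \<in> branches n D"
  shows "W \<subseteq> {0..1}" "connected W" "open W" "inj_on (T ^^ n) W" "(T ^^ n) ` W = D" "W \<noteq> {}"
proof -
  have c: "W \<in> components {x \<in> {0..1}. (T ^^ n) x \<in> D}" using assms by (simp add: branches_def)
  show "W \<subseteq> {0..1}" using in_components_subset[OF c] by auto
  show "connected W" by (rule in_components_connected[OF c])
  show "W \<noteq> {}" by (rule in_components_nonempty[OF c])
  show "open W" "inj_on (T ^^ n) W" "(T ^^ n) ` W = D" using assms by (simp_all add: branches_def)
qed

lemma branches_disjoint:
  assumes "W \<in> branches n D" "W' \<in> branches n D" "W \<noteq> W'"
  shows "W \<inter> W' = {}"
  using assms components_nonoverlap unfolding branches_def by blast

lemma finite_branches: "finite (branches n D)"
proof (cases "D = {}")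
  case True
  have "False" if "W \<in> branches n D" for W
    using branch_facts(5,6)[OF that] True by simp
  then have "branches n D = {}" by blast
  then show ?thesis by simp
next
  case False
  then obtain z where z: "z \<in> D" by blast
  define f where "f W = (SOME w. w \<in> W \<and> (T ^^ n) w = z)" for W
  have f: "f W \<in> W \<and> (T ^^ n) (f W) = z" if "W \<in> branches n D" for W
  proof -
    have "z \<in> (T ^^ n) ` W" using branch_facts(5)[OF that] z by simp
    then obtain w where "z = (T ^^ n) w" "w \<in> W" by (rule imageE)
    then show ?thesis unfolding f_def using someI[of "\<lambda>w. w \<in> W \<and> (T ^^ n) w = z" w] by blast
  qed
  have "inj_on f (branches n D)"
  proof (rule inj_onI)
    fix W W' assume W: "W \<in> branches n D" "W' \<in> branches n D" "f W = f W'"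
    then show "W = W'" using f[OF W(1)] f[OF W(2)] branches_disjoint[OF W(1,2)] by auto
  qed
  moreover have "f ` branches n D \<subseteq> {w \<in> {0..1}. (T ^^ n) w = z}" using f branch_facts(1) by blast
  ultimately show ?thesis using inj_on_finite finite_fibre by blast
qed

lemma inj_on_no_crit:
  assumes "A \<subseteq> {0..1}" "connected A" "A \<inter> crit = {}"
  shows "inj_on T A"
proof (rule linorder_inj_onI)
  fix x y assume xy: "x < y" "x \<in> A" "y \<in> A"
  show "T x \<noteq> T y"
  proof
    assume "T x = T y"
    then obtain c where c: "c \<in> crit" "x < c" "c < y" using crit_between[of x y] xy assms(1) by blast
    then have "c \<in> A" using connectedD_interval[OF assms(2) xy(2,3), of c] by auto
    then show False using c assms(3) by blast
  qed
qed auto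

text \<open>The end points of the image are among \<open>d1\<close> and \<open>d2\<close>, and they differ: with
  equal ones the function would take every value close to them on both sides of the middle of
  \<open>{a..b}\<close>.\<close>

lemma injective_component_onto:
  fixes f :: "real \<Rightarrow> real"
  assumes cont: "continuous_on {a..b} f" and ab: "a < b" and inj: "inj_on f {a<..<b}"
    and into: "f ` {a<..<b} \<subseteq> {d1<..<d2}" and ends: "f a \<notin> {d1<..<d2}" "f b \<notin> {d1<..<d2}"
  shows "f ` {a<..<b} = {d1<..<d2}"
proof
  show "{d1<..<d2} \<subseteq> f ` {a<..<b}"
  proof
    fix z assume z: "z \<in> {d1<..<d2}"
    have "f ` closure {a<..<b} \<subseteq> {d1..d2}"
      by (rule image_closure_subset) (use cont ab into in \<open>auto simp: closure_greaterThanLessThan\<close>)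
    then have "f a \<in> {d1..d2}" "f b \<in> {d1..d2}"
      using ab by (auto simp: closure_greaterThanLessThan image_subset_iff)
    then have e: "f a = d1 \<or> f a = d2" "f b = d1 \<or> f b = d2" using ends by auto
    define c where "c = (a + b) / 2"
    have c: "a < c" "c < b" using ab by (auto simp: c_def)
    have fc: "f c \<in> {d1<..<d2}" using into c by (auto simp: image_subset_iff)
    have ivt: "v \<in> f ` {p..q}" if "a \<le> p" "p \<le> q" "q \<le> b" "min (f p) (f q) \<le> v" "v \<le> max (f p) (f q)" for p q v
    proof -
      have "connected (f ` {p..q})"
        by (rule connected_continuous_image[OF continuous_on_subset[OF cont]]) (use that in auto)
      then have "{min (f p) (f q)..max (f p) (f q)} \<subseteq> f ` {p..q}"
        by (rule connected_between) (use that in auto)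
      then show ?thesis using that by auto
    qed
    have "f a \<noteq> f b"
    proof
      assume eq: "f a = f b"
      define v where "v = (f a + f c) / 2"
      have v: "v \<noteq> f a" "v \<noteq> f c" "min (f a) (f c) \<le> v" "v \<le> max (f a) (f c)"
        using fc e(1) by (auto simp: v_def)
      obtain u1 where u1: "u1 \<in> {a..c}" "f u1 = v" using ivt[of a c v] v c by auto
      obtain u2 where u2: "u2 \<in> {c..b}" "f u2 = v" using ivt[of c b v] v c eq by (auto simp: min.commute max.commute)
      have "u1 \<noteq> a" "u1 \<noteq> c" "u2 \<noteq> b" "u2 \<noteq> c" using u1 u2 v eq by auto
      then have "u1 \<in> {a<..<b}" "u2 \<in> {a<..<b}" "u1 < u2" using u1(1) u2(1) c by auto
      then show False using inj u1(2) u2(2) by (metis inj_onD less_irrefl)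
    qed
    then have "min (f a) (f b) = d1" "max (f a) (f b) = d2" using e z by (auto simp: min_def max_def)
    then obtain u where u: "u \<in> {a..b}" "f u = z" using ivt[of a b z] z ab by auto
    then have "u \<noteq> a" "u \<noteq> b" using z ends by auto
    then show "z \<in> f ` {a<..<b}" using u by auto
  qed
qed (rule into)

lemma component_is_branch:
  assumes D: "D = {d1<..<d2}" "D \<subseteq> {0..1}"
    and x: "x \<in> {0..1}" "(T ^^ n) x \<in> D"
    and W: "W = pullback n D x" and inj: "inj_on (T ^^ n) W" and W01: "0 \<notin> W" "1 \<notin> W"
  shows "W \<in> branches n D" "x \<in> W"
proof -
  define Q where "Q = {u \<in> {0..1}. (T ^^ n) u \<in> D}"
  define Q' where "Q' = {u \<in> {0<..<1}. (T ^^ n) u \<in> D}"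
  have xQ: "x \<in> Q" using x by (simp add: Q_def)
  have WQ: "W = connected_component_set Q x" by (simp add: W pullback_def Q_def)
  show xW: "x \<in> W" using xQ by (simp add: WQ connected_component_refl)
  have WsubQ: "W \<subseteq> Q" unfolding WQ by (rule connected_component_subset)
  have conW: "connected W" unfolding WQ by (rule connected_connected_component)
  have "u \<in> Q'" if "u \<in> W" for u
  proof -
    have "u \<noteq> 0" "u \<noteq> 1" using that W01 by auto
    moreover have "u \<in> Q" using that WsubQ by blast
    ultimately show ?thesis by (auto simp: Q_def Q'_def)
  qed
  then have WsubQ': "W \<subseteq> Q'" by blast
  have "open (({0<..<1} \<inter> (T ^^ n) -` D))"
    by (rule continuous_open_preimage[OF funpow_cont_subset]) (use D in auto)
  then have "open Q'" by (simp add: Q'_def vimage_def Int_def)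
  moreover have "W = connected_component_set Q' x"
  proof
    show "W \<subseteq> connected_component_set Q' x"
      by (rule connected_component_maximal[OF xW conW WsubQ'])
    have "Q' \<subseteq> Q" by (auto simp: Q_def Q'_def)
    then show "connected_component_set Q' x \<subseteq> W" unfolding WQ by (rule connected_component_mono)
  qed
  ultimately have opW: "open W" by (simp add: open_connected_component)
  define a b where "a = Inf W" and "b = Sup W"
  have bdd: "bdd_below W" "bdd_above W" using WsubQ by (auto simp: Q_def intro!: bdd_belowI[of _ 0] bdd_aboveI[of _ 1])
  have Wab: "W = {a<..<b}"
  proof (rule set_eqI)
    fix y
    show "y \<in> W \<longleftrightarrow> y \<in> {a<..<b}"
    proof
      assume y: "y \<in> W"
      then obtain e where e: "e > 0" "ball y e \<subseteq> W" using opW openE by blast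
      have "y - e / 2 \<in> W" "y + e / 2 \<in> W" using e by (auto simp: dist_real_def subset_iff)
      then have "a \<le> y - e / 2" "y + e / 2 \<le> b" unfolding a_def b_def using bdd cInf_lower cSup_upper by blast+
      then show "y \<in> {a<..<b}" using e(1) by auto
    next
      assume y: "y \<in> {a<..<b}"
      obtain w1 where w1: "w1 \<in> W" "w1 < y" using y xW cInf_less_iff[OF _ bdd(1), of y] by (auto simp: a_def)
      obtain w2 where w2: "w2 \<in> W" "y < w2" using y xW less_cSup_iff[OF _ bdd(2), of y] by (auto simp: b_def)
      show "y \<in> W" using connectedD_interval[OF conW w1(1) w2(1)] w1 w2 by auto
    qed
  qed
  have ab: "a < b" using xW Wab by auto
  have "closure W \<subseteq> {0..1}" using WsubQ by (intro closure_minimal) (auto simp: Q_def)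
  then have ab01: "{a..b} \<subseteq> {0..1}" using ab by (simp add: Wab)
  have out: "(T ^^ n) e \<notin> D" if e: "e \<in> {a, b}" for e
  proof
    assume "(T ^^ n) e \<in> D"
    moreover have "e \<in> {0..1}" using e ab01 ab by auto
    ultimately have "insert e W \<subseteq> Q" using WsubQ by (auto simp: Q_def)
    moreover have "connected (insert e W)"
      by (rule connected_intermediate_closure[OF conW]) (use e ab in \<open>auto simp: Wab\<close>)
    ultimately have "insert e W \<subseteq> W" unfolding WQ
      by (intro connected_component_maximal) (use xW WQ in auto)
    then show False using e Wab by auto
  qed
  have "(T ^^ n) ` W = D"
    unfolding Wab D(1)
  proof (rule injective_component_onto[OF funpow_cont_subset[OF ab01] ab])
    show "inj_on (T ^^ n) {a<..<b}" using inj Wab by simp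
    show "(T ^^ n) ` {a<..<b} \<subseteq> {d1<..<d2}" using WsubQ Wab D(1) by (auto simp: Q_def)
    show "(T ^^ n) a \<notin> {d1<..<d2}" "(T ^^ n) b \<notin> {d1<..<d2}" using out D(1) by auto
  qed
  moreover have "W \<in> components Q" unfolding WQ components_def using xQ by blast
  ultimately show "W \<in> branches n D" using opW inj by (simp add: branches_def Q_def)
qed

text \<open>The component of the preimage around \<open>x\<close> is pulled back one step at a time, from
  \<open>k = 0\<close> to \<open>k = n\<close>, along the orbit of \<open>x\<close>. If none of these pullbacks
  contains a critical point or an end point, each step is injective, and the last pullback is a branch.\<close>

lemma branch_or_singular:
  assumes D: "D = {d1<..<d2}" "D \<subseteq> {0..1}" and x: "x \<in> {0..1}" "(T ^^ n) x \<in> D"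
  shows "x \<in> \<Union>(branches n D) \<or> (\<exists>k\<in>{1..n}. \<exists>s\<in>sing. (T ^^ (n - k)) x \<in> pullback k D s)"
proof (rule disjCI)
  assume no: "\<not> (\<exists>k\<in>{1..n}. \<exists>s\<in>sing. (T ^^ (n - k)) x \<in> pullback k D s)"
  define W where "W k = pullback k D ((T ^^ (n - k)) x)" for k
  have xk: "(T ^^ (n - k)) x \<in> {u \<in> {0..1}. (T ^^ k) u \<in> D}" if "k \<le> n" for k
    using funpow_maps[OF x(1)] x(2) funpow_add_apply[of k "n - k" x] that by simp
  then have xW: "(T ^^ (n - k)) x \<in> W k" if "k \<le> n" for k
    using that by (simp add: W_def pullback_def connected_component_refl)
  have W01: "W k \<subseteq> {0..1}" for k using pullback_subset by (force simp: W_def)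
  have conW: "connected (W k)" for k by (simp add: W_def pullback_connected)
  have nos: "W k \<inter> sing = {}" if k: "k \<in> {1..n}" for k
  proof (rule ccontr)
    assume "W k \<inter> sing \<noteq> {}"
    then obtain s where s: "s \<in> W k" "s \<in> sing" by blast
    then have "(T ^^ (n - k)) x \<in> pullback k D s"
      unfolding W_def pullback_def by (simp add: connected_component_sym)
    then show False using no k s by blast
  qed
  have TW: "T ` W (Suc k) \<subseteq> W k" if k: "Suc k \<le> n" for k
  proof -
    have e: "T ((T ^^ (n - Suc k)) x) = (T ^^ (n - k)) x"
    proof -
      have "n - k = Suc (n - Suc k)" using k by simp
      then show ?thesis by simp
    qed
    show ?thesis
      unfolding W_def[of k] pullback_def
    proof (rule connected_component_maximal)
      show "(T ^^ (n - k)) x \<in> T ` W (Suc k)" using xW[OF k] e by (metis imageI)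
      show "connected (T ` W (Suc k))"
        by (rule connected_continuous_image[OF continuous_on_subset[OF T_cont W01] conW])
      show "T ` W (Suc k) \<subseteq> {u \<in> {0..1}. (T ^^ k) u \<in> D}"
      proof
        fix y assume "y \<in> T ` W (Suc k)"
        then obtain u where u: "u \<in> W (Suc k)" "y = T u" by blast
        then have "u \<in> {0..1} \<and> (T ^^ Suc k) u \<in> D" using pullback_subset by (force simp: W_def)
        then show "y \<in> {u \<in> {0..1}. (T ^^ k) u \<in> D}" using u maps by (simp add: funpow_swap1)
      qed
    qed
  qed
  have inj: "inj_on (T ^^ k) (W k)" if "k \<le> n" for k
    using that
  proof (induction k)
    case (Suc k)
    have "inj_on T (W (Suc k))"
      by (rule inj_on_no_crit[OF W01 conW]) (use nos[of "Suc k"] Suc.prems in \<open>auto simp: sing_def\<close>)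
    moreover have "inj_on (T ^^ k) (T ` W (Suc k))"
      by (rule inj_on_subset[OF Suc.IH TW]) (use Suc.prems in auto)
    ultimately have "inj_on ((T ^^ k) \<circ> T) (W (Suc k))" by (rule comp_inj_on)
    then show ?case by (simp only: funpow_Suc_right)
  qed simp
  have ends: "0 \<notin> W n" "1 \<notin> W n"
  proof -
    have "0 \<notin> D" "1 \<notin> D"
    proof -
      have "open D" using D(1) by simp
      then have "D \<subseteq> interior {0..1}" using D(2) by (rule interior_maximal[rotated])
      then show "0 \<notin> D" "1 \<notin> D" by auto
    qed
    then have n0: "n = 0 \<Longrightarrow> 0 \<notin> W n \<and> 1 \<notin> W n" using pullback_subset[of 0 D] by (auto simp: W_def)
    have n1: "n \<noteq> 0 \<Longrightarrow> 0 \<notin> W n \<and> 1 \<notin> W n" using nos[of n] by (auto simp: sing_def)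
    show "0 \<notin> W n" "1 \<notin> W n" using n0 n1 by blast+
  qed
  have "W n \<in> branches n D" "x \<in> W n"
    using component_is_branch[OF D x _ inj[OF order_refl] ends] by (simp_all add: W_def)
  then show "x \<in> \<Union>(branches n D)" by blast
qed

lemma fine_partition:
  assumes "r > 0"
  obtains F where "finite F" "F \<subseteq> {0..1}" "0 \<in> F" "1 \<in> F" "\<And>k s. k \<le> R \<Longrightarrow> s \<in> sing \<Longrightarrow> (T ^^ k) s \<in> F"
    "\<And>a b. (a, b) \<in> gaps F \<Longrightarrow> b - a \<le> r"
proof -
  obtain q :: nat where q: "q > 1 / r" using reals_Archimedean2 by blast
  have q0: "q > 0" using q assms by (metis divide_pos_pos less_trans of_nat_0_less_iff zero_less_one)
  define G where "G = (\<lambda>i. real i / q) ` {..q}"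
  define F where "F = G \<union> (\<Union>k\<in>{..R}. (T ^^ k) ` sing)"
  have fin: "finite F" unfolding F_def G_def using finite_sing by auto
  have G01: "G \<subseteq> {0..1}" using q0 by (auto simp: G_def)
  have F01: "F \<subseteq> {0..1}" unfolding F_def using G01 funpow_image_subset[OF sing_subset] by blast
  have z: "0 \<in> F" "1 \<in> F" using q0 by (auto simp: F_def G_def image_iff intro: bexI[of _ 0] bexI[of _ q])
  have width: "b - a \<le> r" if g: "(a, b) \<in> gaps F" for a b
  proof (rule ccontr)
    assume "\<not> b - a \<le> r"
    moreover have "1 / q < r" using q assms q0 by (simp add: field_simps)
    ultimately have br: "b - a > 1 / q" by linarith
    have ab: "a \<in> {0..1}" "b \<in> {0..1}" "{a<..<b} \<inter> F = {}" using g F01 by (auto simp: gaps_def)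
    define i where "i = nat (\<lfloor>a * q\<rfloor> + 1)"
    have aq: "0 \<le> a * q" using ab q0 by simp
    have i: "a * q < real i" "real i \<le> a * q + 1" using aq unfolding i_def by linarith+
    have l: "a < real i / q" using i q0 by (simp add: field_simps)
    have "real i / q \<le> (a * q + 1) / q" using i by (intro divide_right_mono) auto
    also have "\<dots> = a + 1 / q" using q0 by (simp add: add_divide_distrib)
    finally have u: "real i / q < b" using br by linarith
    then have "real i < b * q" using q0 by (simp add: field_simps)
    also have "\<dots> \<le> 1 * real q" using ab by (intro mult_right_mono) auto
    finally have "real i < q" by simp
    then have "real i / q \<in> F" by (auto simp: F_def G_def)
    then show False using ab(3) l u by auto
  qed
  have orb: "(T ^^ k) s \<in> F" if "k \<le> R" "s \<in> sing" for k s
    unfolding F_def by (intro UnI2 UN_I[of k] imageI) (use that in auto)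
  show thesis by (rule that[OF fin F01 z orb width])
qed

end

section \<open>Most points expand to a fixed scale\<close>

text \<open>The constants of the preceding results, valid for all connected sets with an image narrower than
  \<open>r\<close>. The rate is written as a square because one factor \<open>q ^ k\<close> is used for
  summation over \<open>k\<close> and the other one for decay in the length of the time window.\<close>

locale hyperbolic_scale = conformal_map T T1 \<phi> m
  for T T1 \<phi> :: "real \<Rightarrow> real" and m :: "real measure" +
  fixes K \<theta> \<Delta> C2 q r :: real
  assumes K: "K > 0" and \<theta>: "0 < \<theta>" "\<theta> < 1" and C2: "C2 > 0" and q: "0 < q" "q < 1"
    and r: "r > 0"
    and shrink: "A \<subseteq> {0..1} \<Longrightarrow> connected A \<Longrightarrow> narrow r ((T ^^ k) ` A) \<Longrightarrow> shrinks K \<theta> k A"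
    and distortion: "A \<subseteq> {0..1} \<Longrightarrow> connected A \<Longrightarrow> narrow r ((T ^^ k) ` A) \<Longrightarrow>
      x \<in> A \<Longrightarrow> y \<in> A \<Longrightarrow> \<bar>S k x - S k y\<bar> \<le> \<Delta>"
    and preimage_mass: "A \<subseteq> {0..1} \<Longrightarrow> connected A \<Longrightarrow> narrow r ((T ^^ k) ` A) \<Longrightarrow> B \<in> sets m \<Longrightarrow>
      measure m {x \<in> A. (T ^^ k) x \<in> B} \<le> C2 * (q * q) ^ k * measure m B"

lemma (in conformal_map) hyperbolic_scale_exists:
  obtains K \<theta> \<Delta> C2 q r where "hyperbolic_scale T T1 \<phi> m K \<theta> \<Delta> C2 q r"
proof -
  obtain K \<theta> where K: "K > 0" "0 < \<theta>" "\<theta> < 1" and bc: "\<And>r0. r0 > 0 \<Longrightarrow> \<exists>r'>0. \<forall>k A. A \<subseteq> {0..1} \<and> connected A \<and> narrow r' ((T ^^ k) ` A) \<longrightarrow>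
      shrinks K \<theta> k A \<and> (\<forall>j\<le>k. narrow r0 ((T ^^ j) ` A))"
    by (rule backward_contraction) (rule that; assumption)
  obtain \<Delta> where \<Delta>: "\<And>n A x y. A \<subseteq> {0..1} \<Longrightarrow> shrinks K \<theta> n A \<Longrightarrow> x \<in> A \<Longrightarrow> y \<in> A \<Longrightarrow> \<bar>S n x - S n y\<bar> \<le> \<Delta>"
    by (rule bounded_distortion[OF K]) (rule that; assumption)
  obtain C \<beta> r0 :: real where C: "C > 0" "\<beta> > 0" "r0 > 0" "\<And>A B k. A \<subseteq> {0..1} \<Longrightarrow> connected A \<Longrightarrow>
    \<forall>j<k. narrow r0 ((T ^^ j) ` A) \<Longrightarrow> B \<in> sets m \<Longrightarrow>
    measure m {x \<in> A. (T ^^ k) x \<in> B} \<le> C * exp (- \<beta> * real k) * measure m B"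
    by (rule narrow_preimage_mass) (rule that; assumption)
  obtain r where r: "r > 0" "\<And>k A. A \<subseteq> {0..1} \<Longrightarrow> connected A \<Longrightarrow> narrow r ((T ^^ k) ` A) \<Longrightarrow>
      shrinks K \<theta> k A \<and> (\<forall>j\<le>k. narrow r0 ((T ^^ j) ` A))"
    using bc[OF C(3)] by metis
  define q where "q = exp (- \<beta> / 2)"
  have q: "(q * q) ^ k = exp (- \<beta> * real k)" for k
  proof -
    have "q * q = exp (- \<beta>)" by (simp add: q_def flip: exp_add)
    then show ?thesis by (simp add: exp_of_nat_mult mult.commute flip: exp_of_nat_mult)
  qed
  have "hyperbolic_scale T T1 \<phi> m K \<theta> \<Delta> C q r"
  proof unfold_locales
    show "0 < q" "q < 1" using C(2) by (auto simp: q_def)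
    fix A k assume A: "A \<subseteq> {0..1}" "connected A" "narrow r ((T ^^ k) ` A)"
    show "shrinks K \<theta> k A" using r(2)[OF A] by simp
    show "\<bar>S k x - S k y\<bar> \<le> \<Delta>" if "x \<in> A" "y \<in> A" for x y
      using \<Delta>[OF A(1) _ that] r(2)[OF A] by simp
    show "measure m {x \<in> A. (T ^^ k) x \<in> B} \<le> C * (q * q) ^ k * measure m B" if "B \<in> sets m" for B
      unfolding q using C(4)[OF A(1,2) _ that] r(2)[OF A] by simp
  qed (use K C r in auto)
  then show thesis by (rule that)
qed

lemma (in conformal_map) measure_singleton: "measure m {x} = 0"
proof (cases "x \<in> {0..1}")
  case False
  then have "{x} \<notin> sets m" by (auto simp: sets_m_iff)
  then show ?thesis by (rule measure_notin_sets)
next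
  case True
  obtain C s :: real where C: "C > 0" "s > 0"
    "\<And>A d. A \<subseteq> {0..1} \<Longrightarrow> connected A \<Longrightarrow> narrow d A \<Longrightarrow> d > 0 \<Longrightarrow> measure m A \<le> C * d powr s"
    by (rule mass_of_interval) (rule that; assumption)
  have "((\<lambda>d. C * d powr s) \<longlongrightarrow> C * 0) (at_right 0)"
  proof (intro tendsto_intros tendsto_zero_powrI[of _ _ _ s])
    show "\<forall>\<^sub>F d in at_right 0. (0::real) \<le> d"
      by (rule eventually_mono[OF eventually_at_right_less]) simp
  qed (use C in auto)
  then have lim: "((\<lambda>d. C * d powr s) \<longlongrightarrow> 0) (at_right 0)" by simp
  have "\<forall>\<^sub>F d in at_right 0. measure m {x} \<le> C * d powr s"
    using eventually_at_right_less[of "0::real"]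
    by eventually_elim (rule C(3), use True in \<open>auto simp: narrow_def\<close>)
  then have "measure m {x} \<le> 0"
    by (intro tendsto_lowerbound[OF lim]) auto
  then show ?thesis using measure_nonneg[of m "{x}"] by linarith
qed

lemma (in conformal_map) measure_finite_set:
  assumes "finite X" "X \<subseteq> {0..1}"
  shows "measure m X = 0"
proof -
  have "measure m (\<Union>x\<in>X. {x}) \<le> (\<Sum>x\<in>X. measure m {x})"
    by (rule finite_measure_subadditive_finite[OF assms(1)]) (use assms(2) in \<open>auto simp: sets_m_iff\<close>)
  then show ?thesis using measure_nonneg[of m X] by (simp add: measure_singleton)
qed

text \<open>The points of \<open>F\<close> cut the interval into cells. No singular point enters a cell within
  its first \<open>R\<close> steps, so a pullback of a cell that contains a singular point has depth greater
  than \<open>R\<close>; and \<open>R\<close> is so large that all these pullbacks together contribute at most a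
  half.\<close>

locale gap_partition = hyperbolic_scale T T1 \<phi> m K \<theta> \<Delta> C2 q r
  for T T1 \<phi> :: "real \<Rightarrow> real" and m :: "real measure" and K \<theta> \<Delta> C2 q r :: real +
  fixes F :: "real set" and R :: nat
  assumes F: "finite F" "F \<subseteq> {0..1}" "0 \<in> F" "1 \<in> F"
    and sing_orbits: "k \<le> R \<Longrightarrow> s \<in> sing \<Longrightarrow> (T ^^ k) s \<in> F"
    and fine: "(a, b) \<in> gaps F \<Longrightarrow> b - a \<le> r"
    and tail: "card sing * C2 * (\<Sum>k\<in>{R<..n}. q ^ k) \<le> 1 / 2"

lemma (in hyperbolic_scale) gap_partition_exists:
  obtains F R where "gap_partition T T1 \<phi> m K \<theta> \<Delta> C2 q r F R"
proof -
  obtain R where R: "\<And>n. card sing * C2 * (\<Sum>k\<in>{R<..n}. q ^ k) \<le> 1 / 2"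
    by (rule geometric_tail[of q "card sing * C2"]) (use q C2 in auto)
  obtain F where F: "finite F" "F \<subseteq> {0..1}" "0 \<in> F" "1 \<in> F" "\<And>k s. k \<le> R \<Longrightarrow> s \<in> sing \<Longrightarrow> (T ^^ k) s \<in> F"
    "\<And>a b. (a, b) \<in> gaps F \<Longrightarrow> b - a \<le> r"
    by (rule fine_partition[OF r, of R]) (rule that; assumption)
  have "gap_partition T T1 \<phi> m K \<theta> \<Delta> C2 q r F R"
    by unfold_locales (use F R in auto)
  then show thesis by (rule that)
qed

context gap_partition
begin

definition cells :: "real set set" where
  "cells = (\<lambda>(a, b). {a<..<b}) ` gaps F"

lemma finite_cells: "finite cells"
  unfolding cells_def by (intro finite_imageI finite_gaps F)

lemma cellE:
  assumes "D \<in> cells"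
  obtains a b where "(a, b) \<in> gaps F" "D = {a<..<b}" "0 \<le> a" "a < b" "b \<le> 1"
proof -
  obtain p where p: "p \<in> gaps F" "D = (case p of (a, b) \<Rightarrow> {a<..<b})"
    using assms unfolding cells_def by blast
  obtain a b where ab: "p = (a, b)" by (cases p)
  have "a \<in> F" "b \<in> F" "a < b" using p(1) ab by (auto simp: gaps_def)
  then have "0 \<le> a" "b \<le> 1" "a < b" using F(2) by auto
  then show thesis using that[of a b] p ab by simp
qed

lemma cell_facts:
  assumes "D \<in> cells"
  shows "D \<subseteq> {0..1}" "D \<in> sets m" "measure m D > 0" "narrow r D" "D \<inter> F = {}" "D \<noteq> {}"
proof -
  obtain a b where D: "(a, b) \<in> gaps F" "D = {a<..<b}" "0 \<le> a" "a < b" "b \<le> 1" by (rule cellE[OF assms])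
  show "D \<subseteq> {0..1}" using D by auto
  then show "D \<in> sets m" using D by (simp add: sets_m_iff)
  show "measure m D > 0" unfolding D(2) by (rule supp) (use D in auto)
  show "narrow r D" using fine[OF D(1)] D(2) by (auto simp: narrow_def)
  show "D \<inter> F = {}" using D by (auto simp: gaps_def)
  show "D \<noteq> {}" using D by simp
qed

lemma cells_disjoint:
  assumes "D \<in> cells" "E \<in> cells" "D \<noteq> E"
  shows "D \<inter> E = {}"
proof (rule ccontr)
  assume "D \<inter> E \<noteq> {}"
  then obtain x where x: "x \<in> D" "x \<in> E" by blast
  obtain a b where D: "(a, b) \<in> gaps F" "D = {a<..<b}" by (rule cellE[OF assms(1)])
  obtain c d where E: "(c, d) \<in> gaps F" "E = {c<..<d}" by (rule cellE[OF assms(2)])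
  have "(a, b) = (c, d)" by (rule gaps_disjoint[OF D(1) E(1)]) (use x D E in auto)
  then show False using D E assms(3) by simp
qed

lemma cell_exists:
  assumes "x \<in> {0..1}" "x \<notin> F"
  shows "\<exists>D\<in>cells. x \<in> D"
proof -
  have "x \<noteq> 0" "x \<noteq> 1" using assms F by auto
  then have "0 < x" "x < 1" using assms by auto
  then obtain p where "p \<in> gaps F" "case p of (a, b) \<Rightarrow> x \<in> {a<..<b}"
    using gap_exists[OF F(1,3,4)] assms by blast
  then show ?thesis by (auto simp: cells_def split: prod.splits intro!: bexI[of _ p])
qed

lemma sum_cells_le:
  assumes "A \<in> sets m"
  shows "(\<Sum>D\<in>cells. measure m (A \<inter> D)) \<le> measure m A"
proof -
  have "measure m (\<Union>D\<in>cells. A \<inter> D) = (\<Sum>D\<in>cells. measure m (A \<inter> D))"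
  proof (rule finite_measure_finite_Union[OF finite_cells])
    show "(\<lambda>D. A \<inter> D) ` cells \<subseteq> sets m" using assms cell_facts(2) by blast
    show "disjoint_family_on (\<lambda>D. A \<inter> D) cells"
      unfolding disjoint_family_on_def using cells_disjoint by blast
  qed
  moreover have "measure m (\<Union>D\<in>cells. A \<inter> D) \<le> measure m A"
    by (rule finite_measure_mono) (use assms in auto)
  ultimately show ?thesis by simp
qed

lemma branch_narrow:
  assumes "D \<in> cells" "W \<in> branches n D"
  shows "narrow r ((T ^^ n) ` W)"
  using branch_facts(5)[OF assms(2)] cell_facts(4)[OF assms(1)] by simp

lemma branch_sets: "W \<in> branches n D \<Longrightarrow> W \<in> sets m"
  using branch_facts(1-3) by (simp add: sets_m_iff)

text \<open>Conformality and bounded distortion: up to the factor \<open>exp (2 * \<Delta>)\<close>, the branch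
  \<open>W\<close> is a scaled copy of the cell \<open>D\<close>.\<close>

lemma branch_mass:
  assumes D: "D \<in> cells" and W: "W \<in> branches n D" and A: "A \<in> sets m"
  shows "measure m {x \<in> W. (T ^^ n) x \<in> A} * measure m D \<le> exp (2 * \<Delta>) * measure m W * measure m (A \<inter> D)"
    and "measure m W * measure m (A \<inter> D) \<le> exp (2 * \<Delta>) * measure m {x \<in> W. (T ^^ n) x \<in> A}"
proof -
  note Wf = branch_facts[OF W]
  obtain w0 where w0: "w0 \<in> W" using Wf(6) by blast
  have dist: "\<bar>S n w - S n w0\<bar> \<le> \<Delta>" if "w \<in> W" for w
    by (rule distortion[OF Wf(1,2) branch_narrow[OF D W] that w0])
  then have S: "S n w0 - \<Delta> \<le> S n w" "S n w \<le> S n w0 + \<Delta>" if "w \<in> W" for w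
    using that by (smt (verit))+
  have AD: "A \<inter> D \<in> sets m" using A cell_facts(2)[OF D] by blast
  have eq: "{x \<in> W. (T ^^ n) x \<in> A \<inter> D} = {x \<in> W. (T ^^ n) x \<in> A}" using Wf(5) by blast
  have eqD: "{x \<in> W. (T ^^ n) x \<in> D} = W" using Wf(5) by blast
  have card: "real (card {w \<in> W. (T ^^ n) w = z}) \<le> 1" for z
  proof -
    have fin: "finite {w \<in> W. (T ^^ n) w = z}"
      by (rule finite_subset[OF _ finite_fibre[of n z]]) (use Wf(1) in auto)
    have "\<forall>x\<in>{w \<in> W. (T ^^ n) w = z}. \<forall>y\<in>{w \<in> W. (T ^^ n) w = z}. x = y"
      using Wf(4) by (auto simp: inj_on_def)
    then have "card {w \<in> W. (T ^^ n) w = z} \<le> 1" by (simp only: card_le_Suc0_iff_eq[OF fin] One_nat_def)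
    then show ?thesis by simp
  qed
  have up: "measure m {x \<in> W. (T ^^ n) x \<in> B} \<le> exp (S n w0 + \<Delta>) * measure m B" if "B \<in> sets m" for B
    using measure_preimage_le[OF branch_sets[OF W] that card S(2)] by simp
  have lo: "exp (S n w0 - \<Delta>) * measure m B \<le> measure m {x \<in> W. (T ^^ n) x \<in> B}"
    if "B \<in> sets m" "B \<subseteq> D" for B
    by (rule measure_preimage_ge[OF branch_sets[OF W] that(1) _ S(1)]) (use that(2) Wf(5) in simp)
  have "measure m {x \<in> W. (T ^^ n) x \<in> A} * measure m D
     \<le> exp (S n w0 + \<Delta>) * measure m (A \<inter> D) * measure m D"
    using up[OF AD] unfolding eq by (intro mult_right_mono) auto
  also have "\<dots> = exp (2 * \<Delta>) * (exp (S n w0 - \<Delta>) * measure m D) * measure m (A \<inter> D)"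
  proof -
    have "exp (S n w0 + \<Delta>) = exp (2 * \<Delta>) * exp (S n w0 - \<Delta>)" by (simp flip: exp_add)
    then show ?thesis by (simp add: mult_ac)
  qed
  also have "\<dots> \<le> exp (2 * \<Delta>) * measure m W * measure m (A \<inter> D)"
    using lo[OF cell_facts(2)[OF D] subset_refl] unfolding eqD
    by (intro mult_right_mono mult_left_mono) auto
  finally show "measure m {x \<in> W. (T ^^ n) x \<in> A} * measure m D \<le> exp (2 * \<Delta>) * measure m W * measure m (A \<inter> D)" .
  have "measure m W * measure m (A \<inter> D) \<le> (exp (S n w0 + \<Delta>) * measure m D) * measure m (A \<inter> D)"
    using up[OF cell_facts(2)[OF D]] unfolding eqD by (intro mult_right_mono) auto
  also have "\<dots> \<le> (exp (S n w0 + \<Delta>) * 1) * measure m (A \<inter> D)"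
    by (intro mult_right_mono mult_left_mono) auto
  also have "\<dots> = exp (2 * \<Delta>) * (exp (S n w0 - \<Delta>) * measure m (A \<inter> D))"
    by (simp flip: exp_add mult.assoc)
  also have "\<dots> \<le> exp (2 * \<Delta>) * measure m {x \<in> W. (T ^^ n) x \<in> A}"
    using lo[OF AD] unfolding eq by (intro mult_left_mono) auto
  finally show "measure m W * measure m (A \<inter> D) \<le> exp (2 * \<Delta>) * measure m {x \<in> W. (T ^^ n) x \<in> A}" .
qed

definition expanded :: "nat \<Rightarrow> real set" where
  "expanded n = (\<Union>D\<in>cells. \<Union>(branches n D))"

text \<open>The points that lie in no branch of any level between \<open>n - g\<close> and \<open>n\<close>.
  Writing the window as \<open>n \<le> j + g\<close> avoids truncated subtraction.\<close>

definition unexpanded :: "nat \<Rightarrow> nat \<Rightarrow> real set" where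
  "unexpanded n g = {0..1} - (\<Union>j\<in>{j. j \<le> n \<and> n \<le> j + g}. expanded j)"

lemma expanded_sets: "expanded n \<in> sets m"
proof -
  have "open (expanded n)" unfolding expanded_def using branch_facts(3) by blast
  moreover have "expanded n \<subseteq> {0..1}" unfolding expanded_def using branch_facts(1) by blast
  ultimately show ?thesis by (simp add: sets_m_iff)
qed

lemma unexpanded_sets: "unexpanded n g \<in> sets m"
  unfolding unexpanded_def by (intro sets.Diff I_sets sets.finite_UN) (auto intro: expanded_sets)

lemma expanded_or_singular:
  assumes x: "x \<in> {0..1}" "(T ^^ n) x \<notin> F"
  shows "\<exists>D\<in>cells. (T ^^ n) x \<in> D \<and>
    (x \<in> expanded n \<or> (\<exists>k\<in>{R<..n}. \<exists>s\<in>sing. (T ^^ (n - k)) x \<in> pullback k D s))"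
proof -
  obtain D where D: "D \<in> cells" "(T ^^ n) x \<in> D" using cell_exists[OF funpow_maps[OF x(1)] x(2)] by blast
  obtain a b where ab: "D = {a<..<b}" by (rule cellE[OF D(1)])
  have "x \<in> expanded n \<or> (\<exists>k\<in>{R<..n}. \<exists>s\<in>sing. (T ^^ (n - k)) x \<in> pullback k D s)"
    using branch_or_singular[OF ab cell_facts(1)[OF D(1)] x(1) D(2)]
  proof
    assume "x \<in> \<Union>(branches n D)"
    then show ?thesis using D(1) by (auto simp: expanded_def)
  next
    assume "\<exists>k\<in>{1..n}. \<exists>s\<in>sing. (T ^^ (n - k)) x \<in> pullback k D s"
    then obtain k s where ks: "k \<in> {1..n}" "s \<in> sing" "(T ^^ (n - k)) x \<in> pullback k D s" by blast
    have "s \<in> {u \<in> {0..1}. (T ^^ k) u \<in> D}"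
      using ks(3) unfolding pullback_def by (metis connected_component_in mem_Collect_eq)
    then have "(T ^^ k) s \<notin> F" using cell_facts(5)[OF D(1)] by blast
    then have "\<not> k \<le> R" using sing_orbits ks(2) by blast
    then show ?thesis using ks by auto
  qed
  then show ?thesis using D by blast
qed

lemma pullback_mass:
  assumes D: "D \<in> cells" and A: "A \<in> sets m"
  shows "{u \<in> pullback k D s. (T ^^ k) u \<in> A} \<in> sets m"
    and "measure m {u \<in> pullback k D s. (T ^^ k) u \<in> A} \<le> C2 * (q * q) ^ k * measure m (A \<inter> D)"
proof -
  have sub: "pullback k D s \<subseteq> {0..1}" "(T ^^ k) ` pullback k D s \<subseteq> D" using pullback_subset[of k D s] by auto
  have "pullback k D s \<in> sets m" by (rule connected_sets[OF pullback_connected sub(1)])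
  then show "{u \<in> pullback k D s. (T ^^ k) u \<in> A} \<in> sets m" by (rule preimage_sets[OF _ A])
  have "{u \<in> pullback k D s. (T ^^ k) u \<in> A} = {u \<in> pullback k D s. (T ^^ k) u \<in> A \<inter> D}" using sub by blast
  also have "measure m \<dots> \<le> C2 * (q * q) ^ k * measure m (A \<inter> D)"
    by (rule preimage_mass[OF sub(1) pullback_connected narrow_subset[OF cell_facts(4)[OF D] sub(2)]])
      (use A cell_facts(2)[OF D] in blast)
  finally show "measure m {u \<in> pullback k D s. (T ^^ k) u \<in> A} \<le> C2 * (q * q) ^ k * measure m (A \<inter> D)" .
qed

text \<open>The points of \<open>X\<close> outside \<open>expanded n\<close> and outside a finite set pass
  through a pullback with a singular point, of some depth \<open>k > R\<close>. The choice of \<open>R\<close>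
  bounds the sum of these contributions.\<close>

lemma covering_inequality:
  assumes A: "A \<in> sets m" and X: "X \<in> sets m" "X \<subseteq> {x \<in> {0..1}. (T ^^ n) x \<in> A}" and c: "c \<ge> 0"
    and part: "\<And>D s k. D \<in> cells \<Longrightarrow> s \<in> sing \<Longrightarrow> R < k \<Longrightarrow> k \<le> n \<Longrightarrow>
      measure m {x \<in> X. (T ^^ (n - k)) x \<in> {u \<in> pullback k D s. (T ^^ k) u \<in> A}} \<le> c * (C2 * q ^ k * measure m (A \<inter> D))"
  shows "measure m X \<le> measure m (X \<inter> expanded n) + c / 2 * measure m A"
proof -
  define Z where "Z p = (case p of (D, s, k) \<Rightarrow> {x \<in> X. (T ^^ (n - k)) x \<in> {u \<in> pullback k D s. (T ^^ k) u \<in> A}})"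
    for p :: "real set \<times> real \<times> nat"
  define P where "P = cells \<times> sing \<times> {R<..n}"
  define N where "N = {x \<in> {0..1}. (T ^^ n) x \<in> F}"
  have finP: "finite P" unfolding P_def using finite_cells finite_sing by simp
  have Zsets: "Z p \<in> sets m" if "p \<in> P" for p
    using that preimage_sets[OF X(1) pullback_mass(1)[OF _ A]] by (auto simp: P_def Z_def)
  have "N = (\<Union>z\<in>F. {x \<in> {0..1}. (T ^^ n) x = z})" by (auto simp: N_def)
  then have "finite N" using F(1) finite_fibre by simp
  moreover have "N \<subseteq> {0..1}" by (auto simp: N_def)
  ultimately have N: "N \<in> sets m" "measure m N = 0"
    using measure_finite_set by (auto simp: sets_m_iff finite_imp_closed)
  have "X \<subseteq> N \<union> (X \<inter> expanded n) \<union> (\<Union>p\<in>P. Z p)"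
  proof
    fix x assume x: "x \<in> X"
    then have x01: "x \<in> {0..1}" "(T ^^ n) x \<in> A" using X(2) by auto
    show "x \<in> N \<union> (X \<inter> expanded n) \<union> (\<Union>p\<in>P. Z p)"
    proof (cases "x \<in> N \<union> (X \<inter> expanded n)")
      case False
      then have "(T ^^ n) x \<notin> F" using x01 by (auto simp: N_def)
      then obtain D k s where D: "D \<in> cells" "k \<in> {R<..n}" "s \<in> sing" "(T ^^ (n - k)) x \<in> pullback k D s"
        using expanded_or_singular[OF x01(1)] False x by blast
      have "(T ^^ k) ((T ^^ (n - k)) x) = (T ^^ n) x" using funpow_add_apply[of k "n - k" x] D(2) by simp
      then have "x \<in> Z (D, s, k)" using x x01 D by (simp add: Z_def)
      then show ?thesis using D by (auto simp: P_def)
    qed simp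
  qed
  then have "measure m X \<le> measure m (N \<union> (X \<inter> expanded n) \<union> (\<Union>p\<in>P. Z p))"
    using N(1) X(1) expanded_sets Zsets finP by (intro finite_measure_mono sets.Un sets.finite_UN) auto
  also have "\<dots> \<le> measure m (N \<union> (X \<inter> expanded n)) + measure m (\<Union>p\<in>P. Z p)"
    using N(1) X(1) expanded_sets Zsets finP by (intro measure_Un_le sets.Un sets.finite_UN) auto
  also have "measure m (N \<union> (X \<inter> expanded n)) \<le> measure m N + measure m (X \<inter> expanded n)"
    using N(1) X(1) expanded_sets by (intro measure_Un_le) auto
  also have "measure m (\<Union>p\<in>P. Z p) \<le> (\<Sum>p\<in>P. measure m (Z p))"
    by (rule finite_measure_subadditive_finite[OF finP]) (use Zsets in auto)
  also have "(\<Sum>p\<in>P. measure m (Z p)) \<le> (\<Sum>p\<in>P. case p of (D, s, k) \<Rightarrow> c * (C2 * q ^ k * measure m (A \<inter> D)))"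
    by (rule sum_mono) (use part in \<open>auto simp: P_def Z_def\<close>)
  also have "\<dots> = (\<Sum>D\<in>cells. \<Sum>s\<in>sing. \<Sum>k\<in>{R<..n}. c * (C2 * q ^ k * measure m (A \<inter> D)))"
    by (simp only: P_def sum.cartesian_product)
  also have "\<dots> = (\<Sum>D\<in>cells. measure m (A \<inter> D) * (c * (card sing * C2 * (\<Sum>k\<in>{R<..n}. q ^ k))))"
    by (intro sum.cong refl) (simp add: sum_distrib_left mult_ac)
  also have "\<dots> = (\<Sum>D\<in>cells. measure m (A \<inter> D)) * (c * (card sing * C2 * (\<Sum>k\<in>{R<..n}. q ^ k)))"
    by (simp only: sum_distrib_right)
  also have "\<dots> \<le> measure m A * (c * (1 / 2))"
  proof (rule mult_mono[OF sum_cells_le[OF A]])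
    show "c * (card sing * C2 * (\<Sum>k\<in>{R<..n}. q ^ k)) \<le> c * (1 / 2)" by (rule mult_left_mono[OF tail c])
    show "0 \<le> c * (card sing * C2 * (\<Sum>k\<in>{R<..n}. q ^ k))"
      using c C2 q by (intro mult_nonneg_nonneg sum_nonneg) auto
  qed simp
  finally show ?thesis using N(2) by (simp add: mult.commute)
qed

text \<open>Twice the bound for the part of a preimage that lies in branches; the factor absorbs the rest in
  \<open>preimage_bound\<close>.\<close>

definition C1 :: real where "C1 = 2 * (exp (2 * \<Delta>) * (\<Sum>D\<in>cells. 1 / measure m D))"

lemma C1_pos: "C1 > 0"
proof -
  have "cells \<noteq> {}"
  proof
    assume "cells = {}"
    then have "{0..1} \<subseteq> F" using cell_exists by blast
    then have "finite {0..1::real}" using F(1) finite_subset by blast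
    then show False by (simp add: infinite_Icc)
  qed
  then have "(\<Sum>D\<in>cells. 1 / measure m D) > 0"
    by (intro sum_pos finite_cells) (use cell_facts(3) in auto)
  then show ?thesis by (simp add: C1_def)
qed

lemma expanded_mass:
  assumes A: "A \<in> sets m"
  shows "measure m ({x \<in> {0..1}. (T ^^ n) x \<in> A} \<inter> expanded n) \<le> C1 / 2 * measure m A"
proof -
  have inner: "measure m (\<Union>W\<in>branches n D. {x \<in> W. (T ^^ n) x \<in> A}) \<le> exp (2 * \<Delta>) * (1 / measure m D) * measure m A"
    if D: "D \<in> cells" for D
  proof -
    have mD: "measure m D > 0" by (rule cell_facts(3)[OF D])
    have "measure m (\<Union>W\<in>branches n D. {x \<in> W. (T ^^ n) x \<in> A}) \<le> (\<Sum>W\<in>branches n D. measure m {x \<in> W. (T ^^ n) x \<in> A})"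
      by (rule finite_measure_subadditive_finite[OF finite_branches]) (use preimage_sets[OF branch_sets A] in blast)
    also have "\<dots> \<le> (\<Sum>W\<in>branches n D. exp (2 * \<Delta>) * (1 / measure m D) * measure m A * measure m W)"
    proof (rule sum_mono)
      fix W assume W: "W \<in> branches n D"
      have "measure m {x \<in> W. (T ^^ n) x \<in> A} \<le> exp (2 * \<Delta>) * measure m W * measure m (A \<inter> D) / measure m D"
        using branch_mass(1)[OF D W A] mD by (simp add: pos_le_divide_eq)
      also have "\<dots> \<le> exp (2 * \<Delta>) * measure m W * measure m A / measure m D"
        by (intro divide_right_mono mult_left_mono finite_measure_mono) (use A in auto)
      finally show "measure m {x \<in> W. (T ^^ n) x \<in> A} \<le> exp (2 * \<Delta>) * (1 / measure m D) * measure m A * measure m W"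
        by (simp add: mult_ac)
    qed
    also have "\<dots> = exp (2 * \<Delta>) * (1 / measure m D) * measure m A * (\<Sum>W\<in>branches n D. measure m W)"
      by (simp only: sum_distrib_left)
    also have "(\<Sum>W\<in>branches n D. measure m W) = measure m (\<Union>W\<in>branches n D. W)"
      by (rule finite_measure_finite_Union[OF finite_branches, symmetric])
        (use branch_sets branches_disjoint in \<open>auto simp: disjoint_family_on_def\<close>)
    also have "exp (2 * \<Delta>) * (1 / measure m D) * measure m A * measure m (\<Union>W\<in>branches n D. W)
      \<le> exp (2 * \<Delta>) * (1 / measure m D) * measure m A * 1"
      by (intro mult_left_mono) auto
    finally show ?thesis by simp
  qed
  have sets: "(\<Union>W\<in>branches n D. {x \<in> W. (T ^^ n) x \<in> A}) \<in> sets m" for D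
    by (intro sets.finite_UN finite_branches preimage_sets branch_sets A)
  have "{x \<in> {0..1}. (T ^^ n) x \<in> A} \<inter> expanded n \<subseteq> (\<Union>D\<in>cells. \<Union>W\<in>branches n D. {x \<in> W. (T ^^ n) x \<in> A})"
    by (auto simp: expanded_def)
  then have "measure m ({x \<in> {0..1}. (T ^^ n) x \<in> A} \<inter> expanded n)
    \<le> measure m (\<Union>D\<in>cells. \<Union>W\<in>branches n D. {x \<in> W. (T ^^ n) x \<in> A})"
    by (intro finite_measure_mono sets.finite_UN finite_cells sets) auto
  also have "\<dots> \<le> (\<Sum>D\<in>cells. measure m (\<Union>W\<in>branches n D. {x \<in> W. (T ^^ n) x \<in> A}))"
    by (rule finite_measure_subadditive_finite[OF finite_cells]) (use sets in blast)
  also have "\<dots> \<le> (\<Sum>D\<in>cells. exp (2 * \<Delta>) * (1 / measure m D) * measure m A)"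
    by (rule sum_mono) (rule inner)
  also have "\<dots> = C1 / 2 * measure m A"
    by (simp add: C1_def sum_distrib_left sum_distrib_right mult_ac)
  finally show ?thesis .
qed

text \<open>By induction on \<open>n\<close>: the part in branches accounts for half of \<open>C1\<close>, and
  the part in a singular pullback of depth \<open>k\<close> is a preimage under \<open>T ^^ (n - k)\<close>, to
  which the induction hypothesis applies.\<close>

theorem preimage_bound:
  assumes "A \<in> sets m"
  shows "measure m {x \<in> {0..1}. (T ^^ n) x \<in> A} \<le> C1 * measure m A"
  using assms
proof (induction n arbitrary: A rule: less_induct)
  case (less n)
  let ?X = "{x \<in> {0..1}. (T ^^ n) x \<in> A}"
  have "measure m ?X \<le> measure m (?X \<inter> expanded n) + C1 / 2 * measure m A"
  proof (rule covering_inequality[OF less.prems preimage_sets[OF I_sets less.prems] subset_refl])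
    show "0 \<le> C1" using C1_pos by simp
    fix D s k assume D: "D \<in> cells" and k: "R < k" "k \<le> n"
    let ?Y = "{u \<in> pullback k D s. (T ^^ k) u \<in> A}"
    have "measure m {x \<in> ?X. (T ^^ (n - k)) x \<in> ?Y} \<le> measure m {x \<in> {0..1}. (T ^^ (n - k)) x \<in> ?Y}"
      by (rule finite_measure_mono) (use preimage_sets[OF I_sets pullback_mass(1)[OF D less.prems]] in auto)
    also have "\<dots> \<le> C1 * measure m ?Y"
      by (rule less.IH) (use k pullback_mass(1)[OF D less.prems] in auto)
    also have "\<dots> \<le> C1 * (C2 * (q * q) ^ k * measure m (A \<inter> D))"
      using pullback_mass(2)[OF D less.prems] C1_pos by (intro mult_left_mono) auto
    also have "\<dots> \<le> C1 * (C2 * q ^ k * measure m (A \<inter> D))"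
      using C1_pos C2 q by (intro mult_left_mono mult_right_mono power_mono) (auto simp: mult_left_le_one_le)
    finally show "measure m {x \<in> ?X. (T ^^ (n - k)) x \<in> ?Y} \<le> C1 * (C2 * q ^ k * measure m (A \<inter> D))" .
  qed
  then show ?case using expanded_mass[OF less.prems, of n] by (simp add: field_simps)
qed

text \<open>The same induction, with nothing in branches. A point of the pullback of depth \<open>k \<le>
  g\<close> is at time \<open>n - k\<close> unexpanded with the shorter window \<open>g - k\<close>; the missing
  factor \<open>q ^ k\<close> comes from the mass of the pullback, and for \<open>k > g\<close> that factor
  alone suffices.\<close>

theorem unexpanded_bound:
  assumes "A \<in> sets m"
  shows "measure m {x \<in> unexpanded n g. (T ^^ n) x \<in> A} \<le> C1 * q ^ g * measure m A"
  using assms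
proof (induction n arbitrary: A g rule: less_induct)
  case (less n)
  let ?X = "{x \<in> unexpanded n g. (T ^^ n) x \<in> A}"
  have Xs: "?X \<in> sets m" by (rule preimage_sets[OF unexpanded_sets less.prems])
  have "?X \<inter> expanded n = {}" by (auto simp: unexpanded_def)
  then have e0: "measure m (?X \<inter> expanded n) = 0" by simp
  have "measure m ?X \<le> measure m (?X \<inter> expanded n) + C1 * q ^ g / 2 * measure m A"
  proof (rule covering_inequality[OF less.prems Xs])
    show "?X \<subseteq> {x \<in> {0..1}. (T ^^ n) x \<in> A}" by (auto simp: unexpanded_def)
    show "0 \<le> C1 * q ^ g" using C1_pos q by simp
    fix D s k assume D: "D \<in> cells" and k: "R < k" "k \<le> n"
    let ?Y = "{u \<in> pullback k D s. (T ^^ k) u \<in> A}"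
    note Y = pullback_mass[OF D less.prems, of k s]
    show "measure m {x \<in> ?X. (T ^^ (n - k)) x \<in> ?Y} \<le> C1 * q ^ g * (C2 * q ^ k * measure m (A \<inter> D))"
    proof (cases "k \<le> g")
      case True
      have "measure m {x \<in> ?X. (T ^^ (n - k)) x \<in> ?Y} \<le> measure m {x \<in> unexpanded (n - k) (g - k). (T ^^ (n - k)) x \<in> ?Y}"
      proof (rule finite_measure_mono)
        show "{x \<in> ?X. (T ^^ (n - k)) x \<in> ?Y} \<subseteq> {x \<in> unexpanded (n - k) (g - k). (T ^^ (n - k)) x \<in> ?Y}"
          using True k by (auto simp: unexpanded_def)
      qed (rule preimage_sets[OF unexpanded_sets Y(1)])
      also have "\<dots> \<le> C1 * q ^ (g - k) * measure m ?Y" by (rule less.IH) (use k Y(1) in auto)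
      also have "\<dots> \<le> C1 * q ^ (g - k) * (C2 * (q * q) ^ k * measure m (A \<inter> D))"
        using Y(2) C1_pos q by (intro mult_left_mono) auto
      also have "\<dots> = C1 * (q ^ (g - k) * q ^ k) * (C2 * q ^ k * measure m (A \<inter> D))"
        by (simp add: power_mult_distrib mult_ac)
      also have "q ^ (g - k) * q ^ k = q ^ g" using True by (simp flip: power_add)
      finally show ?thesis .
    next
      case False
      have "measure m {x \<in> ?X. (T ^^ (n - k)) x \<in> ?Y} \<le> measure m {x \<in> {0..1}. (T ^^ (n - k)) x \<in> ?Y}"
        by (rule finite_measure_mono) (use preimage_sets[OF I_sets Y(1)] in \<open>auto simp: unexpanded_def\<close>)
      also have "\<dots> \<le> C1 * measure m ?Y" by (rule preimage_bound[OF Y(1)])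
      also have "\<dots> \<le> C1 * (C2 * (q * q) ^ k * measure m (A \<inter> D))"
        using Y(2) C1_pos by (intro mult_left_mono) auto
      also have "\<dots> = C1 * q ^ k * (C2 * q ^ k * measure m (A \<inter> D))" by (simp add: power_mult_distrib mult_ac)
      also have "\<dots> \<le> C1 * q ^ g * (C2 * q ^ k * measure m (A \<inter> D))"
        using False C1_pos C2 q by (intro mult_right_mono mult_left_mono power_decreasing) auto
      finally show ?thesis .
    qed
  qed
  moreover have "C1 * q ^ g / 2 * measure m A \<le> C1 * q ^ g * measure m A"
    using C1_pos q by (intro mult_right_mono) auto
  ultimately show ?case using e0 by linarith
qed

corollary unexpanded_small: "measure m (unexpanded n g) \<le> C1 * q ^ g"
proof -
  have "{x \<in> unexpanded n g. (T ^^ n) x \<in> {0..1}} = unexpanded n g"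
    using funpow_maps by (auto simp: unexpanded_def)
  then show ?thesis using unexpanded_bound[OF I_sets, of n g] prob_space space_m by simp
qed

end

section \<open>Spreading of mass\<close>

lemma (in interval_map) interval_eventually_full:
  assumes "0 \<le> a" "a < b" "b \<le> 1"
  shows "\<exists>N. \<forall>n\<ge>N. (T ^^ n) ` {a<..<b} = {0..1}"
proof -
  define w where "w = (b - a) / 3"
  have w: "w > 0" using assms by (simp add: w_def)
  obtain N where N: "\<And>a b n. 0 \<le> a \<Longrightarrow> b \<le> 1 \<Longrightarrow> w \<le> b - a \<Longrightarrow> n \<ge> N \<Longrightarrow> (T ^^ n) ` {a..b} = {0..1}"
    by (rule covering_timeE[OF w]) (rule that; assumption)
  have "(T ^^ n) ` {a<..<b} = {0..1}" if n: "n \<ge> N" for n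
  proof
    have ab: "a < a + w" "b - w < b" using w by auto
    have "{a + w..b - w} \<subseteq> {a<..<b}" using ab by auto
    moreover have "(T ^^ n) ` {a + w..b - w} = {0..1}"
      by (rule N[OF _ _ _ n]) (use assms w in \<open>auto simp: w_def field_simps\<close>)
    ultimately show "{0..1} \<subseteq> (T ^^ n) ` {a<..<b}" by (metis image_mono)
    show "(T ^^ n) ` {a<..<b} \<subseteq> {0..1}" by (rule funpow_image_subset) (use assms in auto)
  qed
  then show ?thesis by blast
qed

context gap_partition
begin

lemma cells_eventually_full:
  obtains N where "\<And>D n. D \<in> cells \<Longrightarrow> n \<ge> N \<Longrightarrow> (T ^^ n) ` D = {0..1}"
proof -
  have "\<exists>N. \<forall>n\<ge>N. (T ^^ n) ` D = {0..1}" if D: "D \<in> cells" for D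
  proof -
    obtain a b where ab: "D = {a<..<b}" "0 \<le> a" "a < b" "b \<le> 1" by (rule cellE[OF D])
    show ?thesis unfolding ab(1) by (rule interval_eventually_full[OF ab(2-4)])
  qed
  then obtain N where N: "\<And>D n. D \<in> cells \<Longrightarrow> n \<ge> N D \<Longrightarrow> (T ^^ n) ` D = {0..1}" by metis
  show thesis
  proof (rule that)
    fix D n assume D: "D \<in> cells" and n: "n \<ge> Max (N ` cells)"
    have "N D \<le> Max (N ` cells)" by (rule Max_ge) (use D finite_cells in auto)
    then show "(T ^^ n) ` D = {0..1}" using N[OF D] n by simp
  qed
qed

text \<open>A branch is a scaled copy of its cell, and the cell covers everything after \<open>N\<close> steps
  with a loss of mass that is bounded for the times in the window.\<close>

lemma branch_return:
  obtains N c where "c > 0" "\<And>D W n l A. D \<in> cells \<Longrightarrow> W \<in> branches n D \<Longrightarrow> N \<le> l \<Longrightarrow> l \<le> N + g \<Longrightarrow> A \<in> sets m \<Longrightarrow>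
    c * measure m W * measure m A \<le> measure m {x \<in> W. (T ^^ (l + n)) x \<in> A}"
proof -
  obtain N where N: "\<And>D n. D \<in> cells \<Longrightarrow> n \<ge> N \<Longrightarrow> (T ^^ n) ` D = {0..1}"
    by (rule cells_eventually_full) (rule that; assumption)
  obtain B where B: "B \<ge> 0" "\<forall>x\<in>{0..1}. \<bar>\<phi> x\<bar> \<le> B" using phi_bound by blast
  define c where "c = exp (- (2 * \<Delta>)) * exp (- (real (N + g) * B))"
  have "c * measure m W * measure m A \<le> measure m {x \<in> W. (T ^^ (l + n)) x \<in> A}"
    if D: "D \<in> cells" and W: "W \<in> branches n D" and l: "N \<le> l" "l \<le> N + g" and A: "A \<in> sets m" for D W n l A
  proof -
    let ?A = "{x \<in> {0..1}. (T ^^ l) x \<in> A}"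
    have sA: "?A \<in> sets m" by (rule preimage_sets[OF I_sets A])
    have eqD: "?A \<inter> D = {x \<in> D. (T ^^ l) x \<in> A}" using cell_facts(1)[OF D] by auto
    have "exp (- (real (N + g) * B)) * measure m A \<le> measure m {x \<in> D. (T ^^ l) x \<in> A}"
    proof (rule measure_preimage_ge[OF cell_facts(2)[OF D] A])
      show "A \<subseteq> (T ^^ l) ` D" using N[OF D l(1)] A by (simp add: sets_m_iff)
      fix w assume "w \<in> D"
      then have "w \<in> {0..1}" using cell_facts(1)[OF D] by auto
      then have "\<bar>S l w\<bar> \<le> l * B" by (rule S_bound[OF B(2)])
      moreover have "real l * B \<le> real (N + g) * B" using l(2) B(1) by (intro mult_right_mono) auto
      ultimately show "- (real (N + g) * B) \<le> S l w" by linarith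
    qed
    then have "measure m W * (exp (- (real (N + g) * B)) * measure m A) \<le> measure m W * measure m (?A \<inter> D)"
      unfolding eqD by (intro mult_left_mono) auto
    also have "\<dots> \<le> exp (2 * \<Delta>) * measure m {x \<in> W. (T ^^ n) x \<in> ?A}" by (rule branch_mass(2)[OF D W sA])
    also have "{x \<in> W. (T ^^ n) x \<in> ?A} = {x \<in> W. (T ^^ (l + n)) x \<in> A}"
      using branch_facts(1)[OF W] funpow_maps by (auto simp: funpow_add_apply)
    finally have "exp (- (2 * \<Delta>)) * (measure m W * (exp (- (real (N + g) * B)) * measure m A))
      \<le> exp (- (2 * \<Delta>)) * (exp (2 * \<Delta>) * measure m {x \<in> W. (T ^^ (l + n)) x \<in> A})"
      by (intro mult_left_mono) auto
    also have "\<dots> = measure m {x \<in> W. (T ^^ (l + n)) x \<in> A}" by (simp flip: exp_add mult.assoc)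
    finally show ?thesis by (simp add: c_def mult_ac)
  qed
  moreover have "c > 0" by (simp add: c_def)
  ultimately show thesis using that by blast
qed

text \<open>The branches in question have one of finitely many cells and levels in a window of length
  \<open>g\<close>. Those of one cell and level carry a fixed proportion of \<open>X\<close>, and they are
  disjoint, so their returns add up.\<close>

lemma mass_of_branch_returns:
  obtains N c where "c > 0" "\<And>n X G. X \<in> sets m \<Longrightarrow>
    \<forall>x\<in>X. \<exists>j D W. j \<le> n \<and> n \<le> j + g \<and> D \<in> cells \<and> W \<in> branches j D \<and> x \<in> W \<and> W \<subseteq> G \<Longrightarrow>
    \<exists>Y\<in>sets m. Y \<subseteq> G \<and> (\<forall>A\<in>sets m. c * measure m X * measure m A \<le> measure m {x \<in> Y. (T ^^ (n + N)) x \<in> A})"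
proof -
  obtain N c where c: "c > 0" "\<And>D W n l A. D \<in> cells \<Longrightarrow> W \<in> branches n D \<Longrightarrow> N \<le> l \<Longrightarrow> l \<le> N + g \<Longrightarrow> A \<in> sets m \<Longrightarrow>
    c * measure m W * measure m A \<le> measure m {x \<in> W. (T ^^ (l + n)) x \<in> A}"
    by (rule branch_return[of g]) (rule that; assumption)
  \<comment> \<open>the number of pairs of level and cell; the additional \<open>1\<close> makes the pigeonhole strict\<close>
  define M where "M = real ((g + 1) * card cells) + 1"
  have M: "M > 0" using of_nat_0_le_iff[of "(g + 1) * card cells", where 'a = real] unfolding M_def by linarith
  have main: "\<exists>Y\<in>sets m. Y \<subseteq> G \<and> (\<forall>A\<in>sets m. c / M * measure m X * measure m A \<le> measure m {x \<in> Y. (T ^^ (n + N)) x \<in> A})"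
    if X: "X \<in> sets m" and cov: "\<forall>x\<in>X. \<exists>j D W. j \<le> n \<and> n \<le> j + g \<and> D \<in> cells \<and> W \<in> branches j D \<and> x \<in> W \<and> W \<subseteq> G"
    for n X G
  proof -
    define V where "V p = {W \<in> branches (fst p) (snd p). W \<subseteq> G}" for p :: "nat \<times> real set"
    define P where "P = {n - g..n} \<times> cells"
    have finP: "finite P" unfolding P_def using finite_cells by simp
    have finV: "finite (V p)" for p unfolding V_def using finite_branches by simp
    have Vs: "W \<in> sets m" if "W \<in> V p" for W p using that branch_sets by (auto simp: V_def)
    have UVs: "\<Union>(V p) \<in> sets m" for p by (rule sets.finite_Union[OF finV]) (use Vs in blast)
    have "card {n - g..n} \<le> g + 1" by simp
    then have "card P \<le> (g + 1) * card cells" unfolding P_def card_cartesian_product by (rule mult_right_mono) simp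
    then have "real (card P) \<le> real ((g + 1) * card cells)" using of_nat_le_iff by blast
    then have cardP: "real (card P) < M" by (simp only: M_def)
    have "X \<subseteq> (\<Union>p\<in>P. \<Union>(V p))"
    proof
      fix x assume "x \<in> X"
      then obtain j D W where w: "j \<le> n" "n \<le> j + g" "D \<in> cells" "W \<in> branches j D" "x \<in> W" "W \<subseteq> G"
        using cov by blast
      then have "(j, D) \<in> P" "W \<in> V (j, D)" by (auto simp: P_def V_def)
      then show "x \<in> (\<Union>p\<in>P. \<Union>(V p))" using w(5) by blast
    qed
    then have "measure m X \<le> measure m (\<Union>p\<in>P. \<Union>(V p))"
      by (intro finite_measure_mono sets.finite_UN finP UVs)
    also have "\<dots> \<le> (\<Sum>p\<in>P. measure m (\<Union>(V p)))"
      by (rule finite_measure_subadditive_finite[OF finP]) (use UVs in blast)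
    finally have sumP: "measure m X \<le> (\<Sum>p\<in>P. measure m (\<Union>(V p)))" .
    have ex: "\<exists>Y\<in>sets m. Y \<subseteq> G \<and> (\<forall>A\<in>sets m. c / M * measure m X * measure m A \<le> measure m {x \<in> Y. (T ^^ (n + N)) x \<in> A})"
      if p: "p \<in> P" "measure m X / M \<le> measure m (\<Union>(V p))" for p
    proof (intro bexI conjI ballI)
      show "\<Union>(V p) \<in> sets m" by (rule UVs)
      show "\<Union>(V p) \<subseteq> G" by (auto simp: V_def)
      fix A assume A: "A \<in> sets m"
      obtain j D where jD: "p = (j, D)" by (cases p)
      have j: "j \<le> n" "n \<le> j + g" "D \<in> cells" using p(1) jD by (auto simp: P_def)
      have VW: "W \<in> branches j D" if "W \<in> V p" for W using that jD by (simp add: V_def)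
      have dis: "disjoint_family_on (\<lambda>W. W) (V p)"
        unfolding disjoint_family_on_def using branches_disjoint VW by blast
      have dis2: "disjoint_family_on (\<lambda>W. {x \<in> W. (T ^^ (n + N)) x \<in> A}) (V p)"
        using dis unfolding disjoint_family_on_def by blast
      have "c / M * measure m X * measure m A = c * (measure m X / M) * measure m A" by simp
      also have "\<dots> \<le> c * measure m (\<Union>(V p)) * measure m A"
        using p(2) c(1) by (intro mult_right_mono mult_left_mono) auto
      also have "measure m (\<Union>(V p)) = (\<Sum>W\<in>V p. measure m W)"
      proof -
        have "V p \<subseteq> sets m" using Vs by blast
        then show ?thesis using finite_measure_finite_Union[OF finV _ dis] by simp
      qed
      also have "c * (\<Sum>W\<in>V p. measure m W) * measure m A = (\<Sum>W\<in>V p. c * measure m W * measure m A)"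
        by (simp add: sum_distrib_left sum_distrib_right)
      also have "\<dots> \<le> (\<Sum>W\<in>V p. measure m {x \<in> W. (T ^^ (n + N)) x \<in> A})"
      proof (rule sum_mono)
        fix W assume W: "W \<in> V p"
        have eq: "(N + (n - j)) + j = n + N" using j by simp
        have "N \<le> N + (n - j)" "N + (n - j) \<le> N + g" using j by auto
        then show "c * measure m W * measure m A \<le> measure m {x \<in> W. (T ^^ (n + N)) x \<in> A}"
          using c(2)[OF j(3) VW[OF W] _ _ A, of "N + (n - j)", unfolded eq] by blast
      qed
      also have "\<dots> = measure m (\<Union>W\<in>V p. {x \<in> W. (T ^^ (n + N)) x \<in> A})"
        by (rule finite_measure_finite_Union[OF finV _ dis2, symmetric]) (use preimage_sets[OF Vs A] in blast)
      also have "(\<Union>W\<in>V p. {x \<in> W. (T ^^ (n + N)) x \<in> A}) = {x \<in> \<Union>(V p). (T ^^ (n + N)) x \<in> A}" by blast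
      finally show "c / M * measure m X * measure m A \<le> measure m {x \<in> \<Union>(V p). (T ^^ (n + N)) x \<in> A}" .
    qed
    show ?thesis
    proof (cases "\<exists>p\<in>P. measure m X / M \<le> measure m (\<Union>(V p))")
      case True
      then show ?thesis using ex by blast
    next
      case False
      then have "(\<Sum>p\<in>P. measure m (\<Union>(V p))) \<le> (\<Sum>p\<in>P. measure m X / M)"
        by (intro sum_mono) (auto simp: not_le less_imp_le)
      then have 1: "measure m X \<le> card P * (measure m X / M)" using sumP by simp
      have "measure m X = 0"
      proof (rule ccontr)
        assume "measure m X \<noteq> 0"
        then have "measure m X > 0" using measure_nonneg[of m X] by linarith
        then have "card P * (measure m X / M) < M * (measure m X / M)"
          using cardP M by (intro mult_strict_right_mono) auto
        then show False using 1 M by simp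
      qed
      then show ?thesis by (intro bexI[of _ "{}"]) auto
    qed
  qed
  show thesis by (rule that[of "c / M" N]) (use main c M in auto)
qed

lemma not_unexpanded:
  assumes "x \<in> {0..1}" "x \<notin> unexpanded n g"
  shows "\<exists>j D W. j \<le> n \<and> n \<le> j + g \<and> D \<in> cells \<and> W \<in> branches j D \<and> x \<in> W"
  using assms by (auto simp: unexpanded_def expanded_def)

lemma branch_diameter:
  assumes D: "D \<in> cells" and W: "W \<in> branches j D" and "i \<le> j" "x \<in> W" "y \<in> W"
  shows "\<bar>(T ^^ i) x - (T ^^ i) y\<bar> \<le> K * \<theta> ^ (j - i)"
proof -
  have "shrinks K \<theta> j W" by (rule shrink[OF branch_facts(1,2)[OF W] branch_narrow[OF D W]])
  then have "narrow (K * \<theta> ^ (j - i)) ((T ^^ i) ` W)" using assms(3) by (simp add: shrinks_def)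
  then show ?thesis by (rule narrowD) (use assms in auto)
qed

lemma unexpanded_rare:
  assumes "\<epsilon> > 0"
  obtains g where "\<And>n. measure m (unexpanded n g) \<le> \<epsilon>"
proof -
  have "(\<lambda>g. C1 * q ^ g) \<longlonglongrightarrow> C1 * 0"
    by (intro tendsto_intros LIMSEQ_realpow_zero) (use q in auto)
  then have "\<forall>\<^sub>F g in sequentially. C1 * q ^ g < \<epsilon>" using assms by (intro order_tendstoD) auto
  then obtain g where "C1 * q ^ g < \<epsilon>" by (auto simp: eventually_sequentially)
  then have "measure m (unexpanded n g) \<le> \<epsilon>" for n using unexpanded_small[of n g] by linarith
  then show thesis by (rule that)
qed

text \<open>Inner regularity, which is available for finite Borel measures on the whole line, hence the
  extension \<open>M\<close>.\<close>

lemma compact_subset_mass: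
  assumes E: "E \<in> sets m" and \<epsilon>: "\<epsilon> > 0"
  obtains L where "compact L" "L \<subseteq> E" "measure m E - \<epsilon> < measure m L"
proof -
  define M where "M = distr m borel (\<lambda>x. x)"
  have id: "(\<lambda>x. x) \<in> measurable m borel"
    unfolding measurable_cong_sets[OF sets_m refl] by (rule measurable_restrict_space1) simp
  have sM: "sets M = sets borel" by (simp add: M_def)
  have em: "emeasure M B = emeasure m B" if "B \<in> sets borel" "B \<subseteq> {0..1}" for B
    using that id by (simp add: M_def emeasure_distr space_m Int_absorb2)
  have Eb: "E \<in> sets borel" "E \<subseteq> {0..1}" using E by (auto simp: sets_m_iff)
  have "emeasure M (space M) \<noteq> \<infinity>"
    using id by (simp add: M_def emeasure_distr emeasure_eq_measure)
  then have sup: "emeasure M E = (SUP L\<in>{L. L \<subseteq> E \<and> compact L}. emeasure M L)"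
    by (rule inner_regular[OF sM _ Eb(1)])
  show thesis
  proof (cases "measure m E - \<epsilon> < 0")
    case True
    then show thesis using that[of "{}"] by simp
  next
    case False
    have "ennreal (measure m E - \<epsilon>) < emeasure M E"
      using False \<epsilon> em[OF Eb] by (simp add: emeasure_eq_measure ennreal_lessI)
    then obtain L where L: "L \<subseteq> E" "compact L" "ennreal (measure m E - \<epsilon>) < emeasure M L"
      unfolding sup by (auto simp: less_SUP_iff)
    have "emeasure M L = ennreal (measure m L)"
      using em[of L] L Eb by (auto simp: emeasure_eq_measure compact_imp_closed)
    then have "measure m E - \<epsilon> < measure m L"
      using L(3) False by (simp add: ennreal_less_iff)
    then show thesis using that L by blast
  qed
qed

lemma compact_nbhd_mass:
  assumes L: "compact L" "L \<subseteq> {0..1}" and \<epsilon>: "\<epsilon> > 0"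
  obtains \<delta> where "\<delta> > 0" "(\<Union>x\<in>L. ball x \<delta>) \<inter> {0..1} - L \<in> sets m"
    "measure m ((\<Union>x\<in>L. ball x \<delta>) \<inter> {0..1} - L) < \<epsilon>"
proof -
  define U where "U k = (\<Union>x\<in>L. ball x (1 / (real k + 1))) \<inter> {0..1} - L" for k :: nat
  have Lb: "L \<in> sets borel" using L(1) by (simp add: compact_imp_closed)
  have op: "open (\<Union>x\<in>L. ball x (1 / (real k + 1)))" for k by (intro open_UN) auto
  have Us: "U k \<in> sets m" for k
  proof -
    have "(\<Union>x\<in>L. ball x (1 / (real k + 1))) \<inter> {0..1} - L \<in> sets borel"
      using op[of k] Lb by (intro sets.Diff sets.Int) auto
    then show ?thesis by (auto simp: U_def sets_m_iff)
  qed
  have "decseq U"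
  proof (rule decseq_SucI)
    fix k
    have "1 / (real (Suc k) + 1) \<le> 1 / (real k + 1)" by (intro divide_left_mono) auto
    then have "ball x (1 / (real (Suc k) + 1)) \<subseteq> ball x (1 / (real k + 1))" for x :: real by (rule subset_ball)
    then show "U (Suc k) \<subseteq> U k" unfolding U_def by blast
  qed
  then have "(\<lambda>k. measure m (U k)) \<longlonglongrightarrow> measure m (\<Inter>k. U k)"
    by (intro finite_Lim_measure_decseq) (use Us in auto)
  also have "(\<Inter>k. U k) = {}"
  proof (rule ccontr)
    assume "(\<Inter>k. U k) \<noteq> {}"
    then obtain x where x: "\<And>k. x \<in> U k" by blast
    then have "x \<notin> L" by (auto simp: U_def)
    then obtain e where e: "e > 0" "\<And>y. y \<in> L \<Longrightarrow> dist x y \<ge> e"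
      using separate_point_closed[OF compact_imp_closed[OF L(1)]] by blast
    obtain k where k: "inverse (real (Suc k)) < e" using reals_Archimedean e(1) by blast
    obtain y where "y \<in> L" "dist y x < 1 / (real k + 1)" using x[of k] by (auto simp: U_def)
    moreover have "1 / (real k + 1) = inverse (real (Suc k))" by (simp add: inverse_eq_divide add.commute)
    ultimately show False using e(2)[of y] k by (simp add: dist_commute)
  qed
  finally have "(\<lambda>k. measure m (U k)) \<longlonglongrightarrow> 0" by simp
  then have "\<forall>\<^sub>F k in sequentially. measure m (U k) < \<epsilon>" using \<epsilon> by (rule order_tendstoD)
  then obtain k where "measure m (U k) < \<epsilon>" by (auto simp: eventually_sequentially)
  then show thesis using that[of "1 / (real k + 1)"] Us[of k] by (simp add: U_def)
qed

text \<open>Approximate \<open>E\<close> from inside by a compact set \<open>L\<close>. The branches of high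
  level that meet \<open>L\<close> are tiny, so they lie in a neighbourhood of \<open>L\<close> that has little
  mass outside \<open>L\<close>. The time \<open>l\<close> depends on \<open>A\<close>, because that mass
  outside has to be small compared with the mass of \<open>A\<close>; the constant does not.\<close>

theorem positive_mass_spreads:
  assumes E: "E \<in> sets m" "measure m E > 0"
  obtains c where "c > 0" "\<And>A. A \<in> sets m \<Longrightarrow> \<exists>l. c * measure m A \<le> measure m {x \<in> E. (T ^^ l) x \<in> A}"
proof -
  define e where "e = measure m E"
  have e: "e > 0" using E by (simp add: e_def)
  obtain L where L: "compact L" "L \<subseteq> E" "e - e / 4 < measure m L"
    by (rule compact_subset_mass[OF E(1), of "e / 4"]) (use e in \<open>auto simp: e_def\<close>)
  have L01: "L \<subseteq> {0..1}" using L(2) E(1) by (auto simp: sets_m_iff)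
  have Ls: "L \<in> sets m" using L01 L(1) by (simp add: sets_m_iff compact_imp_closed)
  have e4: "e / 4 > 0" using e by simp
  obtain g where g: "\<And>n. measure m (unexpanded n g) \<le> e / 4" by (rule unexpanded_rare[OF e4]) (rule that; assumption)
  obtain N c where c: "c > 0" "\<And>n X G. X \<in> sets m \<Longrightarrow>
    \<forall>x\<in>X. \<exists>j D W. j \<le> n \<and> n \<le> j + g \<and> D \<in> cells \<and> W \<in> branches j D \<and> x \<in> W \<and> W \<subseteq> G \<Longrightarrow>
    \<exists>Y\<in>sets m. Y \<subseteq> G \<and> (\<forall>A\<in>sets m. c * measure m X * measure m A \<le> measure m {x \<in> Y. (T ^^ (n + N)) x \<in> A})"
    by (rule mass_of_branch_returns[of g]) (rule that; assumption)
  have "\<exists>l. c * (e / 4) * measure m A \<le> measure m {x \<in> E. (T ^^ l) x \<in> A}" if A: "A \<in> sets m" for A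
  proof (cases "measure m A = 0")
    case True
    then show ?thesis by simp
  next
    case False
    then have mA: "measure m A > 0" using measure_nonneg[of m A] by linarith
    define \<epsilon> where "\<epsilon> = c * (e / 4) * measure m A"
    have \<epsilon>: "\<epsilon> > 0" using c(1) e mA by (simp add: \<epsilon>_def)
    obtain \<delta> where \<delta>: "\<delta> > 0" "(\<Union>x\<in>L. ball x \<delta>) \<inter> {0..1} - L \<in> sets m"
      "measure m ((\<Union>x\<in>L. ball x \<delta>) \<inter> {0..1} - L) < \<epsilon>"
      by (rule compact_nbhd_mass[OF L(1) L01 \<epsilon>])
    let ?G = "(\<Union>x\<in>L. ball x \<delta>) \<inter> {0..1}"
    have "(\<lambda>n. K * \<theta> ^ n) \<longlonglongrightarrow> K * 0" by (intro tendsto_intros LIMSEQ_realpow_zero) (use \<theta> in auto)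
    then have "\<forall>\<^sub>F n in sequentially. K * \<theta> ^ n < \<delta>" using \<delta>(1) by (intro order_tendstoD) auto
    then obtain n0 where n0: "\<And>n. n \<ge> n0 \<Longrightarrow> K * \<theta> ^ n < \<delta>" by (auto simp: eventually_sequentially)
    define n where "n = n0 + g"
    define X where "X = L - unexpanded n g"
    have Xs: "X \<in> sets m" unfolding X_def using Ls unexpanded_sets by blast
    have "measure m L \<le> measure m (X \<union> unexpanded n g)"
      by (rule finite_measure_mono) (unfold X_def, blast, rule sets.Un[OF Xs[unfolded X_def] unexpanded_sets])
    also have "\<dots> \<le> measure m X + measure m (unexpanded n g)" by (rule measure_Un_le[OF Xs unexpanded_sets])
    finally have mX: "measure m X \<ge> e / 2" using g[of n] L(3) by linarith
    have cov: "\<forall>x\<in>X. \<exists>j D W. j \<le> n \<and> n \<le> j + g \<and> D \<in> cells \<and> W \<in> branches j D \<and> x \<in> W \<and> W \<subseteq> ?G"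
    proof
      fix x assume x: "x \<in> X"
      then have xL: "x \<in> L" by (simp add: X_def)
      have x01: "x \<in> {0..1}" using xL L01 by blast
      have "x \<notin> unexpanded n g" using x by (simp add: X_def)
      then obtain j D W where w: "j \<le> n" "n \<le> j + g" "D \<in> cells" "W \<in> branches j D" "x \<in> W"
        using not_unexpanded[OF x01] by blast
      have "W \<subseteq> ?G"
      proof
        fix y assume y: "y \<in> W"
        have "\<bar>(T ^^ 0) x - (T ^^ 0) y\<bar> \<le> K * \<theta> ^ (j - 0)"
          by (rule branch_diameter[OF w(3,4) _ w(5) y]) simp
        moreover have "K * \<theta> ^ j < \<delta>" by (rule n0) (use w(2) n_def in linarith)
        ultimately have "dist x y < \<delta>" by (simp add: dist_real_def)
        then show "y \<in> ?G" using xL branch_facts(1)[OF w(4)] y by auto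
      qed
      then show "\<exists>j D W. j \<le> n \<and> n \<le> j + g \<and> D \<in> cells \<and> W \<in> branches j D \<and> x \<in> W \<and> W \<subseteq> ?G"
        using w by blast
    qed
    obtain Y where Y: "Y \<in> sets m" "Y \<subseteq> ?G"
      "\<And>A. A \<in> sets m \<Longrightarrow> c * measure m X * measure m A \<le> measure m {x \<in> Y. (T ^^ (n + N)) x \<in> A}"
      using c(2)[OF Xs cov] by blast
    let ?Z = "{x \<in> L. (T ^^ (n + N)) x \<in> A}"
    have Zs: "?Z \<in> sets m" by (rule preimage_sets[OF Ls A])
    have "c * (e / 2) * measure m A \<le> c * measure m X * measure m A"
      using mX c(1) by (intro mult_right_mono mult_left_mono) auto
    also have "\<dots> \<le> measure m {x \<in> Y. (T ^^ (n + N)) x \<in> A}" by (rule Y(3)[OF A])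
    also have "\<dots> \<le> measure m (?Z \<union> (?G - L))"
      by (rule finite_measure_mono) (use Y(2) Zs \<delta>(2) in auto)
    also have "\<dots> \<le> measure m ?Z + measure m (?G - L)" by (rule measure_Un_le[OF Zs \<delta>(2)])
    also have "\<dots> \<le> measure m ?Z + \<epsilon>" using \<delta>(3) by simp
    also have "measure m ?Z \<le> measure m {x \<in> E. (T ^^ (n + N)) x \<in> A}"
      by (rule finite_measure_mono) (use L(2) preimage_sets[OF E(1) A] in auto)
    finally have "c * (e / 4) * measure m A \<le> measure m {x \<in> E. (T ^^ (n + N)) x \<in> A}"
      by (simp add: \<epsilon>_def)
    then show ?thesis by blast
  qed
  then show thesis using that[of "c * (e / 4)"] c(1) e by simp
qed

section \<open>Avoiding a hole\<close>

definition avoid :: "real set \<Rightarrow> nat \<Rightarrow> real set" where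
  "avoid U n = {x \<in> {0..1}. \<forall>i<n. (T ^^ i) x \<notin> U}"

lemma avoid_sets:
  assumes "U \<in> sets m"
  shows "avoid U n \<in> sets m"
proof -
  have "avoid U n = {0..1} - (\<Union>i\<in>{..<n}. {x \<in> {0..1}. (T ^^ i) x \<in> U})" by (auto simp: avoid_def)
  then show ?thesis using preimage_sets[OF I_sets assms] I_sets by (auto intro!: sets.Diff sets.finite_UN)
qed

lemma visit_mass:
  assumes U: "U \<in> sets m" and J: "finite J"
  shows "measure m {x \<in> {0..1}. \<exists>i\<in>J. (T ^^ i) x \<in> U} \<le> card J * (C1 * measure m U)"
proof -
  have "{x \<in> {0..1}. \<exists>i\<in>J. (T ^^ i) x \<in> U} = (\<Union>i\<in>J. {x \<in> {0..1}. (T ^^ i) x \<in> U})" by auto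
  also have "measure m \<dots> \<le> (\<Sum>i\<in>J. measure m {x \<in> {0..1}. (T ^^ i) x \<in> U})"
    by (rule finite_measure_subadditive_finite[OF J]) (use preimage_sets[OF I_sets U] in blast)
  also have "\<dots> \<le> (\<Sum>i\<in>J. C1 * measure m U)" by (rule sum_mono) (rule preimage_bound[OF U])
  finally show ?thesis by simp
qed

text \<open>The mass of an interval of length \<open>d\<close> is at most of order \<open>d powr s\<close>, so
  the masses of the intervals around \<open>z\<close> form a geometric series whose sum is small for large
  \<open>h\<close>, uniformly in \<open>n\<close> and \<open>z\<close>.\<close>

lemma boundary_loss:
  assumes "\<epsilon> > 0"
  obtains h where "\<And>n z. measure m {x \<in> {0..1}. \<exists>i<n. \<bar>(T ^^ i) x - z\<bar> \<le> K * \<theta> ^ (n - i + h)} \<le> \<epsilon>"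
proof -
  obtain C s :: real where C: "C > 0" "s > 0"
    "\<And>A d. A \<subseteq> {0..1} \<Longrightarrow> connected A \<Longrightarrow> narrow d A \<Longrightarrow> d > 0 \<Longrightarrow> measure m A \<le> C * d powr s"
    by (rule mass_of_interval) (rule that; assumption)
  define t where "t = \<theta> powr s"
  have t: "0 < t" "t < 1" using \<theta> C powr_less_mono2[of s \<theta> 1] by (auto simp: t_def)
  define c where "c = C1 * (C * (2 * K) powr s) * (1 / (1 - t))"
  have "(\<lambda>h. c * t ^ h) \<longlonglongrightarrow> c * 0" by (intro tendsto_intros LIMSEQ_realpow_zero) (use t in auto)
  then have "\<forall>\<^sub>F h in sequentially. c * t ^ h < \<epsilon>" using assms by (intro order_tendstoD) auto
  then obtain h where h: "c * t ^ h < \<epsilon>" by (auto simp: eventually_sequentially)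
  have "measure m {x \<in> {0..1}. \<exists>i<n. \<bar>(T ^^ i) x - z\<bar> \<le> K * \<theta> ^ (n - i + h)} \<le> \<epsilon>" for n z
  proof -
    define J where "J i = cball z (K * \<theta> ^ (n - i + h)) \<inter> {0..1}" for i
    have Js: "J i \<in> sets m" for i by (simp add: J_def sets_m_iff)
    have mJ: "measure m (J i) \<le> C * (2 * K) powr s * t ^ h * t ^ (n - i)" for i
    proof -
      have "measure m (J i) \<le> C * (2 * (K * \<theta> ^ (n - i + h))) powr s"
      proof (rule C(3))
        show "connected (J i)" unfolding J_def cball_eq_atLeastAtMost by (simp add: Int_atLeastAtMost)
        show "narrow (2 * (K * \<theta> ^ (n - i + h))) (J i)"
          unfolding narrow_def
        proof (intro ballI)
          fix u v assume "u \<in> J i" "v \<in> J i"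
          then have "\<bar>z - u\<bar> \<le> K * \<theta> ^ (n - i + h)" "\<bar>z - v\<bar> \<le> K * \<theta> ^ (n - i + h)"
            by (auto simp: J_def dist_real_def)
          then show "\<bar>u - v\<bar> \<le> 2 * (K * \<theta> ^ (n - i + h))" by linarith
        qed
        show "2 * (K * \<theta> ^ (n - i + h)) > 0" using K \<theta> by simp
      qed (auto simp: J_def)
      also have "(2 * (K * \<theta> ^ (n - i + h))) powr s = (2 * K) powr s * (\<theta> ^ (n - i + h)) powr s"
        using K \<theta> by (simp add: powr_mult)
      also have "(\<theta> ^ (n - i + h)) powr s = t ^ (n - i + h)"
        using \<theta> by (simp add: t_def powr_powr powr_power mult.commute flip: powr_realpow)
      finally show ?thesis by (simp add: power_add mult_ac)
    qed
    have "{x \<in> {0..1}. \<exists>i<n. \<bar>(T ^^ i) x - z\<bar> \<le> K * \<theta> ^ (n - i + h)} = (\<Union>i\<in>{..<n}. {x \<in> {0..1}. (T ^^ i) x \<in> J i})"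
      using funpow_maps by (auto simp: J_def dist_real_def abs_minus_commute)
    also have "measure m \<dots> \<le> (\<Sum>i<n. measure m {x \<in> {0..1}. (T ^^ i) x \<in> J i})"
      by (rule finite_measure_subadditive_finite) (use preimage_sets[OF I_sets Js] in auto)
    also have "\<dots> \<le> (\<Sum>i<n. C1 * (C * (2 * K) powr s * t ^ h * t ^ (n - i)))"
    proof (rule sum_mono)
      fix i
      have "measure m {x \<in> {0..1}. (T ^^ i) x \<in> J i} \<le> C1 * measure m (J i)" by (rule preimage_bound[OF Js])
      also have "\<dots> \<le> C1 * (C * (2 * K) powr s * t ^ h * t ^ (n - i))"
        using mJ C1_pos by (intro mult_left_mono) auto
      finally show "measure m {x \<in> {0..1}. (T ^^ i) x \<in> J i} \<le> C1 * (C * (2 * K) powr s * t ^ h * t ^ (n - i))" .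
    qed
    also have "\<dots> = C1 * (C * (2 * K) powr s * t ^ h) * (\<Sum>i<n. t ^ (n - i))"
      by (simp add: sum_distrib_left mult.assoc)
    also have "(\<Sum>i<n. t ^ (n - i)) = (\<Sum>i<n. t ^ Suc i)"
      by (rule sum.reindex_bij_witness[of _ "\<lambda>k. n - Suc k" "\<lambda>k. n - Suc k"])
        (auto simp: Suc_diff_Suc simp flip: power_Suc)
    also have "C1 * (C * (2 * K) powr s * t ^ h) * (\<Sum>i<n. t ^ Suc i) \<le> C1 * (C * (2 * K) powr s * t ^ h) * (1 / (1 - t))"
    proof (rule mult_left_mono)
      have "(\<Sum>k<n. t ^ Suc k) \<le> (\<Sum>k<n. t ^ k)" by (rule sum_mono) (use t in \<open>auto simp: mult_left_le_one_le\<close>)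
      also have "\<dots> \<le> (\<Sum>k. t ^ k)" by (rule sum_le_suminf) (use t in auto)
      also have "\<dots> = 1 / (1 - t)" by (rule suminf_geometric) (use t in auto)
      finally show "(\<Sum>k<n. t ^ Suc k) \<le> 1 / (1 - t)" .
      show "0 \<le> C1 * (C * (2 * K) powr s * t ^ h)" using C1_pos C t by simp
    qed
    also have "\<dots> = c * t ^ h" by (simp add: c_def)
    finally show ?thesis using h by linarith
  qed
  then show thesis by (rule that)
qed

text \<open>If a branch of level at least \<open>n + h\<close> contains a point that avoids the hole for
  \<open>n\<close> steps and another one that does not, then at the time \<open>i\<close> of the visit the
  former is within the diameter \<open>K * \<theta> ^ (n - i + h)\<close> of an end point of the hole. By
  \<open>boundary_loss\<close> few points do this, so most of the avoiding points lie in branches that avoid the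
  hole entirely, and such branches return with a fixed proportion. No constant depends on the hole or on
  \<open>n\<close>.\<close>

theorem avoidance_spreads:
  obtains h c where "c > 0" "\<And>y \<rho> n A. measure m (avoid (ball y \<rho> \<inter> {0..1}) n) \<ge> 1 / 2 \<Longrightarrow> A \<in> sets m \<Longrightarrow>
    c * measure m A \<le> measure m {x \<in> avoid (ball y \<rho> \<inter> {0..1}) n. (T ^^ (n + h)) x \<in> A}"
proof -
  have e8: "(1 / 8 :: real) > 0" "(1 / 16 :: real) > 0" by simp_all
  obtain g where g: "\<And>n. measure m (unexpanded n g) \<le> 1 / 8" by (rule unexpanded_rare[OF e8(1)]) (rule that; assumption)
  obtain h where h: "\<And>n z. measure m {x \<in> {0..1}. \<exists>i<n. \<bar>(T ^^ i) x - z\<bar> \<le> K * \<theta> ^ (n - i + h)} \<le> 1 / 16"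
    by (rule boundary_loss[OF e8(2)]) (rule that; assumption)
  obtain N c where c: "c > 0" "\<And>n X G. X \<in> sets m \<Longrightarrow>
    \<forall>x\<in>X. \<exists>j D W. j \<le> n \<and> n \<le> j + g \<and> D \<in> cells \<and> W \<in> branches j D \<and> x \<in> W \<and> W \<subseteq> G \<Longrightarrow>
    \<exists>Y\<in>sets m. Y \<subseteq> G \<and> (\<forall>A\<in>sets m. c * measure m X * measure m A \<le> measure m {x \<in> Y. (T ^^ (n + N)) x \<in> A})"
    by (rule mass_of_branch_returns[of g]) (rule that; assumption)
  have main: "c / 4 * measure m A \<le> measure m {x \<in> avoid (ball y \<rho> \<inter> {0..1}) n. (T ^^ (n + (g + h + N))) x \<in> A}"
    if half: "measure m (avoid (ball y \<rho> \<inter> {0..1}) n) \<ge> 1 / 2" and A: "A \<in> sets m" for y \<rho> n A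
  proof -
    let ?B = "ball y \<rho> \<inter> {0..1}"
    let ?G = "avoid ?B n"
    have Bs: "?B \<in> sets m" by (simp add: sets_m_iff)
    have Gs: "?G \<in> sets m" by (rule avoid_sets[OF Bs])
    define Z where "Z z = {x \<in> {0..1}. \<exists>i<n. \<bar>(T ^^ i) x - z\<bar> \<le> K * \<theta> ^ (n - i + h)}" for z
    have Zs: "Z z \<in> sets m" for z
    proof -
      have "Z z = (\<Union>i\<in>{..<n}. {x \<in> {0..1}. (T ^^ i) x \<in> cball z (K * \<theta> ^ (n - i + h)) \<inter> {0..1}})"
        using funpow_maps by (auto simp: Z_def dist_real_def abs_minus_commute)
      also have "\<dots> \<in> sets m" by (intro sets.finite_UN preimage_sets[OF I_sets]) (auto simp: sets_m_iff)
      finally show ?thesis .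
    qed
    \<comment> \<open>the levels in the window before \<open>n + g + h\<close> are at least \<open>n + h\<close>\<close>
    define n' where "n' = n + (g + h)"
    define X where "X = ?G - unexpanded n' g - Z (y + \<rho>) - Z (y - \<rho>)"
    have Xs: "X \<in> sets m" unfolding X_def using Gs unexpanded_sets Zs by blast
    have "measure m ?G \<le> measure m (((X \<union> unexpanded n' g) \<union> Z (y + \<rho>)) \<union> Z (y - \<rho>))"
      by (rule finite_measure_mono) (use Xs unexpanded_sets Zs in \<open>auto simp: X_def\<close>)
    also have "\<dots> \<le> measure m ((X \<union> unexpanded n' g) \<union> Z (y + \<rho>)) + measure m (Z (y - \<rho>))"
      using Xs unexpanded_sets Zs by (intro measure_Un_le) auto
    also have "measure m ((X \<union> unexpanded n' g) \<union> Z (y + \<rho>)) \<le> measure m (X \<union> unexpanded n' g) + measure m (Z (y + \<rho>))"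
      using Xs unexpanded_sets Zs by (intro measure_Un_le) auto
    also have "measure m (X \<union> unexpanded n' g) \<le> measure m X + measure m (unexpanded n' g)"
      using Xs unexpanded_sets by (intro measure_Un_le) auto
    finally have mX: "measure m X \<ge> 1 / 4"
      using half g[of n'] h[of n "y + \<rho>"] h[of n "y - \<rho>"] by (simp add: Z_def)
    have cov: "\<forall>x\<in>X. \<exists>j D W. j \<le> n' \<and> n' \<le> j + g \<and> D \<in> cells \<and> W \<in> branches j D \<and> x \<in> W \<and> W \<subseteq> ?G"
    proof
      fix x assume x: "x \<in> X"
      have xG: "x \<in> ?G" using x by (simp add: X_def)
      then have x01: "x \<in> {0..1}" by (simp add: avoid_def)
      have "x \<notin> unexpanded n' g" using x by (simp add: X_def)
      then obtain j D W where w: "j \<le> n'" "n' \<le> j + g" "D \<in> cells" "W \<in> branches j D" "x \<in> W"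
        using not_unexpanded[OF x01] by blast
      have "W \<subseteq> ?G"
      proof
        fix v assume v: "v \<in> W"
        have v01: "v \<in> {0..1}" using branch_facts(1)[OF w(4)] v by blast
        have "(T ^^ i) v \<notin> ?B" if i: "i < n" for i
        proof
          assume hit: "(T ^^ i) v \<in> ?B"
          have "(T ^^ i) x \<notin> ?B" using xG i by (simp add: avoid_def)
          then have out: "\<bar>(T ^^ i) x - y\<bar> \<ge> \<rho>" using funpow_maps[OF x01, of i] by (simp add: dist_real_def abs_minus_commute)
          have inn: "\<bar>(T ^^ i) v - y\<bar> < \<rho>" using hit by (simp add: dist_real_def abs_minus_commute)
          have "\<bar>(T ^^ i) x - (T ^^ i) v\<bar> \<le> K * \<theta> ^ (j - i)"
            by (rule branch_diameter[OF w(3,4) _ w(5) v]) (use w(2) i in \<open>simp add: n'_def\<close>)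
          also have "\<dots> \<le> K * \<theta> ^ (n - i + h)"
            using K \<theta> w(2) i by (intro mult_left_mono power_decreasing) (auto simp: n'_def)
          finally have "\<bar>(T ^^ i) x - (y + \<rho>)\<bar> \<le> K * \<theta> ^ (n - i + h) \<or> \<bar>(T ^^ i) x - (y - \<rho>)\<bar> \<le> K * \<theta> ^ (n - i + h)"
            using out inn by (smt (verit))
          then have "x \<in> Z (y + \<rho>) \<or> x \<in> Z (y - \<rho>)" using x01 i by (auto simp: Z_def)
          then show False using x by (auto simp: X_def)
        qed
        then show "v \<in> ?G" using v01 by (simp add: avoid_def)
      qed
      then show "\<exists>j D W. j \<le> n' \<and> n' \<le> j + g \<and> D \<in> cells \<and> W \<in> branches j D \<and> x \<in> W \<and> W \<subseteq> ?G"
        using w by blast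
    qed
    obtain Y where Y: "Y \<in> sets m" "Y \<subseteq> ?G"
      "\<And>A. A \<in> sets m \<Longrightarrow> c * measure m X * measure m A \<le> measure m {x \<in> Y. (T ^^ (n' + N)) x \<in> A}"
      using c(2)[OF Xs cov] by blast
    have "c / 4 * measure m A = c * (1 / 4) * measure m A" by simp
    also have "\<dots> \<le> c * measure m X * measure m A"
      using mX c(1) by (intro mult_right_mono mult_left_mono) auto
    also have "\<dots> \<le> measure m {x \<in> Y. (T ^^ (n' + N)) x \<in> A}" by (rule Y(3)[OF A])
    also have "\<dots> \<le> measure m {x \<in> ?G. (T ^^ (n' + N)) x \<in> A}"
      by (rule finite_measure_mono) (use Y(2) preimage_sets[OF Gs A] in auto)
    also have "n' + N = n + (g + h + N)" by (simp add: n'_def)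
    finally show ?thesis .
  qed
  show thesis by (rule that[of "c / 4" "g + h + N"]) (use main c(1) in auto)
qed

section \<open>Late hitting times\<close>

text \<open>The density of \<open>\<mu>\<close> is at least \<open>1 / 2\<close> on a set \<open>E\<close> of
  positive mass. A set \<open>A\<close> of small \<open>\<mu>\<close>-measure would have preimages of the same
  small \<open>\<mu>\<close>-measure, while \<open>E\<close> spreads over \<open>A\<close>.\<close>

theorem invariant_measure_dominates:
  assumes \<mu>: "prob_space \<mu>" "sets \<mu> = sets m" "distr \<mu> \<mu> T = \<mu>" "T \<in> measurable \<mu> \<mu>"
    and ac: "absolutely_continuous m \<mu>"
  obtains c where "c > 0" "\<And>A. A \<in> sets m \<Longrightarrow> c * measure m A \<le> measure \<mu> A"
proof -
  interpret M: prob_space \<mu> by (rule \<mu>(1))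
  define f where "f = RN_deriv m \<mu>"
  have fm: "f \<in> borel_measurable m" by (simp add: f_def)
  have dens: "density m f = \<mu>" unfolding f_def by (rule density_RN_deriv[OF ac \<mu>(2)])
  define E where "E = {x \<in> space m. ennreal (1 / 2) \<le> f x}"
  have Es: "E \<in> sets m" unfolding E_def using fm by measurable
  have em: "emeasure \<mu> A = (\<integral>\<^sup>+x\<in>A. f x \<partial>m)" if "A \<in> sets m" for A
    using emeasure_density[OF fm that] dens by simp
  have "measure m E \<noteq> 0"
  proof
    assume "measure m E = 0"
    then have "emeasure m E = 0" by (simp add: emeasure_eq_measure)
    then have "AE x in m. x \<notin> E" using Es by (intro AE_not_in) (auto simp: null_sets_def)
    then have ae: "AE x in m. f x * indicator (space m) x \<le> ennreal (1 / 2)"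
      by eventually_elim (auto simp: E_def indicator_def)
    have "1 = emeasure \<mu> (space m)" using M.emeasure_space_1 sets_eq_imp_space_eq[OF \<mu>(2)] by simp
    also have "\<dots> = (\<integral>\<^sup>+x\<in>space m. f x \<partial>m)" by (rule em) simp
    also have "\<dots> \<le> (\<integral>\<^sup>+x. ennreal (1 / 2) \<partial>m)" by (rule nn_integral_mono_AE[OF ae])
    also have "\<dots> = ennreal (1 / 2)" by (simp add: emeasure_space_1)
    also have "\<dots> < 1" by (rule ennreal_less_one_iff[THEN iffD2]) simp
    finally show False by simp
  qed
  then have mE: "measure m E > 0" using measure_nonneg[of m E] by linarith
  obtain c where c: "c > 0" "\<And>A. A \<in> sets m \<Longrightarrow> \<exists>l. c * measure m A \<le> measure m {x \<in> E. (T ^^ l) x \<in> A}"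
    by (rule positive_mass_spreads[OF Es mE]) (rule that; assumption)
  have inv: "T ^^ l \<in> measurable \<mu> \<mu> \<and> distr \<mu> \<mu> (T ^^ l) = \<mu>" for l
  proof (induction l)
    case 0
    then show ?case by (simp add: id_def distr_id2)
  next
    case (Suc l)
    have "distr \<mu> \<mu> (T \<circ> (T ^^ l)) = distr (distr \<mu> \<mu> (T ^^ l)) \<mu> T"
      using distr_distr[OF \<mu>(4)] Suc by metis
    then have "distr \<mu> \<mu> (T \<circ> (T ^^ l)) = \<mu>" using Suc \<mu>(3) by simp
    moreover have "T \<circ> (T ^^ l) \<in> measurable \<mu> \<mu>"
      using Suc \<mu>(4) by (blast intro: measurable_comp)
    ultimately show ?case by (simp only: funpow.simps(2) simp_thms)
  qed
  have "c / 2 * measure m A \<le> measure \<mu> A" if A: "A \<in> sets m" for A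
  proof -
    obtain l where l: "c * measure m A \<le> measure m {x \<in> E. (T ^^ l) x \<in> A}" using c(2)[OF A] by blast
    let ?Z = "{x \<in> E. (T ^^ l) x \<in> A}"
    have Zs: "?Z \<in> sets m" by (rule preimage_sets[OF Es A])
    have "ennreal (1 / 2 * measure m ?Z) = ennreal (1 / 2) * ennreal (measure m ?Z)" by (rule ennreal_mult) auto
    also have "\<dots> = (\<integral>\<^sup>+x. ennreal (1 / 2) * indicator ?Z x \<partial>m)"
      by (simp only: nn_integral_cmult_indicator[OF Zs] emeasure_eq_measure)
    also have "\<dots> \<le> (\<integral>\<^sup>+x. f x * indicator ?Z x \<partial>m)"
      by (rule nn_integral_mono) (auto simp: indicator_def E_def)
    also have "\<dots> = emeasure \<mu> ?Z" by (rule em[OF Zs, symmetric])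
    also have "\<dots> = ennreal (measure \<mu> ?Z)" by (rule M.emeasure_eq_measure)
    finally have "1 / 2 * measure m ?Z \<le> measure \<mu> ?Z" by (simp add: ennreal_le_iff)
    also have "\<dots> \<le> measure \<mu> ((T ^^ l) -` A \<inter> space \<mu>)"
      by (rule M.finite_measure_mono)
        (use inv[of l] A \<mu>(2) sets_eq_imp_space_eq[OF \<mu>(2)] in \<open>auto simp: E_def intro: measurable_sets\<close>)
    also have "\<dots> = measure (distr \<mu> \<mu> (T ^^ l)) A"
      by (rule measure_distr[symmetric]) (use inv[of l] A \<mu>(2) in auto)
    also have "\<dots> = measure \<mu> A" using inv[of l] by simp
    finally show ?thesis using l by simp
  qed
  then show thesis using that[of "c / 2"] c(1) by simp
qed

text \<open>It suffices to shrink the holes along a sequence, because only a lower bound of an upper limit is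
  wanted.\<close>

definition target :: "real \<Rightarrow> nat \<Rightarrow> real set" where
  "target y j = ball y (1 / (real j + 1)) \<inter> {0..1}"

lemma target_sets: "target y j \<in> sets m"
  by (simp add: target_def sets_m_iff)

lemma target_mass_pos:
  assumes "y \<in> {0..1}"
  shows "measure m (target y j) > 0"
proof -
  define d where "d = 1 / (real j + 1)"
  have d: "0 < d" "d \<le> 1" by (auto simp: d_def)
  define a b where "a = max 0 (y - d / 2)" and "b = min 1 (y + d / 2)"
  have ab: "0 \<le> a" "a < b" "b \<le> 1" using assms d by (auto simp: a_def b_def)
  have "{a<..<b} \<subseteq> target y j"
    using d(1) unfolding target_def d_def[symmetric] by (auto simp: a_def b_def dist_real_def)
  then have "measure m {a<..<b} \<le> measure m (target y j)" by (rule finite_measure_mono) (rule target_sets)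
  then show ?thesis using supp[OF ab] by linarith
qed

lemma target_mass_tendsto: "(\<lambda>j. measure m (target y j)) \<longlonglongrightarrow> 0"
proof (rule LIMSEQ_I)
  fix \<epsilon> :: real assume \<epsilon>: "\<epsilon> > 0"
  obtain \<delta> where \<delta>: "\<delta> > 0" "measure m ((ball y \<delta> \<inter> {0..1}) - {y}) < \<epsilon>"
    using punctured_nbhd_small[OF \<epsilon>] by blast
  obtain J where J: "inverse (real (Suc J)) < \<delta>" using reals_Archimedean \<delta>(1) by blast
  have "measure m (target y j) < \<epsilon>" if j: "j \<ge> J" for j
  proof -
    have "1 / (real j + 1) \<le> 1 / (real J + 1)" using j by (intro divide_left_mono) auto
    then have le: "1 / (real j + 1) \<le> \<delta>" using J by (simp add: inverse_eq_divide add.commute)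
    have s: "(ball y \<delta> \<inter> {0..1}) - {y} \<in> sets m" by (auto simp: sets_m_iff)
    have s': "(ball y \<delta> \<inter> {0..1}) \<inter> {y} \<in> sets m" by (auto simp: sets_m_iff)
    have "target y j \<subseteq> ((ball y \<delta> \<inter> {0..1}) - {y}) \<union> ((ball y \<delta> \<inter> {0..1}) \<inter> {y})"
      using subset_ball[OF le, of y] by (auto simp: target_def)
    then have "measure m (target y j) \<le> measure m (((ball y \<delta> \<inter> {0..1}) - {y}) \<union> ((ball y \<delta> \<inter> {0..1}) \<inter> {y}))"
      by (rule finite_measure_mono) (use s s' in blast)
    also have "\<dots> \<le> measure m ((ball y \<delta> \<inter> {0..1}) - {y}) + measure m ((ball y \<delta> \<inter> {0..1}) \<inter> {y})"
      by (rule measure_Un_le[OF s s'])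
    also have "measure m ((ball y \<delta> \<inter> {0..1}) \<inter> {y}) = 0"
      by (rule measure_finite_set) auto
    finally show ?thesis using \<delta>(2) by simp
  qed
  then show "\<exists>no. \<forall>n\<ge>no. norm (measure m (target y n) - 0) < \<epsilon>" by auto
qed

text \<open>With \<open>b\<close> the measure of \<open>U\<close>, the points for which the hitting time of
  \<open>U\<close> times \<open>b\<close> is at least \<open>N\<close>.\<close>

definition late :: "real \<Rightarrow> real set \<Rightarrow> real \<Rightarrow> real set" where
  "late b U N = {x \<in> {0..1}. \<forall>i. 1 \<le> i \<and> real i * b < N \<longrightarrow> (T ^^ i) x \<notin> U}"

lemma late_sets:
  assumes "U \<in> sets m"
  shows "late b U N \<in> sets m"
proof -
  have "late b U N = {0..1} - (\<Union>i\<in>{i. 1 \<le> i \<and> real i * b < N}. {x \<in> {0..1}. (T ^^ i) x \<in> U})"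
    by (auto simp: late_def)
  also have "\<dots> \<in> sets m"
    by (intro sets.Diff I_sets sets.countable_UN'') (rule countableI_type, rule preimage_sets[OF I_sets assms])
  finally show ?thesis .
qed

text \<open>The time \<open>N / b\<close> is covered by \<open>Q\<close> blocks of \<open>n\<close> steps,
  separated by \<open>h\<close> steps each. By the union bound half of the mass survives one block when
  \<open>n\<close> is about \<open>1 / (2 C1 M)\<close>, where \<open>M\<close> is the mass of the hole, and
  \<open>avoidance_spreads\<close> makes the blocks independent up to the factor \<open>c\<close>. The number
  \<open>Q * h\<close> of the times between blocks does not depend on the hole, so hitting it then has mass of
  order \<open>M\<close>, which tends to \<open>0\<close>.\<close>

lemma late_mass:
  assumes y: "y \<in> {0..1}" and c\<mu>: "c\<mu> > 0"
  obtains \<delta> J where "\<delta> > 0" "\<And>j b. j \<ge> J \<Longrightarrow> c\<mu> * measure m (target y j) \<le> b \<Longrightarrow> \<delta> \<le> measure m (late b (target y j) N)"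
proof -
  obtain h c where c: "c > 0" "\<And>y \<rho> n A. measure m (avoid (ball y \<rho> \<inter> {0..1}) n) \<ge> 1 / 2 \<Longrightarrow> A \<in> sets m \<Longrightarrow>
    c * measure m A \<le> measure m {x \<in> avoid (ball y \<rho> \<inter> {0..1}) n. (T ^^ (n + h)) x \<in> A}"
    by (rule avoidance_spreads) (rule that; assumption)
  obtain Q :: nat where Q: "real Q > 4 * C1 * N / c\<mu>" using reals_Archimedean2 by blast
  define \<delta> where "\<delta> = c ^ Q / 2"
  have \<delta>: "\<delta> > 0" using c(1) by (simp add: \<delta>_def)
  \<comment> \<open>the first bound makes \<open>n\<close> at least \<open>1 / (4 C1 M)\<close> in spite of rounding, the second one pays for the times between blocks\<close>
  define \<eta> where "\<eta> = min (1 / (4 * C1)) (\<delta> / (C1 * (real (Q * h) + 1)))"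
  have \<eta>: "\<eta> > 0" using C1_pos \<delta> by (auto simp: \<eta>_def intro!: divide_pos_pos mult_pos_pos add_nonneg_pos)
  obtain J where J: "\<And>j. j \<ge> J \<Longrightarrow> measure m (target y j) < \<eta>"
    using order_tendstoD(2)[OF target_mass_tendsto \<eta>] by (auto simp: eventually_sequentially)
  have "\<delta> \<le> measure m (late b (target y j) N)" if j: "j \<ge> J" and b: "c\<mu> * measure m (target y j) \<le> b" for j b
  proof -
    define B where "B = target y j"
    define M where "M = measure m B"
    have Bs: "B \<in> sets m" by (simp add: B_def target_sets)
    have M0: "M > 0" using target_mass_pos[OF y] by (simp add: M_def B_def)
    have M1: "M < 1 / (4 * C1)" "M < \<delta> / (C1 * (real (Q * h) + 1))" using J[OF j] by (auto simp: \<eta>_def M_def B_def)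
    define n where "n = nat \<lfloor>1 / (2 * C1 * M)\<rfloor>"
    have n: "real n \<le> 1 / (2 * C1 * M)" "1 / (2 * C1 * M) - 1 < real n"
      using C1_pos M0 unfolding n_def by (auto simp: of_nat_nat)
    have nlow: "1 / (4 * C1 * M) \<le> real n"
    proof -
      have "1 \<le> 1 / (4 * C1 * M)" using M1(1) M0 C1_pos by (simp add: field_simps)
      moreover have "1 / (2 * C1 * M) = 1 / (4 * C1 * M) + 1 / (4 * C1 * M)" using C1_pos M0 by (simp add: field_simps)
      ultimately show ?thesis using n(2) by linarith
    qed
    have half: "measure m (avoid B n) \<ge> 1 / 2"
    proof -
      let ?V = "{x \<in> {0..1}. \<exists>i\<in>{..<n}. (T ^^ i) x \<in> B}"
      have Vs: "?V \<in> sets m"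
      proof -
        have "?V = (\<Union>i\<in>{..<n}. {x \<in> {0..1}. (T ^^ i) x \<in> B})" by auto
        then show ?thesis using preimage_sets[OF I_sets Bs] by (auto intro!: sets.finite_UN)
      qed
      have "measure m ?V \<le> card {..<n} * (C1 * M)" unfolding M_def by (rule visit_mass[OF Bs]) simp
      also have "\<dots> \<le> 1 / (2 * C1 * M) * (C1 * M)" using n(1) C1_pos M0 by (intro mult_right_mono) auto
      also have "\<dots> = 1 / 2" using C1_pos M0 by simp
      finally have "measure m ?V \<le> 1 / 2" .
      moreover have "avoid B n = space m - ?V" by (auto simp: avoid_def space_m)
      ultimately show ?thesis using prob_compl[OF Vs] by simp
    qed
    \<comment> \<open>survival of the first \<open>t\<close> blocks\<close>
    define P where "P t = {x \<in> {0..1}. \<forall>s<t. \<forall>i<n. (T ^^ (s * (n + h) + i)) x \<notin> B}" for t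
    have Ps: "P t \<in> sets m" for t
    proof -
      have "P t = {0..1} - (\<Union>s\<in>{..<t}. \<Union>i\<in>{..<n}. {x \<in> {0..1}. (T ^^ (s * (n + h) + i)) x \<in> B})"
        by (auto simp: P_def)
      also have "\<dots> \<in> sets m" by (intro sets.Diff I_sets sets.finite_UN preimage_sets[OF I_sets Bs]) auto
      finally show ?thesis .
    qed
    have mP: "c ^ t \<le> measure m (P t)" for t
    proof (induction t)
      case 0
      have "P 0 = space m" by (auto simp: P_def space_m)
      then show ?case by (simp add: prob_space)
    next
      case (Suc t)
      have "c ^ Suc t \<le> c * measure m (P t)" using Suc c(1) by simp
      also have "\<dots> \<le> measure m {x \<in> avoid B n. (T ^^ (n + h)) x \<in> P t}"
        using c(2)[of y "1 / (real j + 1)" n "P t"] half Ps unfolding B_def target_def by blast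
      also have "{x \<in> avoid B n. (T ^^ (n + h)) x \<in> P t} \<subseteq> P (Suc t)"
      proof
        fix x assume x: "x \<in> {x \<in> avoid B n. (T ^^ (n + h)) x \<in> P t}"
        have "(T ^^ (s * (n + h) + i)) x \<notin> B" if "s < Suc t" "i < n" for s i
        proof (cases s)
          case 0
          then show ?thesis using x that by (simp add: avoid_def)
        next
          case (Suc s')
          have "s * (n + h) + i = (s' * (n + h) + i) + (n + h)" using Suc by simp
          then have "(T ^^ (s * (n + h) + i)) x = (T ^^ (s' * (n + h) + i)) ((T ^^ (n + h)) x)"
            by (simp only: funpow_add_apply)
          then show ?thesis using x that Suc by (auto simp: P_def)
        qed
        then show "x \<in> P (Suc t)" using x by (simp add: P_def avoid_def)
      qed
      then have "measure m {x \<in> avoid B n. (T ^^ (n + h)) x \<in> P t} \<le> measure m (P (Suc t))"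
        by (rule finite_measure_mono) (rule Ps)
      finally show ?case .
    qed
    \<comment> \<open>the times between blocks\<close>
    define Gp where "Gp = (\<lambda>(s, i). s * (n + h) + n + i) ` ({..<Q} \<times> {..<h})"
    have cG: "card Gp \<le> Q * h"
      unfolding Gp_def by (rule order_trans[OF card_image_le]) auto
    let ?V = "{x \<in> {0..1}. \<exists>i\<in>Gp. (T ^^ i) x \<in> B}"
    have fG: "finite Gp" by (simp add: Gp_def)
    have Vs: "?V \<in> sets m"
    proof -
      have "?V = (\<Union>i\<in>Gp. {x \<in> {0..1}. (T ^^ i) x \<in> B})" by auto
      then show ?thesis using preimage_sets[OF I_sets Bs] fG by (auto intro!: sets.finite_UN)
    qed
    have mV: "measure m ?V \<le> \<delta>"
    proof -
      have "measure m ?V \<le> card Gp * (C1 * M)" unfolding M_def by (rule visit_mass[OF Bs fG])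
      also have "\<dots> \<le> (real (Q * h) + 1) * (C1 * M)"
        using cG C1_pos M0 by (intro mult_right_mono) (auto simp flip: of_nat_mult)
      also have "\<dots> \<le> \<delta>"
      proof -
        have pos: "C1 * (real (Q * h) + 1) > 0"
          using C1_pos by (intro mult_pos_pos add_nonneg_pos) auto
        have "M * (C1 * (real (Q * h) + 1)) \<le> \<delta>" using M1(2) pos by (simp add: pos_less_divide_eq less_imp_le)
        then show ?thesis by (simp only: mult_ac)
      qed
      finally show ?thesis .
    qed
    have "P Q - ?V \<subseteq> late b B N"
    proof
      fix x assume x: "x \<in> P Q - ?V"
      then have x01: "x \<in> {0..1}" by (simp add: P_def)
      have "(T ^^ i) x \<notin> B" if i: "real i * b < N" for i
      proof -
        have bpos: "b > 0" using b M0 c\<mu> unfolding M_def B_def by (meson less_le_trans mult_pos_pos)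
        have "i < Q * (n + h)"
        proof (rule ccontr)
          assume "\<not> ?thesis"
          then have "Q * n \<le> i" by (simp add: algebra_simps)
          then have "real Q * real n \<le> real i" by (metis of_nat_le_iff of_nat_mult)
          moreover have "real Q * (1 / (4 * C1 * M)) \<le> real Q * real n" using nlow by (intro mult_left_mono) auto
          ultimately have "real Q * (1 / (4 * C1 * M)) \<le> real i" by linarith
          then have "real Q * (1 / (4 * C1 * M)) * (c\<mu> * M) \<le> real i * b"
            using b c\<mu> M0 bpos unfolding M_def B_def by (intro mult_mono) auto
          moreover have "real Q * (1 / (4 * C1 * M)) * (c\<mu> * M) = real Q * c\<mu> / (4 * C1)" using M0 by simp
          moreover have "N < real Q * c\<mu> / (4 * C1)" using Q c\<mu> C1_pos by (simp add: field_simps)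
          ultimately show False using i by linarith
        qed
        define s k where "s = i div (n + h)" and "k = i mod (n + h)"
        have nh: "n + h > 0" using \<open>i < Q * (n + h)\<close> by (cases "n + h") auto
        have ik: "i = s * (n + h) + k" by (simp only: s_def k_def div_mult_mod_eq)
        have s: "s < Q" using \<open>i < Q * (n + h)\<close> unfolding s_def by (simp add: less_mult_imp_div_less)
        have k: "k < n + h" using nh by (simp add: k_def)
        show ?thesis
        proof (cases "k < n")
          case True
          then show ?thesis using x s ik by (auto simp: P_def)
        next
          case False
          then have "i = s * (n + h) + n + (k - n)" "k - n < h" using ik k by auto
          then have "i \<in> Gp" unfolding Gp_def using s by (intro image_eqI[of _ _ "(s, k - n)"]) auto
          then show ?thesis using x x01 by auto
        qed
      qed
      then show "x \<in> late b B N" using x01 by (simp add: late_def)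
    qed
    then have "measure m (P Q - ?V) \<le> measure m (late b B N)"
      by (rule finite_measure_mono) (rule late_sets[OF Bs])
    moreover have "measure m (P Q) \<le> measure m (P Q - ?V) + measure m ?V"
    proof -
      have s1: "P Q - ?V \<in> sets m" by (rule sets.Diff[OF Ps Vs])
      have "measure m (P Q) \<le> measure m ((P Q - ?V) \<union> ?V)"
        by (rule finite_measure_mono) (use sets.Un[OF s1 Vs] in auto)
      also have "\<dots> \<le> measure m (P Q - ?V) + measure m ?V" by (rule measure_Un_le[OF s1 Vs])
      finally show ?thesis .
    qed
    ultimately show ?thesis using mP[of Q] mV unfolding B_def \<delta>_def by simp
  qed
  then show thesis using that \<delta> by blast
qed

text \<open>The upper limit \<open>G\<close> of the late sets has mass at least \<open>\<delta>\<close>. If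
  \<open>(T ^^ l) x\<close> lies in \<open>G\<close>, so does \<open>x\<close>, unless its orbit meets
  \<open>y\<close> during the first \<open>l\<close> steps: small holes are not hit in these steps, and waiting
  longer makes a point only later. If the complement of \<open>G\<close> had positive mass, it would spread over
  \<open>G\<close>, contradicting this.\<close>

theorem late_infinitely_often:
  assumes y: "y \<in> {0..1}" and c\<mu>: "c\<mu> > 0" and b: "\<And>j. c\<mu> * measure m (target y j) \<le> b j"
  shows "AE x in m. \<exists>\<^sub>\<infinity>j. x \<in> late (b j) (target y j) N"
proof -
  obtain \<delta> J where \<delta>: "\<delta> > 0" "\<And>j b. j \<ge> J \<Longrightarrow> c\<mu> * measure m (target y j) \<le> b \<Longrightarrow> \<delta> \<le> measure m (late b (target y j) N)"
    by (rule late_mass[OF y c\<mu>, of N]) (rule that; assumption)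
  define X where "X j = late (b j) (target y j) N" for j
  have Xs: "X j \<in> sets m" for j unfolding X_def by (rule late_sets[OF target_sets])
  define U where "U k = (\<Union>j\<in>{k..}. X j)" for k
  have Us: "U k \<in> sets m" for k unfolding U_def by (intro sets.countable_UN'') (use Xs in auto)
  define G where "G = (\<Inter>k. U k)"
  have Gs: "G \<in> sets m" unfolding G_def by (rule sets.countable_INT) (use Us in auto)
  have "decseq U" unfolding decseq_def U_def by fastforce
  then have "(\<lambda>k. measure m (U k)) \<longlonglongrightarrow> measure m G"
    unfolding G_def by (intro finite_Lim_measure_decseq) (use Us in auto)
  moreover have "\<delta> \<le> measure m (U k)" for k
  proof -
    have "\<delta> \<le> measure m (X (max k J))" unfolding X_def by (rule \<delta>(2)) (use b in auto)
    also have "\<dots> \<le> measure m (U k)" by (rule finite_measure_mono[OF _ Us]) (unfold U_def, rule UN_upper, simp)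
    finally show ?thesis .
  qed
  ultimately have mG: "\<delta> \<le> measure m G" by (intro LIMSEQ_le_const) auto
  have inG: "x \<in> G \<longleftrightarrow> (\<exists>\<^sub>\<infinity>j. x \<in> X j)" for x
    by (auto simp: G_def U_def INFM_nat_le)
  have pull: "x \<in> G" if x: "x \<in> {0..1}" "(T ^^ l) x \<in> G" and no: "\<And>i. 1 \<le> i \<Longrightarrow> i \<le> l \<Longrightarrow> (T ^^ i) x \<noteq> y" for x l
  proof -
    have "\<forall>i\<in>{1..l}. \<forall>\<^sub>F j in sequentially. (T ^^ i) x \<notin> target y j"
    proof
      fix i assume "i \<in> {1..l}"
      then have "dist y ((T ^^ i) x) > 0" using no[of i] by auto
      then obtain k where k: "inverse (real (Suc k)) < dist y ((T ^^ i) x)" using reals_Archimedean by blast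
      have "(T ^^ i) x \<notin> target y j" if "j \<ge> k" for j
      proof -
        have "1 / (real j + 1) \<le> 1 / (real k + 1)" using that by (intro divide_left_mono) auto
        also have "\<dots> < dist y ((T ^^ i) x)" using k by (simp add: inverse_eq_divide add.commute)
        finally show ?thesis by (simp add: target_def)
      qed
      then show "\<forall>\<^sub>F j in sequentially. (T ^^ i) x \<notin> target y j" by (auto simp: eventually_sequentially)
    qed
    then have "\<forall>\<^sub>F j in sequentially. \<forall>i\<in>{1..l}. (T ^^ i) x \<notin> target y j"
      by (simp add: eventually_ball_finite)
    then have ev: "MOST j. \<forall>i\<in>{1..l}. (T ^^ i) x \<notin> target y j" by (simp add: cofinite_eq_sequentially)
    have "\<exists>\<^sub>\<infinity>j. (T ^^ l) x \<in> X j" using x(2) inG by blast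
    then have "\<exists>\<^sub>\<infinity>j. (T ^^ l) x \<in> X j \<and> (\<forall>i\<in>{1..l}. (T ^^ i) x \<notin> target y j)"
      using ev by (rule INFM_conjI)
    then have "\<exists>\<^sub>\<infinity>j. x \<in> X j"
    proof (rule INFM_mono)
      fix j assume j: "(T ^^ l) x \<in> X j \<and> (\<forall>i\<in>{1..l}. (T ^^ i) x \<notin> target y j)"
      have bj: "b j \<ge> 0" using b[of j] c\<mu> by (meson less_imp_le measure_nonneg mult_nonneg_nonneg order_trans)
      have "(T ^^ i) x \<notin> target y j" if i: "1 \<le> i" "real i * b j < N" for i
      proof (cases "i \<le> l")
        case True
        then show ?thesis using j i by auto
      next
        case False
        have "real (i - l) * b j \<le> real i * b j" using bj by (intro mult_right_mono) auto
        then have "(T ^^ (i - l)) ((T ^^ l) x) \<notin> target y j"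
          using j i False by (auto simp: X_def late_def)
        then show ?thesis using False funpow_add_apply[of "i - l" l x] by simp
      qed
      then show "x \<in> X j" using x(1) by (simp add: X_def late_def)
    qed
    then show ?thesis using inG by blast
  qed
  have "measure m ({0..1} - G) = 0"
  proof (rule ccontr)
    assume "measure m ({0..1} - G) \<noteq> 0"
    then have pos: "measure m ({0..1} - G) > 0" using measure_nonneg[of m "{0..1} - G"] by linarith
    obtain c where c: "c > 0" "\<And>A. A \<in> sets m \<Longrightarrow> \<exists>l. c * measure m A \<le> measure m {x \<in> {0..1} - G. (T ^^ l) x \<in> A}"
      by (rule positive_mass_spreads[OF sets.Diff[OF I_sets Gs] pos]) (rule that; assumption)
    obtain l where l: "c * measure m G \<le> measure m {x \<in> {0..1} - G. (T ^^ l) x \<in> G}" using c(2)[OF Gs] by blast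
    have sub: "{x \<in> {0..1} - G. (T ^^ l) x \<in> G} \<subseteq> (\<Union>i\<in>{1..l}. {x \<in> {0..1}. (T ^^ i) x = y})"
      using pull by fastforce
    have fin: "finite (\<Union>i\<in>{1..l}. {x \<in> {0..1}. (T ^^ i) x = y})" using finite_fibre by blast
    have "measure m {x \<in> {0..1} - G. (T ^^ l) x \<in> G} = 0"
      by (rule measure_finite_set[OF finite_subset[OF sub fin]]) auto
    moreover have "c * measure m G > 0" using c(1) mG \<delta>(1) by simp
    ultimately show False using l by linarith
  qed
  then have "{0..1} - G \<in> null_sets m"
    using I_sets Gs by (auto simp: null_sets_def emeasure_eq_measure)
  then have "AE x in m. x \<notin> {0..1} - G" by (rule AE_not_in)
  then show ?thesis
    using AE_space by eventually_elim (use inG in \<open>auto simp: X_def space_m\<close>)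
qed

lemma hitting_time_product_ge:
  assumes "x \<in> late b U N" "b > 0"
  shows "ennreal N \<le> ennreal_of_enat (hitting_time T U x) * ennreal b"
proof (cases "{enat k | k. k \<ge> 1 \<and> (T ^^ k) x \<in> U} = {}")
  case True
  then have "hitting_time T U x = \<infinity>" unfolding hitting_time_def by (simp only: Inf_enat_def simp_thms if_True)
  then show ?thesis using assms(2) by (simp add: ennreal_top_mult)
next
  case False
  then obtain e where e: "e \<in> {enat k | k. k \<ge> 1 \<and> (T ^^ k) x \<in> U}" by (meson ex_in_conv)
  have "hitting_time T U x \<in> {enat k | k. k \<ge> 1 \<and> (T ^^ k) x \<in> U}"
    unfolding hitting_time_def by (rule wellorder_InfI[OF e])
  then obtain k where k: "hitting_time T U x = enat k" "k \<ge> 1" "(T ^^ k) x \<in> U" by blast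
  have "\<forall>i. 1 \<le> i \<and> real i * b < N \<longrightarrow> (T ^^ i) x \<notin> U" using assms(1) unfolding late_def by blast
  then have "\<not> real k * b < N" using k(2,3) by blast
  then have "N \<le> real k * b" by (simp only: not_less)
  then have "ennreal N \<le> ennreal (real k * b)" by (rule ennreal_leI)
  also have "ennreal (real k * b) = ennreal (real k) * ennreal b" using assms(2) by (intro ennreal_mult) auto
  finally show ?thesis by (simp only: k(1) ennreal_of_enat_enat ennreal_of_nat_eq_real_of_nat)
qed

text \<open>Lateness for every natural number \<open>N\<close> at once, transferred from \<open>m\<close> to
  \<open>\<mu>\<close> by absolute continuity. Comparison with \<open>m\<close> shows that the holes have
  positive \<open>\<mu>\<close>-measure; without this an infinite hitting time would contribute \<open>0\<close>
  to the product.\<close>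

theorem hitting_time_limsup:
  assumes \<mu>: "prob_space \<mu>" "sets \<mu> = sets m" "distr \<mu> \<mu> T = \<mu>" "T \<in> measurable \<mu> \<mu>"
    and ac: "absolutely_continuous m \<mu>" and y: "y \<in> {0..1}"
  shows "AE x in \<mu>. Limsup (at_right 0) (\<lambda>r. ennreal_of_enat (hitting_time T (ball y r \<inter> {0..1}) x)
      * emeasure \<mu> (ball y r \<inter> {0..1})) = \<infinity>"
proof -
  interpret M: prob_space \<mu> by (rule \<mu>(1))
  obtain c where c: "c > 0" "\<And>A. A \<in> sets m \<Longrightarrow> c * measure m A \<le> measure \<mu> A"
    by (rule invariant_measure_dominates[OF \<mu> ac]) (rule that; assumption)
  define b where "b j = measure \<mu> (target y j)" for j
  have b: "c * measure m (target y j) \<le> b j" for j unfolding b_def by (rule c(2)[OF target_sets])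
  have bpos: "b j > 0" for j
    using b[of j] mult_pos_pos[OF c(1) target_mass_pos[OF y, of j]] by linarith
  have "AE x in m. \<exists>\<^sub>\<infinity>j. x \<in> late (b j) (target y j) (real N)" for N :: nat
    by (rule late_infinitely_often[OF y c(1) b])
  then have "AE x in m. \<forall>N::nat. \<exists>\<^sub>\<infinity>j. x \<in> late (b j) (target y j) (real N)"
    by (simp add: AE_all_countable)
  then have "AE x in \<mu>. \<forall>N::nat. \<exists>\<^sub>\<infinity>j. x \<in> late (b j) (target y j) (real N)"
    using absolutely_continuous_AE[OF \<mu>(2) ac] by blast
  then show ?thesis
  proof eventually_elim
    case (elim x)
    define f where "f r = ennreal_of_enat (hitting_time T (ball y r \<inter> {0..1}) x) * emeasure \<mu> (ball y r \<inter> {0..1})" for r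
    have f: "ennreal N \<le> f (1 / (real j + 1))" if "x \<in> late (b j) (target y j) N" for j N
      using hitting_time_product_ge[OF that bpos] by (simp add: f_def b_def target_def M.emeasure_eq_measure)
    have "ennreal (real N) \<le> Limsup (at_right 0) f" for N :: nat
      unfolding Limsup_def
    proof (rule INF_greatest)
      fix P :: "real \<Rightarrow> bool" assume "P \<in> {P. eventually P (at_right 0)}"
      then obtain d where d: "d > 0" "\<And>r. 0 < r \<Longrightarrow> r < d \<Longrightarrow> P r"
        by (auto simp: eventually_at_right_field)
      obtain J where J: "inverse (real (Suc J)) < d" using reals_Archimedean d(1) by blast
      obtain j where j: "j > J" "x \<in> late (b j) (target y j) (real N)"
        using elim by (auto simp: INFM_nat)
      have "1 / (real j + 1) \<le> 1 / (real J + 1)" using j(1) by (intro divide_left_mono) auto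
      then have "1 / (real j + 1) < d" using J by (simp add: inverse_eq_divide add.commute)
      then have "P (1 / (real j + 1))" by (intro d(2)) auto
      then show "ennreal (real N) \<le> (SUP r\<in>{r. P r}. f r)"
        by (intro SUP_upper2[where f = f, OF _ f[OF j(2)]]) auto
    qed
    then have "\<not> Limsup (at_right 0) f < \<infinity>"
      using ennreal_Ex_less_of_nat by (metis ennreal_of_nat_eq_real_of_nat infinity_ennreal_def not_less)
    then show ?case unfolding f_def by (simp add: less_top[symmetric])
  qed
qed

end

section \<open>Non-flat critical points\<close>

lemma C3_on_C1:
  assumes "C3_on S f"
  obtains f1 where "\<And>x. x \<in> S \<Longrightarrow> (f has_real_derivative f1 x) (at x within S)" "continuous_on S f1"
proof -
  obtain f1 f2 f3 where f: "\<forall>x\<in>S. (f has_real_derivative f1 x) (at x within S)"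
    "\<forall>x\<in>S. (f1 has_real_derivative f2 x) (at x within S)"
    using assms unfolding C3_on_def by blast
  have "continuous_on S f1" using f(2) by (intro DERIV_continuous_on) auto
  then show thesis using that f(1) by blast
qed

lemma deriv_ivl_eq:
  assumes "(f has_real_derivative d) (at x within {0..1})" "x \<in> {0..1}"
  shows "deriv_ivl f x = d"
  using assms vector_derivative_within_closed_interval[of 0 1 x f d]
  by (simp add: deriv_ivl_def has_real_derivative_iff_has_vector_derivative)

lemma C3_on_locally_lipschitz:
  assumes "C3_on U f" "open U" "c \<in> U"
  obtains k \<epsilon> where "k \<ge> 1" "\<epsilon> > 0" "ball c \<epsilon> \<subseteq> U"
    "\<And>x y. x \<in> ball c \<epsilon> \<Longrightarrow> y \<in> ball c \<epsilon> \<Longrightarrow> \<bar>f x - f y\<bar> \<le> k * \<bar>x - y\<bar>"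
proof -
  obtain f1 where f1: "\<And>x. x \<in> U \<Longrightarrow> (f has_real_derivative f1 x) (at x within U)" "continuous_on U f1"
    by (rule C3_on_C1[OF assms(1)]) (rule that; assumption)
  obtain e1 where e1: "e1 > 0" "ball c e1 \<subseteq> U" using assms(2,3) open_contains_ball by blast
  obtain e2 where e2: "e2 > 0" "\<And>x. x \<in> U \<Longrightarrow> dist x c < e2 \<Longrightarrow> dist (f1 x) (f1 c) < 1"
    using f1(2) assms(3) unfolding continuous_on_iff by (meson zero_less_one)
  define \<epsilon> where "\<epsilon> = min e1 e2"
  have sub: "ball c \<epsilon> \<subseteq> U" using e1(2) by (auto simp: \<epsilon>_def)
  have "\<bar>f x - f y\<bar> \<le> (\<bar>f1 c\<bar> + 1) * \<bar>x - y\<bar>" if xy: "x \<in> ball c \<epsilon>" "y \<in> ball c \<epsilon>" for x y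
  proof -
    have "norm (f x - f y) \<le> (\<bar>f1 c\<bar> + 1) * norm (x - y)"
    proof (rule field_differentiable_bound[OF convex_ball _ _ xy, where f' = f1])
      fix z assume z: "z \<in> ball c \<epsilon>"
      show "(f has_real_derivative f1 z) (at z within ball c \<epsilon>)"
        using f1(1)[of z] z sub by (blast intro: has_field_derivative_subset)
      have "dist (f1 z) (f1 c) < 1" using z sub by (intro e2(2)) (auto simp: \<epsilon>_def dist_commute)
      then show "norm (f1 z) \<le> \<bar>f1 c\<bar> + 1" by (simp add: dist_real_def)
    qed
    then show ?thesis by simp
  qed
  then show thesis using that[of "\<bar>f1 c\<bar> + 1" \<epsilon>] sub e1(1) e2(1) by (auto simp: \<epsilon>_def)
qed

lemma C3_diffeo_bilipschitz:
  assumes "C3_diffeo U V f" "c \<in> U"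
  obtains k \<epsilon> where "k \<ge> 1" "\<epsilon> > 0"
    "\<And>x y. x \<in> ball c \<epsilon> \<Longrightarrow> y \<in> ball c \<epsilon> \<Longrightarrow> \<bar>f x - f y\<bar> \<le> k * \<bar>x - y\<bar> \<and> \<bar>x - y\<bar> \<le> k * \<bar>f x - f y\<bar>"
proof -
  obtain g where UV: "open U" "open V" "C3_on U f" "f ` U = V" and g: "C3_on V g" "\<And>x. x \<in> U \<Longrightarrow> g (f x) = x"
    using assms(1) unfolding C3_diffeo_def by blast
  obtain k1 e1 where k1: "k1 \<ge> 1" "e1 > 0" "ball c e1 \<subseteq> U"
    "\<And>x y. x \<in> ball c e1 \<Longrightarrow> y \<in> ball c e1 \<Longrightarrow> \<bar>f x - f y\<bar> \<le> k1 * \<bar>x - y\<bar>"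
    by (rule C3_on_locally_lipschitz[OF UV(3,1) assms(2)]) (rule that; assumption)
  have fc: "f c \<in> V" using UV(4) assms(2) by blast
  obtain k2 e2 where k2: "k2 \<ge> 1" "e2 > 0" "ball (f c) e2 \<subseteq> V"
    "\<And>x y. x \<in> ball (f c) e2 \<Longrightarrow> y \<in> ball (f c) e2 \<Longrightarrow> \<bar>g x - g y\<bar> \<le> k2 * \<bar>x - y\<bar>"
    by (rule C3_on_locally_lipschitz[OF g(1) UV(2) fc]) (rule that; assumption)
  define \<epsilon> where "\<epsilon> = min e1 (e2 / k1)"
  have \<epsilon>: "\<epsilon> > 0" using k1 k2 by (simp add: \<epsilon>_def)
  have near: "f x \<in> ball (f c) e2" if "x \<in> ball c \<epsilon>" for x
  proof -
    have "\<bar>f c - f x\<bar> \<le> k1 * \<bar>c - x\<bar>" using that k1(2) by (intro k1(4)) (auto simp: \<epsilon>_def)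
    also have "\<dots> < e2" using that k1(1) by (simp add: \<epsilon>_def dist_real_def field_simps)
    finally show ?thesis by (simp add: dist_real_def)
  qed
  have "\<bar>f x - f y\<bar> \<le> max k1 k2 * \<bar>x - y\<bar> \<and> \<bar>x - y\<bar> \<le> max k1 k2 * \<bar>f x - f y\<bar>"
    if xy: "x \<in> ball c \<epsilon>" "y \<in> ball c \<epsilon>" for x y
  proof
    have in1: "x \<in> ball c e1" "y \<in> ball c e1" using xy by (auto simp: \<epsilon>_def)
    have "\<bar>f x - f y\<bar> \<le> k1 * \<bar>x - y\<bar>" using in1 by (rule k1(4))
    also have "\<dots> \<le> max k1 k2 * \<bar>x - y\<bar>" by (intro mult_right_mono) auto
    finally show "\<bar>f x - f y\<bar> \<le> max k1 k2 * \<bar>x - y\<bar>" .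
    have "g (f x) = x" "g (f y) = y" using g(2) in1 k1(3) by blast+
    then have "\<bar>x - y\<bar> \<le> k2 * \<bar>f x - f y\<bar>" using k2(4)[OF near[OF xy(1)] near[OF xy(2)]] by simp
    also have "\<dots> \<le> max k1 k2 * \<bar>f x - f y\<bar>" by (intro mult_right_mono) auto
    finally show "\<bar>x - y\<bar> \<le> max k1 k2 * \<bar>f x - f y\<bar>" .
  qed
  then show thesis using that[of "max k1 k2" \<epsilon>] k1(1) \<epsilon> by auto
qed

text \<open>The difference \<open>t powr l - s powr l\<close> is comparable with \<open>t powr (l - 1) * (t -
  s)\<close> up to the factor \<open>l\<close>.\<close>

lemma powr_difference_bounds:
  fixes l :: real
  assumes "l > 1" "0 \<le> s" "s \<le> t"
  shows "(t - s) * t powr (l - 1) \<le> t powr l - s powr l"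
    and "t powr l - s powr l \<le> l * t powr (l - 1) * (t - s)"
proof -
  have split: "x powr l = x * x powr (l - 1)" if "x \<ge> 0" for x :: real
    using that powr_add[of x 1 "l - 1"] by (cases "x = 0") auto
  have "s * s powr (l - 1) \<le> s * t powr (l - 1)"
    using assms by (intro mult_left_mono powr_mono2) auto
  then show "(t - s) * t powr (l - 1) \<le> t powr l - s powr l"
    using assms split[of s] split[of t] by (simp add: algebra_simps)
  show "t powr l - s powr l \<le> l * t powr (l - 1) * (t - s)"
  proof (cases "s = 0")
    case True
    have "1 * (t * t powr (l - 1)) \<le> l * (t * t powr (l - 1))"
      using assms by (intro mult_right_mono) auto
    then show ?thesis using True assms split[of t] by (simp add: mult_ac)
  next
    case False
    have "norm (t powr l - s powr l) \<le> l * t powr (l - 1) * norm (t - s)"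
    proof (rule field_differentiable_bound[where S = "{s..t}" and f' = "\<lambda>x. l * x powr (l - 1)"])
      fix x assume x: "x \<in> {s..t}"
      then have "x > 0" using False assms by auto
      then have "((\<lambda>x. x powr l) has_real_derivative l * x powr (l - 1)) (at x)"
        by (rule has_real_derivative_powr)
      then show "((\<lambda>x. x powr l) has_real_derivative l * x powr (l - 1)) (at x within {s..t})"
        by (rule has_field_derivative_at_within)
      show "norm (l * x powr (l - 1)) \<le> l * t powr (l - 1)"
        using x \<open>x > 0\<close> assms by (simp add: abs_mult powr_mono2)
    qed (use assms in auto)
    then show ?thesis using assms by simp
  qed
qed

lemma abs_derivative_le:
  fixes f :: "real \<Rightarrow> real"
  assumes "(f has_real_derivative D) (at e within {a..b})" "a < b" "e \<in> {a..b}"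
    and "\<forall>\<^sub>F y in at e within {a..b}. \<bar>f y - f e\<bar> \<le> C * \<bar>y - e\<bar>"
  shows "\<bar>D\<bar> \<le> C"
proof (rule tendsto_upperbound)
  show "((\<lambda>y. \<bar>(f y - f e) / (y - e)\<bar>) \<longlongrightarrow> \<bar>D\<bar>) (at e within {a..b})"
    using assms(1) by (intro tendsto_rabs) (simp add: has_field_derivative_iff)
  show "\<forall>\<^sub>F y in at e within {a..b}. \<bar>(f y - f e) / (y - e)\<bar> \<le> C"
    using assms(4) eventually_neq_at_within[of e]
    by eventually_elim (simp add: abs_divide divide_le_eq)
  show "at e within {a..b} \<noteq> bot"
    using assms(2,3) by (simp add: trivial_limit_within islimpt_Icc)
qed

text \<open>In the coordinates \<open>\<phi>\<close> and \<open>\<eta>\<close>, which are bi-Lipschitz near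
  \<open>c\<close> and \<open>T c\<close>, the absolute value of the map is \<open>\<bar>x\<bar> powr l\<close>.
  Let \<open>M\<close> be the maximum of \<open>\<bar>\<phi>\<bar>\<close> on the interval. The derivative is at
  most of order \<open>M powr (l - 1)\<close>. The maximum is attained at a point \<open>q\<close>, and the end
  point \<open>p\<close> farther from \<open>q\<close> is at least half the length away. If
  \<open>\<phi>\<close> has the same sign at both, the values of \<open>T\<close> there differ by the order of
  \<open>M powr (l - 1)\<close> times the length; otherwise \<open>\<phi>\<close> has a zero in between, and it
  takes over the role of \<open>p\<close>.\<close>

lemma nonflat_at_growth:
  assumes deriv: "\<And>x. x \<in> {0..1} \<Longrightarrow> (T has_real_derivative T1 x) (at x within {0..1})"
    and c: "c \<in> {0..1}" and nf: "nonflat_at T c"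
  shows "\<exists>\<delta>>0. \<exists>K. \<forall>a b e. 0 \<le> a \<and> a \<le> e \<and> e \<le> b \<and> b \<le> 1 \<and> {a..b} \<subseteq> ball c \<delta> \<longrightarrow>
        (\<exists>u\<in>{a..b}. \<exists>v\<in>{a..b}. (b - a) * \<bar>T1 e\<bar> \<le> K * \<bar>T u - T v\<bar>)"
proof -
  obtain l U U' V V' \<phi> \<eta> where l: "l > 1"
    and \<phi>: "C3_diffeo U U' \<phi>" "c \<in> U" "\<phi> c = 0"
    and \<eta>: "C3_diffeo V V' \<eta>" "T c \<in> V" "\<eta> (T c) = 0"
    and ev: "\<forall>\<^sub>F x in at c within {0..1}. \<bar>\<eta> (T x)\<bar> = \<bar>\<phi> x\<bar> powr l"
    using nf unfolding nonflat_at_def by blast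
  obtain k e1 where k: "k \<ge> 1" "e1 > 0" "\<And>x y. x \<in> ball c e1 \<Longrightarrow> y \<in> ball c e1 \<Longrightarrow>
      \<bar>\<phi> x - \<phi> y\<bar> \<le> k * \<bar>x - y\<bar> \<and> \<bar>x - y\<bar> \<le> k * \<bar>\<phi> x - \<phi> y\<bar>"
    by (rule C3_diffeo_bilipschitz[OF \<phi>(1,2)]) (rule that; assumption)
  obtain k' e2 where k': "k' \<ge> 1" "e2 > 0" "\<And>x y. x \<in> ball (T c) e2 \<Longrightarrow> y \<in> ball (T c) e2 \<Longrightarrow>
      \<bar>\<eta> x - \<eta> y\<bar> \<le> k' * \<bar>x - y\<bar> \<and> \<bar>x - y\<bar> \<le> k' * \<bar>\<eta> x - \<eta> y\<bar>"
    by (rule C3_diffeo_bilipschitz[OF \<eta>(1,2)]) (rule that; assumption)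
  have Tcont: "continuous_on {0..1} T" using deriv by (intro DERIV_continuous_on) auto
  obtain e3 where e3: "e3 > 0" "\<And>x. x \<in> {0..1} \<Longrightarrow> dist x c < e3 \<Longrightarrow> dist (T x) (T c) < e2"
    using Tcont c k'(2) unfolding continuous_on_iff by meson
  obtain e4 where e4: "e4 > 0" "\<And>x. x \<in> {0..1} \<Longrightarrow> x \<noteq> c \<Longrightarrow> dist x c < e4 \<Longrightarrow> \<bar>\<eta> (T x)\<bar> = \<bar>\<phi> x\<bar> powr l"
    using ev unfolding eventually_at by blast
  define \<delta> where "\<delta> = min (min e1 e3) e4"
  have \<delta>: "\<delta> > 0" using k(2) e3(1) e4(1) by (simp add: \<delta>_def)
  have pw: "\<bar>\<eta> (T x)\<bar> = \<bar>\<phi> x\<bar> powr l" if "x \<in> {0..1}" "x \<in> ball c \<delta>" for x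
    using that e4(2)[of x] \<phi>(3) \<eta>(3) by (cases "x = c") (auto simp: \<delta>_def dist_commute)
  have bi: "\<bar>\<phi> x - \<phi> y\<bar> \<le> k * \<bar>x - y\<bar>" "\<bar>x - y\<bar> \<le> k * \<bar>\<phi> x - \<phi> y\<bar>"
    if "x \<in> ball c \<delta>" "y \<in> ball c \<delta>" for x y
    using k(3)[of x y] that by (auto simp: \<delta>_def)
  have bi': "\<bar>\<eta> (T x) - \<eta> (T y)\<bar> \<le> k' * \<bar>T x - T y\<bar>" "\<bar>T x - T y\<bar> \<le> k' * \<bar>\<eta> (T x) - \<eta> (T y)\<bar>"
    if "x \<in> {0..1}" "x \<in> ball c \<delta>" "y \<in> {0..1}" "y \<in> ball c \<delta>" for x y
  proof -
    have "T x \<in> ball (T c) e2" "T y \<in> ball (T c) e2"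
      using e3(2)[of x] e3(2)[of y] that by (auto simp: \<delta>_def dist_commute)
    then show "\<bar>\<eta> (T x) - \<eta> (T y)\<bar> \<le> k' * \<bar>T x - T y\<bar>" "\<bar>T x - T y\<bar> \<le> k' * \<bar>\<eta> (T x) - \<eta> (T y)\<bar>"
      using k'(3) by auto
  qed
  define C where "C = k' * (l * k)"
  have C0: "C \<ge> 0" using k(1) k'(1) l by (simp add: C_def)
  have main: "\<exists>u\<in>{a..b}. \<exists>v\<in>{a..b}. (b - a) * \<bar>T1 e\<bar> \<le> C * (4 * k * k') * \<bar>T u - T v\<bar>"
    if ab: "0 \<le> a" "a \<le> e" "e \<le> b" "b \<le> 1" and nb: "{a..b} \<subseteq> ball c \<delta>" for a b e
  proof (cases "a = b")
    case True
    then show ?thesis using ab by (intro bexI[of _ a]) auto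
  next
    case False
    then have lt: "a < b" using ab by simp
    have eab: "e \<in> {a..b}" using ab by simp
    have I: "x \<in> {0..1}" "x \<in> ball c \<delta>" if "x \<in> {a..b}" for x using that ab nb by auto
    note pw = pw[OF I] and bi = bi[OF I(2) I(2)] and bi' = bi'[OF I I]
    have \<phi>cont: "continuous_on {a..b} \<phi>"
    proof (rule continuous_on_subset[OF lipschitz_on_continuous_on])
      show "k-lipschitz_on {a..b} \<phi>"
        using bi(1) k(1) by (intro lipschitz_onI) (auto simp: dist_real_def)
    qed simp
    then have "continuous_on {a..b} (\<lambda>x. \<bar>\<phi> x\<bar>)" by (intro continuous_intros)
    then obtain q where q: "q \<in> {a..b}" "\<And>x. x \<in> {a..b} \<Longrightarrow> \<bar>\<phi> x\<bar> \<le> \<bar>\<phi> q\<bar>"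
      using continuous_attains_sup[of "{a..b}" "\<lambda>x. \<bar>\<phi> x\<bar>"] lt by auto
    define M where "M = \<bar>\<phi> q\<bar>"
    define p where "p = (if q - a \<ge> b - q then a else b)"
    have p: "p \<in> {a..b}" "b - a \<le> 2 * \<bar>q - p\<bar>" using q(1) lt by (auto simp: p_def)
    have M0: "M \<ge> 0" and Mle: "\<And>x. x \<in> {a..b} \<Longrightarrow> \<bar>\<phi> x\<bar> \<le> M" using q(2) by (auto simp: M_def)
    \<comment> \<open>a Lipschitz bound at \<open>e\<close> bounds the derivative\<close>
    have upper: "\<bar>T1 e\<bar> \<le> C * M powr (l - 1)"
    proof (rule abs_derivative_le[OF _ lt eab])
      show der: "(T has_real_derivative T1 e) (at e within {a..b})"
        using deriv[of e] I(1)[OF eab] ab by (auto intro: has_field_derivative_subset)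
      \<comment> \<open>the coordinate change only controls absolute values, so \<open>\<eta>\<close> must not change sign between the two points\<close>
      have lip: "\<bar>T y - T e\<bar> \<le> C * M powr (l - 1) * \<bar>y - e\<bar>"
        if y: "y \<in> {a..b}" and same: "\<bar>\<eta> (T y) - \<eta> (T e)\<bar> = \<bar>\<bar>\<eta> (T y)\<bar> - \<bar>\<eta> (T e)\<bar>\<bar>" for y
      proof -
        define s t where "s = min \<bar>\<phi> y\<bar> \<bar>\<phi> e\<bar>" and "t = max \<bar>\<phi> y\<bar> \<bar>\<phi> e\<bar>"
        have st: "0 \<le> s" "s \<le> t" "t \<le> M" using Mle[OF y] Mle[OF eab] by (auto simp: s_def t_def)
        have mono: "s powr l \<le> t powr l" using st l by (intro powr_mono2) auto
        have "\<bar>\<bar>\<eta> (T y)\<bar> - \<bar>\<eta> (T e)\<bar>\<bar> = t powr l - s powr l"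
          using pw[OF y y] pw[OF eab eab] mono by (auto simp: s_def t_def min_def max_def split: if_splits)
        also have "\<dots> \<le> l * t powr (l - 1) * (t - s)" by (rule powr_difference_bounds(2)[OF l st(1,2)])
        also have "\<dots> \<le> l * M powr (l - 1) * (k * \<bar>y - e\<bar>)"
        proof (rule mult_mono)
          show "l * t powr (l - 1) \<le> l * M powr (l - 1)"
            using st l by (intro mult_left_mono powr_mono2) auto
          have "t - s \<le> \<bar>\<phi> y - \<phi> e\<bar>" by (auto simp: s_def t_def)
          then show "t - s \<le> k * \<bar>y - e\<bar>" using bi(1)[OF y eab] by linarith
        qed (use st l in auto)
        finally have "\<bar>\<eta> (T y) - \<eta> (T e)\<bar> \<le> l * M powr (l - 1) * (k * \<bar>y - e\<bar>)" using same by simp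
        then have "k' * \<bar>\<eta> (T y) - \<eta> (T e)\<bar> \<le> k' * (l * M powr (l - 1) * (k * \<bar>y - e\<bar>))"
          using k'(1) by (intro mult_left_mono) auto
        then have "\<bar>T y - T e\<bar> \<le> k' * (l * M powr (l - 1) * (k * \<bar>y - e\<bar>))"
          using bi'(2)[OF y y eab eab] by linarith
        then show ?thesis by (simp only: C_def mult_ac)
      qed
      show "\<forall>\<^sub>F y in at e within {a..b}. \<bar>T y - T e\<bar> \<le> C * M powr (l - 1) * \<bar>y - e\<bar>"
      proof (cases "\<eta> (T e) = 0")
        case True
        show ?thesis
          unfolding eventually_at using lip True by (intro exI[of _ 1]) auto
      next
        case False
        have "(T \<longlongrightarrow> T e) (at e within {a..b})"
          using der DERIV_continuous continuous_within by blast
        moreover have "\<bar>\<eta> (T e)\<bar> / k' > 0" using False k'(1) by simp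
        ultimately have "\<forall>\<^sub>F y in at e within {a..b}. dist (T y) (T e) < \<bar>\<eta> (T e)\<bar> / k'"
          by (rule tendstoD)
        moreover have "\<forall>\<^sub>F y in at e within {a..b}. y \<in> {a..b}"
          by (simp add: eventually_at_filter)
        ultimately show ?thesis
        proof eventually_elim
          case (elim y)
          have "k' * \<bar>T y - T e\<bar> < \<bar>\<eta> (T e)\<bar>" using elim(1) k'(1) by (simp add: dist_real_def field_simps)
          then have "\<bar>\<eta> (T y) - \<eta> (T e)\<bar> < \<bar>\<eta> (T e)\<bar>" using bi'(1)[OF elim(2) elim(2) eab eab] by linarith
          then have "\<bar>\<eta> (T y) - \<eta> (T e)\<bar> = \<bar>\<bar>\<eta> (T y)\<bar> - \<bar>\<eta> (T e)\<bar>\<bar>" by (smt (verit))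
          then show ?case by (rule lip[OF elim(2)])
        qed
      qed
    qed
    obtain u v where uv: "u \<in> {a..b}" "v \<in> {a..b}" "(b - a) * M powr (l - 1) \<le> 4 * k * k' * \<bar>T u - T v\<bar>"
    proof (cases "\<phi> p * \<phi> q \<ge> 0")
      case True
      have "b - a \<le> 2 * (k * \<bar>\<phi> q - \<phi> p\<bar>)" using p(2) bi(2)[OF q(1) p(1)] by (smt (verit))
      also have "\<bar>\<phi> q - \<phi> p\<bar> = M - \<bar>\<phi> p\<bar>"
        using True Mle[OF p(1)] unfolding M_def by (auto simp: zero_le_mult_iff)
      finally have "(b - a) * M powr (l - 1) \<le> 2 * (k * (M - \<bar>\<phi> p\<bar>)) * M powr (l - 1)"
        by (intro mult_right_mono) auto
      also have "\<dots> = 2 * k * ((M - \<bar>\<phi> p\<bar>) * M powr (l - 1))" by simp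
      also have "\<dots> \<le> 2 * k * (k' * \<bar>T q - T p\<bar>)"
      proof (rule mult_left_mono)
        have "(M - \<bar>\<phi> p\<bar>) * M powr (l - 1) \<le> M powr l - \<bar>\<phi> p\<bar> powr l"
          by (rule powr_difference_bounds(1)[OF l _ Mle[OF p(1)]]) simp
        also have "\<dots> = \<bar>\<eta> (T q)\<bar> - \<bar>\<eta> (T p)\<bar>" using pw[OF q(1) q(1)] pw[OF p(1) p(1)] by (simp add: M_def)
        also have "\<dots> \<le> \<bar>\<eta> (T q) - \<eta> (T p)\<bar>" by simp
        also have "\<dots> \<le> k' * \<bar>T q - T p\<bar>" by (rule bi'(1)[OF q(1) q(1) p(1) p(1)])
        finally show "(M - \<bar>\<phi> p\<bar>) * M powr (l - 1) \<le> k' * \<bar>T q - T p\<bar>" .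
      qed (use k in simp)
      also have "\<dots> \<le> 4 * k * k' * \<bar>T q - T p\<bar>" using k(1) k'(1) by simp
      finally show thesis using that[OF q(1) p(1)] by blast
    next
      case False
      have "\<exists>z\<in>{a..b}. \<phi> z = 0"
      proof -
        have "connected (\<phi> ` {a..b})" by (rule connected_continuous_image[OF \<phi>cont]) simp
        moreover have "\<phi> p \<le> 0 \<and> 0 \<le> \<phi> q \<or> \<phi> q \<le> 0 \<and> 0 \<le> \<phi> p" using False by (auto simp: not_le mult_less_0_iff)
        ultimately have "0 \<in> \<phi> ` {a..b}"
          using p(1) q(1) by (meson connectedD_interval image_eqI)
        then show ?thesis by auto
      qed
      then obtain z where z: "z \<in> {a..b}" "\<phi> z = 0" by blast
      have "b - a \<le> 2 * (k * \<bar>\<phi> q - \<phi> p\<bar>)" using p(2) bi(2)[OF q(1) p(1)] by (smt (verit))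
      also have "\<dots> \<le> 2 * (k * (2 * M))"
        using Mle[OF p(1)] k(1) unfolding M_def by (intro mult_left_mono) auto
      finally have "(b - a) * M powr (l - 1) \<le> 2 * (k * (2 * M)) * M powr (l - 1)"
        by (intro mult_right_mono) auto
      also have "\<dots> = 4 * k * ((M - 0) * M powr (l - 1))" by simp
      also have "\<dots> \<le> 4 * k * (k' * \<bar>T q - T z\<bar>)"
      proof (rule mult_left_mono)
        have "(M - 0) * M powr (l - 1) \<le> M powr l - 0 powr l"
          by (rule powr_difference_bounds(1)[OF l _ M0]) simp
        also have "\<dots> = \<bar>\<eta> (T q)\<bar> - \<bar>\<eta> (T z)\<bar>" using pw[OF q(1) q(1)] pw[OF z(1) z(1)] z(2) by (simp add: M_def)
        also have "\<dots> \<le> \<bar>\<eta> (T q) - \<eta> (T z)\<bar>" by simp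
        also have "\<dots> \<le> k' * \<bar>T q - T z\<bar>" by (rule bi'(1)[OF q(1) q(1) z(1) z(1)])
        finally show "(M - 0) * M powr (l - 1) \<le> k' * \<bar>T q - T z\<bar>" .
      qed (use k in simp)
      finally show thesis using that[OF q(1) z(1)] by (simp add: mult_ac)
    qed
    have "(b - a) * \<bar>T1 e\<bar> \<le> (b - a) * (C * M powr (l - 1))"
      using upper lt by (intro mult_left_mono) auto
    also have "\<dots> = C * ((b - a) * M powr (l - 1))" by simp
    also have "\<dots> \<le> C * (4 * k * k' * \<bar>T u - T v\<bar>)" by (rule mult_left_mono[OF uv(3) C0])
    finally have "(b - a) * \<bar>T1 e\<bar> \<le> C * (4 * k * k') * \<bar>T u - T v\<bar>" by (simp only: mult.assoc)
    then show ?thesis using uv(1,2) by blast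
  qed
  show ?thesis
    by (rule exI[of _ \<delta>], rule conjI[OF \<delta>], rule exI[of _ "C * (4 * k * k')"]) (use main in blast)
qed

section \<open>Collet--Eckmann maps with Hoelder potentials\<close>

lemma exact_TCE_interval_map:
  assumes "exact_TCE T"
  obtains T1 where "interval_map T T1"
proof -
  have maps: "T x \<in> {0..1}" if "x \<in> {0..1}" for x using assms that unfolding exact_TCE_def by blast
  have C3: "C3_on {0..1} T" and crit: "finite (Crit T)" and ex: "topologically_exact T"
    and nf: "\<And>c. c \<in> Crit T \<Longrightarrow> nonflat_at T c"
    using assms by (auto simp: exact_TCE_def)
  let ?R = "{root n \<bar>deriv_ivl (T ^^ n) x\<bar> | n x. n \<ge> 1 \<and> x \<in> unit_ivl \<and> (T ^^ n) x = x}"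
  define lam where "lam = Inf ?R"
  have lam: "lam > 1" using assms by (simp add: exact_TCE_def lam_def)
  obtain T1 where T1: "\<And>x. x \<in> {0..1} \<Longrightarrow> (T has_real_derivative T1 x) (at x within {0..1})" "continuous_on {0..1} T1"
    by (rule C3_on_C1[OF C3]) (rule that; assumption)
  have fmaps: "(T ^^ n) x \<in> {0..1}" if "x \<in> {0..1}" for n x using that maps by (induction n) auto
  have Crit: "Crit T = {x \<in> {0..1}. T1 x = 0}"
    unfolding Crit_def using deriv_ivl_eq[OF T1(1)] by auto
  have chain: "((T ^^ n) has_real_derivative (\<Prod>k<n. T1 ((T ^^ k) x))) (at x within {0..1})"
    if "x \<in> {0..1}" for n x
  proof (induction n)
    case 0
    then show ?case by (simp add: id_def)
  next
    case (Suc n)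
    have "(T has_real_derivative T1 ((T ^^ n) x)) (at ((T ^^ n) x) within (T ^^ n) ` {0..1})"
      by (rule has_field_derivative_subset[OF T1(1)[OF fmaps[OF that]]]) (use fmaps in auto)
    from DERIV_image_chain[OF this Suc] show ?case by (simp only: funpow.simps prod.lessThan_Suc mult.commute)
  qed
  have open_full: "\<exists>n. (T ^^ n) ` U = {0..1}" if "openin (top_of_set {0..1}) U" "U \<noteq> {}" for U
    using ex that by (simp add: topologically_exact_def)
  have "interval_map T T1"
  proof
    show "T x \<in> {0..1}" if "x \<in> {0..1}" for x by (rule maps[OF that])
    show "(T has_real_derivative T1 x) (at x within {0..1})" if "x \<in> {0..1}" for x by (rule T1(1)[OF that])
    show "continuous_on {0..1} T1" by (rule T1(2))
    show "finite {x \<in> {0..1}. T1 x = 0}" using crit Crit by simp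
    show "\<exists>n. (T ^^ n) ` {a..b} = {0..1}" if ab: "a \<in> {0..1}" "b \<in> {0..1}" "a < b" for a b
    proof -
      have "openin (top_of_set {0..1}) {a<..<b}" using ab by (intro open_subset) auto
      then obtain n where n: "(T ^^ n) ` {a<..<b} = {0..1}" using open_full[of "{a<..<b}"] ab(3) by auto
      have "{0..1} \<subseteq> (T ^^ n) ` {a..b}" unfolding n[symmetric] by (intro image_mono) auto
      moreover have "(T ^^ n) ` {a..b} \<subseteq> {0..1}" using fmaps ab(1,2) by (intro image_subsetI) auto
      ultimately show ?thesis by blast
    qed
    show "T ` {0..1} = {0..1}"
    proof -
      have "openin (top_of_set {0..1}) {0<..<1 / 2 :: real}" by (intro open_subset) auto
      then obtain n where n: "(T ^^ n) ` {0<..<1 / 2} = {0..1}" using open_full[of "{0<..<1 / 2}"] by auto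
      have "n \<noteq> 0"
      proof
        assume "n = 0"
        then have "(1 :: real) \<in> {0<..<1 / 2}" using n by auto
        then show False by simp
      qed
      then obtain k where k: "n = Suc k" by (cases n) auto
      have "{0..1} = T ` (T ^^ k) ` {0<..<1 / 2}" using n k by (simp add: image_comp)
      also have "\<dots> \<subseteq> T ` {0..1}" by (intro image_mono image_subsetI fmaps) auto
      finally show ?thesis using maps by blast
    qed
    show "\<exists>\<delta>>0. \<exists>K. \<forall>a b e. 0 \<le> a \<and> a \<le> e \<and> e \<le> b \<and> b \<le> 1 \<and> {a..b} \<subseteq> ball c \<delta> \<longrightarrow>
        (\<exists>u\<in>{a..b}. \<exists>v\<in>{a..b}. (b - a) * \<bar>T1 e\<bar> \<le> K * \<bar>T u - T v\<bar>)"
      if "c \<in> {0..1}" "T1 c = 0" for c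
      by (rule nonflat_at_growth[OF T1(1) that(1) nf]) (use that Crit in auto)
    show "\<exists>lam>1. \<forall>n\<ge>1. \<forall>x\<in>{0..1}. (T ^^ n) x = x \<longrightarrow> lam ^ n \<le> (\<Prod>k<n. \<bar>T1 ((T ^^ k) x)\<bar>)"
    proof (rule exI[of _ lam], intro conjI lam allI ballI impI)
      fix n :: nat and x :: real assume nx: "1 \<le> n" "x \<in> {0..1}" "(T ^^ n) x = x"
      have "bdd_below ?R" by (rule bdd_belowI[of _ 0]) auto
      moreover have "root n \<bar>deriv_ivl (T ^^ n) x\<bar> \<in> ?R" using nx by blast
      ultimately have "lam \<le> root n \<bar>deriv_ivl (T ^^ n) x\<bar>" unfolding lam_def by (intro cInf_lower)
      then have "lam ^ n \<le> root n \<bar>deriv_ivl (T ^^ n) x\<bar> ^ n" using lam by (intro power_mono) auto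
      also have "\<dots> = \<bar>deriv_ivl (T ^^ n) x\<bar>" using nx(1) by simp
      also have "\<dots> = (\<Prod>k<n. \<bar>T1 ((T ^^ k) x)\<bar>)"
        using deriv_ivl_eq[OF chain[OF nx(2)] nx(2)] by (simp add: abs_prod)
      finally show "lam ^ n \<le> (\<Prod>k<n. \<bar>T1 ((T ^^ k) x)\<bar>)" .
    qed
  qed
  then show thesis by (rule that)
qed

lemma (in interval_map) eigenmeasure_conformal_map:
  assumes "holder_continuous_on {0..1} \<psi>" "prob_on_ivl m" "dual_eigenmeasure T \<psi> (exp P) m"
    and "supp_ivl m = {0..1}"
  shows "conformal_map T T1 (\<lambda>x. \<psi> x - P) m"
proof (rule conformal_map.intro[OF interval_map_axioms], rule conformal_map_axioms.intro)
  interpret prob_space m using assms(2) by (simp add: prob_on_ivl_def)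
  show "prob_space m" using assms(2) by (simp add: prob_on_ivl_def)
  show sets_m: "sets m = sets (restrict_space borel {0..1})" using assms(2) by (simp add: prob_on_ivl_def)
  obtain \<alpha> C where C: "0 < \<alpha>" "\<And>x y. x \<in> {0..1} \<Longrightarrow> y \<in> {0..1} \<Longrightarrow> \<bar>\<psi> x - \<psi> y\<bar> \<le> C * \<bar>x - y\<bar> powr \<alpha>"
    using assms(1) unfolding holder_continuous_on_def by blast
  have "\<bar>(\<psi> x - P) - (\<psi> y - P)\<bar> \<le> \<bar>C\<bar> * \<bar>x - y\<bar> powr \<alpha>" if "x \<in> {0..1}" "y \<in> {0..1}" for x y
  proof -
    have "C * \<bar>x - y\<bar> powr \<alpha> \<le> \<bar>C\<bar> * \<bar>x - y\<bar> powr \<alpha>" by (intro mult_right_mono) auto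
    then show ?thesis using C(2)[OF that] by simp
  qed
  then show "\<exists>\<alpha> C. 0 < \<alpha> \<and> 0 \<le> C \<and> (\<forall>x\<in>{0..1}. \<forall>y\<in>{0..1}. \<bar>(\<psi> x - P) - (\<psi> y - P)\<bar> \<le> C * \<bar>x - y\<bar> powr \<alpha>)"
    using C(1) by (intro exI[of _ \<alpha>] exI[of _ "\<bar>C\<bar>"]) auto
  show "(\<integral>x. (\<Sum>y\<in>{y \<in> {0..1}. T y = x}. g y * exp (\<psi> y - P)) \<partial>m) = (\<integral>x. g x \<partial>m)"
    if "g \<in> borel_measurable m" "bounded (g ` {0..1})" for g
  proof -
    have "transfer_op T \<psi> g x = exp P * (\<Sum>y\<in>{y \<in> {0..1}. T y = x}. g y * exp (\<psi> y - P))" for x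
      by (simp add: transfer_op_def sum_distrib_left exp_diff)
    then have "exp P * (\<integral>x. (\<Sum>y\<in>{y \<in> {0..1}. T y = x}. g y * exp (\<psi> y - P)) \<partial>m) = (\<integral>x. transfer_op T \<psi> g x \<partial>m)"
      by (simp only: integral_mult_right_zero)
    also have "\<dots> = exp P * (\<integral>x. g x \<partial>m)" using assms(3) that unfolding dual_eigenmeasure_def by blast
    finally show ?thesis by simp
  qed
  show "measure m {a<..<b} > 0" if ab: "0 \<le> a" "a < b" "b \<le> 1" for a b
  proof -
    have "(a + b) / 2 \<in> supp_ivl m" using assms(4) ab by simp
    moreover have "(b - a) / 2 > 0" using ab by simp
    ultimately have "emeasure m (ball ((a + b) / 2) ((b - a) / 2) \<inter> {0..1}) > 0"
      unfolding supp_ivl_def by blast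
    also have "ball ((a + b) / 2) ((b - a) / 2) = {a<..<b}"
      by (auto simp: dist_real_def field_simps abs_if split: if_splits)
    also have "{a<..<b} \<inter> {0..1} = {a<..<b}" using ab by auto
    finally show ?thesis by (simp add: emeasure_eq_measure)
  qed
qed

text \<open>The conclusion for almost every \<open>x\<close> holds with every centre \<open>y\<close> in the
  interval.\<close>

theorem theorem24:
  fixes T \<psi> :: "real \<Rightarrow> real" and m \<mu> :: "real measure"
  assumes "exact_TCE T" and "tame T"
    and "holder_continuous_on unit_ivl \<psi>"
    and "prob_on_ivl m" and "dual_eigenmeasure T \<psi> (exp (pressure T \<psi>)) m"
    and "supp_ivl m = unit_ivl"
    and "prob_on_ivl \<mu>" and "invariant_measure T \<mu>" and "absolutely_continuous m \<mu>"
  shows "AE y in \<mu>. AE x in \<mu>.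
    Limsup (at_right 0) (\<lambda>r. ennreal_of_enat (hitting_time T (ball y r \<inter> unit_ivl) x)
                              * emeasure \<mu> (ball y r \<inter> unit_ivl)) = \<infinity>"
proof -
  obtain T1 where "interval_map T T1" by (rule exact_TCE_interval_map[OF assms(1)])
  then interpret interval_map T T1 .
  interpret conformal_map T T1 "\<lambda>x. \<psi> x - pressure T \<psi>" m
    by (rule eigenmeasure_conformal_map[OF assms(3-6)])
  obtain K \<theta> \<Delta> C2 q r where "hyperbolic_scale T T1 (\<lambda>x. \<psi> x - pressure T \<psi>) m K \<theta> \<Delta> C2 q r"
    by (rule hyperbolic_scale_exists)
  then interpret hyperbolic_scale T T1 "\<lambda>x. \<psi> x - pressure T \<psi>" m K \<theta> \<Delta> C2 q r .
  obtain F R where "gap_partition T T1 (\<lambda>x. \<psi> x - pressure T \<psi>) m K \<theta> \<Delta> C2 q r F R"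
    by (rule gap_partition_exists)
  then interpret gap_partition T T1 "\<lambda>x. \<psi> x - pressure T \<psi>" m K \<theta> \<Delta> C2 q r F R .
  have \<mu>: "prob_space \<mu>" "sets \<mu> = sets m" using assms(7) sets_m by (auto simp: prob_on_ivl_def)
  have inv: "distr \<mu> \<mu> T = \<mu>" "T \<in> measurable \<mu> \<mu>" using assms(8) by (auto simp: invariant_measure_def)
  have "space \<mu> = {0..1}" using sets_eq_imp_space_eq[OF \<mu>(2)] space_m by simp
  then show ?thesis
    by (intro AE_I2 hitting_time_limsup[OF \<mu> inv assms(9)]) simp
qed

end
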